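(* Let $R$ be an almost Dedekind domain which is SP-scattered, and let $\alpha$ be its SP-rank. Then \[ \mathrm{Inv}(R)\simeq\bigoplus_{i<\alpha}\mathcal{C}_c\big(\mathrm{Crit}_i(R)\setminus\mathrm{Crit}_{i+1}(R),\mathbb{Z}\big) \] as abelian groups; in particular, $\mathrm{Inv}(R)$ is a free abelian group.
   Context: An almost Dedekind domain is an integral domain $R$ such that $R_M$ is a discrete valuation ring for every maximal ideal $M$; let $K$ be its quotient field. $\mathrm{Inv}(R)$ is the group of invertible fractional ideals of $R$ under multiplication. $\mathcal{M}$ denotes $\mathrm{Max}(R)$ endowed with the inverse topology (the restriction to $\mathrm{Max}(R)$ of the coarsest topology on $\mathrm{Spec}(R)$ in which every Zariski-open Zariski-compact set is closed; on $\mathrm{Max}(R)$ it coincides with the constructible topology). Subsets of $\mathcal{M}$ carry the subspace topology. For a topological space $X$, $\mathcal{C}_c(X,\mathbb{Z})$ is the group (under pointwise addition) of continuous functions $X\to\mathbb{Z}$ ($\mathbb{Z}$ discrete) with compact support, the support being the closure of the set where the function is nonzero. A maximal ideal $M$ of an almost Dedekind domain $A$ is critical if for every finitely generated ideal $I\subseteq M$ there is a maximal ideal $N$ with $I\subseteq N^2$; $\mathrm{Crit}(A)$ is the set of critical maximal ideals. Define recursively for ordinals $\alpha$: $\mathrm{Crit}_0(R)=\mathrm{Max}(R)$, $T_0=R$; if $\alpha=\gamma+1$, $\mathrm{Crit}_\alpha(R)=\{P\in\mathrm{Max}(R)\mid PT_\gamma\in\mathrm{Crit}(T_\gamma)\}$;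 if $\alpha$ is a limit ordinal, $\mathrm{Crit}_\alpha(R)=\bigcap_{\gamma<\alpha}\mathrm{Crit}_\gamma(R)$; and $T_\alpha=\bigcap\{R_P\mid P\in\mathrm{Crit}_\alpha(R)\}$ (equal to $K$ if the set is empty; each $T_\alpha$ is again almost Dedekind). The SP-rank of $R$ is the least ordinal $\alpha$ with $\mathrm{Crit}_\alpha(R)=\mathrm{Crit}_{\alpha+1}(R)$; $R$ is SP-scattered if $\mathrm{Crit}_\alpha(R)=\emptyset$ for this $\alpha$. *)

theory Defs
  imports "HOL-Analysis.Analysis" "HOL-Algebra.Product_Groups" "HOL-Algebra.Free_Abelian_Groups"
begin

text \<open>Setting: K is the field 'k (UNIV), and rings are subrings of K.
  An integral domain R with quotient field K is encoded as a subring R of 'k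
  such that every element of 'k is a quotient of elements of R.\<close>

definition subring :: "'k::field set \<Rightarrow> bool" where
  "subring R \<longleftrightarrow> 0 \<in> R \<and> 1 \<in> R \<and>
     (\<forall>x\<in>R. \<forall>y\<in>R. x + y \<in> R \<and> x * y \<in> R \<and> - x \<in> R)"

definition has_quotient_field :: "'k::field set \<Rightarrow> bool" where
  "has_quotient_field R \<longleftrightarrow> (\<forall>x. \<exists>a\<in>R. \<exists>b\<in>R. b \<noteq> 0 \<and> x = a / b)"

definition is_ideal :: "'k::field set \<Rightarrow> 'k set \<Rightarrow> bool" where
  "is_ideal R I \<longleftrightarrow> I \<subseteq> R \<and> 0 \<in> I \<and> (\<forall>x\<in>I. \<forall>y\<in>I. x + y \<in> I) \<and>
     (\<forall>r\<in>R. \<forall>x\<in>I. r * x \<in> I)"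

definition prime_ideals :: "'k::field set \<Rightarrow> 'k set set" where
  "prime_ideals R = {P. is_ideal R P \<and> P \<noteq> R \<and>
     (\<forall>x\<in>R. \<forall>y\<in>R. x * y \<in> P \<longrightarrow> x \<in> P \<or> y \<in> P)}"

definition max_ideals :: "'k::field set \<Rightarrow> 'k set set" where
  "max_ideals R = {M. is_ideal R M \<and> M \<noteq> R \<and>
     (\<forall>J. is_ideal R J \<and> M \<subseteq> J \<longrightarrow> J = M \<or> J = R)}"

definition ideal_mult :: "'k::field set \<Rightarrow> 'k set \<Rightarrow> 'k set" where
  "ideal_mult A B = {z. \<exists>(n::nat) f g. (\<forall>i<n. f i \<in> A \<and> g i \<in> B) \<and> z = (\<Sum>i<n. f i * g i)}"

definition gen_ideal :: "'k::field set \<Rightarrow> 'k set \<Rightarrow> 'k set" where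
  "gen_ideal R F = {z. \<exists>c. (\<forall>f\<in>F. c f \<in> R) \<and> z = (\<Sum>f\<in>F. c f * f)}"

definition fin_gen_ideal :: "'k::field set \<Rightarrow> 'k set \<Rightarrow> bool" where
  "fin_gen_ideal R I \<longleftrightarrow> (\<exists>F. finite F \<and> F \<subseteq> R \<and> I = gen_ideal R F)"

definition localization :: "'k::field set \<Rightarrow> 'k set \<Rightarrow> 'k set" where
  "localization R P = {a / b | a b. a \<in> R \<and> b \<in> R \<and> b \<notin> P}"

definition is_dvr :: "'k::field set \<Rightarrow> bool" where
  "is_dvr V \<longleftrightarrow> (\<exists>v :: 'k \<Rightarrow> int.
     (\<forall>x y. x \<noteq> 0 \<longrightarrow> y \<noteq> 0 \<longrightarrow> v (x * y) = v x + v y) \<and>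
     (\<forall>x y. x \<noteq> 0 \<longrightarrow> y \<noteq> 0 \<longrightarrow> x + y \<noteq> 0 \<longrightarrow> min (v x) (v y) \<le> v (x + y)) \<and>
     (\<exists>t. t \<noteq> 0 \<and> v t = 1) \<and>
     V = {x. x = 0 \<or> 0 \<le> v x})"

definition almost_dedekind :: "'k::field set \<Rightarrow> bool" where
  "almost_dedekind R \<longleftrightarrow> subring R \<and> has_quotient_field R \<and>
     (\<forall>M\<in>max_ideals R. is_dvr (localization R M))"

definition critical_ideals :: "'k::field set \<Rightarrow> 'k set set" where
  "critical_ideals A = {M. M \<in> max_ideals A \<and> (\<forall>J. fin_gen_ideal A J \<and> J \<subseteq> M \<longrightarrow>
      (\<exists>Nm. Nm \<in> max_ideals A \<and> J \<subseteq> ideal_mult Nm Nm))}"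

text \<open>T = intersection of the R_P for P in S (equal to K = UNIV if S is empty).\<close>
definition overring :: "'k::field set \<Rightarrow> 'k set set \<Rightarrow> 'k set" where
  "overring R S = \<Inter> ((localization R) ` S)"

text \<open>Ordinals are represented by the elements of a well-order r.
  b is the immediate predecessor of a (i.e. a = b + 1).\<close>
definition is_pred :: "'o rel \<Rightarrow> 'o \<Rightarrow> 'o \<Rightarrow> bool" where
  "is_pred r b a \<longleftrightarrow> (b, a) \<in> r \<and> b \<noteq> a \<and>
     \<not> (\<exists>c. (b, c) \<in> r \<and> c \<noteq> b \<and> (c, a) \<in> r \<and> c \<noteq> a)"

definition wsucc :: "'o rel \<Rightarrow> 'o \<Rightarrow> 'o" where
  "wsucc r b = (SOME a. is_pred r b a)"

definition crit_step :: "'k::field set \<Rightarrow> 'o rel \<Rightarrow> ('o \<Rightarrow> 'k set set) \<Rightarrow> 'o \<Rightarrow> 'k set set" where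
  "crit_step R r f a =
     (if \<exists>b. is_pred r b a then
        (let T = overring R (f (THE b. is_pred r b a))
         in {P \<in> max_ideals R. ideal_mult P T \<in> critical_ideals T})
      else max_ideals R \<inter> \<Inter> (f ` {b. (b, a) \<in> r \<and> b \<noteq> a}))"

text \<open>Crit_a(R) for a in the field of the well-order r (zero and limit
  stages: intersection of earlier stages, intersected with Max(R)).\<close>
definition crit_seq :: "'k::field set \<Rightarrow> 'o rel \<Rightarrow> 'o \<Rightarrow> 'k set set" where
  "crit_seq R r = wfrec (r - Id) (crit_step R r)"

definition is_SP_rank :: "'k::field set \<Rightarrow> 'o rel \<Rightarrow> 'o \<Rightarrow> bool" where
  "is_SP_rank R r a \<longleftrightarrow> a \<in> Field r \<and> (\<exists>c. is_pred r a c) \<and>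
     crit_seq R r a = crit_seq R r (wsucc r a) \<and>
     (\<forall>b. (b, a) \<in> r \<and> b \<noteq> a \<longrightarrow> crit_seq R r b \<noteq> crit_seq R r (wsucc r b))"

definition zariski :: "'k::field set \<Rightarrow> 'k set topology" where
  "zariski R = topology_generated_by {{P \<in> prime_ideals R. f \<notin> P} | f. f \<in> R}"

definition inverse_topology :: "'k::field set \<Rightarrow> 'k set topology" where
  "inverse_topology R = topology_generated_by
     {prime_ideals R - U | U. openin (zariski R) U \<and> compactin (zariski R) U}"

definition max_inverse :: "'k::field set \<Rightarrow> 'k set topology" where
  "max_inverse R = subtopology (inverse_topology R) (max_ideals R)"

definition Cc_group :: "'a topology \<Rightarrow> ('a \<Rightarrow> int) monoid" where
  "Cc_group X = \<lparr>carrier = {f. continuous_map X (discrete_topology UNIV) f \<and>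
        compactin X (X closure_of {x \<in> topspace X. f x \<noteq> 0}) \<and>
        (\<forall>x. x \<notin> topspace X \<longrightarrow> f x = 0)},
     monoid.mult = (\<lambda>f g x. f x + g x), one = (\<lambda>x. 0)\<rparr>"

definition frac_ideal :: "'k::field set \<Rightarrow> 'k set \<Rightarrow> bool" where
  "frac_ideal R I \<longleftrightarrow> 0 \<in> I \<and> I \<noteq> {0} \<and> (\<forall>x\<in>I. \<forall>y\<in>I. x + y \<in> I) \<and>
     (\<forall>r\<in>R. \<forall>x\<in>I. r * x \<in> I) \<and> (\<exists>d\<in>R. d \<noteq> 0 \<and> (\<forall>x\<in>I. d * x \<in> R))"

definition invertible_ideal :: "'k::field set \<Rightarrow> 'k set \<Rightarrow> bool" where
  "invertible_ideal R I \<longleftrightarrow> frac_ideal R I \<and> (\<exists>J. frac_ideal R J \<and> ideal_mult I J = R)"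

definition Inv_group :: "'k::field set \<Rightarrow> 'k set monoid" where
  "Inv_group R = \<lparr>carrier = {I. invertible_ideal R I}, monoid.mult = ideal_mult, one = R\<rparr>"

end

theory Submission
  imports Defs "HOL-Library.Function_Algebras"
begin

text \<open>
  An invertible ideal $I$ is determined by the function $\nu_I : M \mapsto v_M(I)$ on $\mathrm{Max}(R)$, and these
  functions form a lattice-ordered group $G$ whose sets $\{\nu > 0\}$ are the basic compact open sets
  of the inverse topology. For closed $C$, restriction of $G$ to $C$ describes the invertible ideals of
  $T = \bigcap_{P \in C} R_P$, and a point of $C$ is noncritical for $T$ iff some nonnegative function in
  $G|_C$ takes the value 1 there and is bounded by 1. Hence every function in $G$ that vanishes on the
  critical points is locally constant on their complement in $C$, and conversely
  every compactly supported continuous function there is induced by $G$. Filtering $G$ by the subgroups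
  $H_i$ of functions vanishing on $\mathrm{Crit}_i(R)$, the graded piece $H_{i+1}/H_i$ is therefore
  $\mathcal{C}_c(\mathrm{Crit}_i(R) \setminus \mathrm{Crit}_{i+1}(R), \mathbb{Z})$, and the filtration is continuous at
  limits by compactness. The filtration splits because these groups are free.

  The latter is a theorem of Noebeling. Well-order the generating sets and filter by initial segments;
  multiplication by the indicator of the $k$-th generator identifies the $k$-th graded piece with a
  quotient of the unital ring generated by the earlier ones by an ideal that is pure as a subgroup,
  so induction over all such quotients applies.
\<close>

subsection \<open>Relative bases of integer modules\<close>

text \<open>A value function need not be locally constant at a critical point, because no element of
  the group that is 0 or 1 on the closed set is available there to isolate a level set. So the whole
  group is not a group of continuous functions, and only its graded pieces are. The spaces carrying
  these pieces need not be compact, so their function groups may have no unit, while the induction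
  for freeness needs one; hence the span is used both with and without \<open>UNIV\<close>. Purity
  means that the quotient is torsion free. It has to be carried along, since multiplication by an
  indicator modulo the earlier generators produces a new ideal at each stage. Quotients are never
  formed. \<open>rel_basis N M B\<close> records a basis of M / N by representatives in M, so the
  filtration by initial segments of generators and the one by critical sets both stay in one type of
  functions and are handled by the same lemma \<open>rel_basis_filtration\<close>. Choosing
  representatives is also what splits a filtration: their union is a basis of the whole group, and
  its partition into stages gives the direct sum.\<close>

interpretation zmod: module "\<lambda>(n::int) (f::'v::comm_ring_1). of_int n * f"
  by unfold_locales (simp_all add: algebra_simps)

abbreviation lincomb :: "('v::comm_ring_1 \<Rightarrow> int) \<Rightarrow> 'v set \<Rightarrow> 'v" where
  "lincomb c F \<equiv> \<Sum>b\<in>F. of_int (c b) * b"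

abbreviation zlinear :: "('v::comm_ring_1 \<Rightarrow> 'w::comm_ring_1) \<Rightarrow> bool" where
  "zlinear \<equiv> module_hom (\<lambda>n x. of_int n * x) (\<lambda>n x. of_int n * x)"

lemma zlinearI:
  assumes "\<And>x y. \<phi> (x + y) = \<phi> x + \<phi> y" "\<And>n x. \<phi> (of_int n * x) = of_int n * \<phi> x"
  shows "zlinear \<phi>"
  by (intro module_hom.intro module_hom_axioms.intro zmod.module_axioms assms)

lemma lincomb_in_subspace: "zmod.subspace M \<Longrightarrow> F \<subseteq> M \<Longrightarrow> lincomb c F \<in> M"
  by (intro zmod.subspace_sum zmod.subspace_scale) auto

lemma zlinear_lincomb:
  assumes "zlinear \<phi>"
  shows "\<phi> (lincomb c F) = (\<Sum>b\<in>F. of_int (c b) * \<phi> b)"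
  by (simp only: module_hom.sum[OF assms] module_hom.scale[OF assms])

lemma Well_orderD:
  assumes "Well_order r"
  shows "\<And>i j. i \<in> Field r \<Longrightarrow> j \<in> Field r \<Longrightarrow> (i, j) \<in> r \<or> (j, i) \<in> r"
    "\<And>i j. (i, j) \<in> r \<Longrightarrow> (j, i) \<in> r \<Longrightarrow> i = j"
    "\<And>i j k. (i, j) \<in> r \<Longrightarrow> (j, k) \<in> r \<Longrightarrow> (i, k) \<in> r"
    "wf (r - Id)"
proof -
  have wo: "total_on (Field r) r" "refl_on (Field r) r" "antisym r" "trans r" "wf (r - Id)"
    using assms unfolding well_order_on_def linear_order_on_def partial_order_on_def preorder_on_def by auto
  show "(i, j) \<in> r \<or> (j, i) \<in> r" if "i \<in> Field r" "j \<in> Field r" for i j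
    using wo(1,2) that unfolding total_on_def refl_on_def by (cases "i = j") auto
  show "i = j" if "(i, j) \<in> r" "(j, i) \<in> r" for i j
    using wo(3) that by (rule antisymD)
  show "(i, k) \<in> r" if "(i, j) \<in> r" "(j, k) \<in> r" for i j k
    using wo(4) that by (rule transD)
  show "wf (r - Id)" by (rule wo(5))
qed

lemma Well_order_finite_max:
  assumes r: "Well_order r" and E: "finite E" "E \<noteq> {}" "E \<subseteq> Field r"
  obtains m where "m \<in> E" "\<And>x. x \<in> E \<Longrightarrow> (x, m) \<in> r"
proof -
  let ?R = "\<lambda>x y. (x, y) \<in> r - Id"
  have "asymp_on E ?R" using Well_orderD(2)[OF r] by (auto intro!: asymp_onI)
  moreover have "transp_on E ?R"
  proof (rule transp_onI)
    fix x y z assume "?R x y" "?R y z"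
    then show "?R x z" using Well_orderD(2)[OF r, of x y] Well_orderD(3)[OF r, of x y z] by auto
  qed
  ultimately obtain m where m: "m \<in> E" "\<forall>x\<in>E. x \<noteq> m \<longrightarrow> \<not> ?R m x"
    using Finite_Set.bex_max_element[OF E(1) _ _ E(2), of ?R] by blast
  have "(x, m) \<in> r" if "x \<in> E" for x
    using m that Well_orderD(1)[OF r, of m x] E(3) by (cases "x = m") auto
  then show ?thesis using that m(1) by blast
qed

text \<open>For \<open>N \<subseteq> M\<close>, the set \<open>B\<close> maps bijectively to a basis of \<open>M / N\<close>.\<close>

definition rel_basis :: "'v::comm_ring_1 set \<Rightarrow> 'v set \<Rightarrow> 'v set \<Rightarrow> bool" where
  "rel_basis N M B \<longleftrightarrow> B \<subseteq> M \<and> M \<subseteq> zmod.span (B \<union> N) \<and>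
     (\<forall>F c. finite F \<and> F \<subseteq> B \<and> lincomb c F \<in> N \<longrightarrow> (\<forall>b\<in>F. c b = 0))"

lemma rel_basisD:
  assumes "rel_basis N M B"
  shows "B \<subseteq> M" "M \<subseteq> zmod.span (B \<union> N)"
    "\<And>F c b. \<lbrakk>finite F; F \<subseteq> B; lincomb c F \<in> N; b \<in> F\<rbrakk> \<Longrightarrow> c b = 0"
proof -
  show "B \<subseteq> M" "M \<subseteq> zmod.span (B \<union> N)" using assms unfolding rel_basis_def by auto
  fix F c b assume A: "finite F" "F \<subseteq> B" "lincomb c F \<in> N" "b \<in> F"
  from assms have "\<forall>F c. finite F \<and> F \<subseteq> B \<and> lincomb c F \<in> N \<longrightarrow> (\<forall>b\<in>F. c b = 0)"
    unfolding rel_basis_def by simp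
  from this[THEN spec[of _ F], THEN spec[of _ c]] show "c b = 0" using A by simp
qed

lemma rel_basis_disjoint:
  assumes "rel_basis N M B" "b \<in> B"
  shows "b \<notin> N"
  using rel_basisD(3)[OF assms(1), of "{b}" "\<lambda>_. 1" b] assms(2) by auto

text \<open>Independence is tested from the top: modulo \<open>N1\<close> only the part over
  \<open>B\<close> survives, and once its coefficients vanish, the part over \<open>B1\<close> is
  tested modulo \<open>N\<close>.\<close>

lemma rel_basis_trans:
  assumes N: "zmod.subspace N1" "N \<subseteq> N1"
    and B1: "rel_basis N N1 B1" and B: "rel_basis N1 M B" and NM: "N1 \<subseteq> M"
  shows "rel_basis N M (B1 \<union> B)"
  unfolding rel_basis_def
proof (intro conjI allI impI ballI)
  show "B1 \<union> B \<subseteq> M" using rel_basisD(1)[OF B1] rel_basisD(1)[OF B] NM by blast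
  have "N1 \<subseteq> zmod.span (B1 \<union> B \<union> N)"
    using rel_basisD(2)[OF B1] zmod.span_mono[of "B1 \<union> N" "B1 \<union> B \<union> N"] by blast
  moreover have "B \<subseteq> zmod.span (B1 \<union> B \<union> N)"
    using zmod.span_superset[of "B1 \<union> B \<union> N"] by blast
  ultimately have "zmod.span (B \<union> N1) \<subseteq> zmod.span (B1 \<union> B \<union> N)"
    by (intro zmod.span_minimal) auto
  then show "M \<subseteq> zmod.span (B1 \<union> B \<union> N)" using rel_basisD(2)[OF B] by blast
  fix F c b
  assume A: "finite F \<and> F \<subseteq> B1 \<union> B \<and> lincomb c F \<in> N" and bF: "b \<in> F"
  have dis: "B1 \<inter> B = {}" using rel_basis_disjoint[OF B] rel_basisD(1)[OF B1] by blast
  have "F = (F \<inter> B1) \<union> (F \<inter> B)" using A by blast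
  then have eq: "lincomb c F = lincomb c (F \<inter> B1) + lincomb c (F \<inter> B)"
    using sum.union_disjoint[of "F \<inter> B1" "F \<inter> B" "\<lambda>b. of_int (c b) * b"] A dis by auto
  have "lincomb c (F \<inter> B1) \<in> N1"
    using rel_basisD(1)[OF B1] by (intro zmod.subspace_sum[OF N(1)] zmod.subspace_scale[OF N(1)]) auto
  moreover have "lincomb c F \<in> N1" using A N(2) by blast
  ultimately have "lincomb c (F \<inter> B) \<in> N1"
    using zmod.subspace_diff[OF N(1)] unfolding eq by fastforce
  moreover have "finite (F \<inter> B)" using A by blast
  ultimately have z: "\<forall>b\<in>F\<inter>B. c b = 0" using rel_basisD(3)[OF B, of "F \<inter> B" c] by blast
  then have "lincomb c (F \<inter> B) = 0" by (intro sum.neutral) auto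
  then have "lincomb c (F \<inter> B1) \<in> N" using A eq by simp
  moreover have "finite (F \<inter> B1)" using A by blast
  ultimately have "\<forall>b\<in>F\<inter>B1. c b = 0" using rel_basisD(3)[OF B1, of "F \<inter> B1" c] by blast
  then show "c b = 0" using z bF A by blast
qed

text \<open>\<open>L i\<close> and \<open>U i\<close> are the lower and upper ends of the graded
  piece at i. \<open>Lcont\<close> and \<open>Mcont\<close> forbid new elements at limits: whatever
  is not in \<open>N\<close> has already entered at some earlier upper end. Spanning goes by
  well-founded induction, independence by the largest index that occurs in a relation.\<close>

lemma rel_basis_filtration:
  fixes L U B :: "'o \<Rightarrow> 'v::comm_ring_1 set"
  assumes r: "Well_order r" and I: "I \<subseteq> Field r"
    and L: "\<And>i. i \<in> I \<Longrightarrow> zmod.subspace (L i)"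
    and NL: "\<And>i. i \<in> I \<Longrightarrow> N \<subseteq> L i"
    and UL: "\<And>i j. \<lbrakk>i \<in> I; j \<in> I; (i, j) \<in> r; i \<noteq> j\<rbrakk> \<Longrightarrow> U i \<subseteq> L j"
    and Lcont: "\<And>i x. \<lbrakk>i \<in> I; x \<in> L i\<rbrakk> \<Longrightarrow> x \<in> N \<or> (\<exists>j\<in>I. (j, i) \<in> r \<and> j \<noteq> i \<and> x \<in> U j)"
    and Mcont: "\<And>x. x \<in> M \<Longrightarrow> x \<in> N \<or> (\<exists>j\<in>I. x \<in> U j)"
    and UM: "\<And>i. i \<in> I \<Longrightarrow> U i \<subseteq> M"
    and B: "\<And>i. i \<in> I \<Longrightarrow> rel_basis (L i) (U i) (B i)"
  shows "disjoint_family_on B I \<and> rel_basis N M (\<Union>i\<in>I. B i)"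
proof
  have tot: "\<And>i j. i \<in> I \<Longrightarrow> j \<in> I \<Longrightarrow> (i, j) \<in> r \<or> (j, i) \<in> r"
    using Well_orderD(1)[OF r] I by blast
  note asym = Well_orderD(2)[OF r] and trn = Well_orderD(3)[OF r] and wf = Well_orderD(4)[OF r]
  have BL: "B i \<subseteq> L j" if "i \<in> I" "j \<in> I" "(i, j) \<in> r" "i \<noteq> j" for i j
    using rel_basisD(1)[OF B] UL that by blast
  show "disjoint_family_on B I"
    unfolding disjoint_family_on_def
  proof (intro ballI impI)
    fix i j assume ij: "i \<in> I" "j \<in> I" "i \<noteq> j"
    then consider "(i, j) \<in> r" | "(j, i) \<in> r" using tot by blast
    then show "B i \<inter> B j = {}"
    proof cases
      case 1 then show ?thesis using BL[of i j] rel_basis_disjoint[OF B[of j]] ij by blast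
    next
      case 2 then show ?thesis using BL[of j i] rel_basis_disjoint[OF B[of i]] ij by blast
    qed
  qed
  have sp: "U i \<subseteq> zmod.span ((\<Union>i\<in>I. B i) \<union> N)" if "i \<in> I" for i
    using that
  proof (induction i rule: wf_induct_rule[OF wf])
    case (1 i)
    have "L i \<subseteq> zmod.span ((\<Union>i\<in>I. B i) \<union> N)"
    proof
      fix x assume x: "x \<in> L i"
      then consider "x \<in> N" | j where "j \<in> I" "(j, i) \<in> r - Id" "x \<in> U j"
        using Lcont[OF 1(2)] by blast
      then show "x \<in> zmod.span ((\<Union>i\<in>I. B i) \<union> N)"
        using 1(1) zmod.span_superset[of "(\<Union>i\<in>I. B i) \<union> N"] by cases blast+
    qed
    moreover have "B i \<subseteq> zmod.span ((\<Union>i\<in>I. B i) \<union> N)"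
      using 1(2) zmod.span_superset[of "(\<Union>i\<in>I. B i) \<union> N"] by blast
    ultimately have "zmod.span (B i \<union> L i) \<subseteq> zmod.span ((\<Union>i\<in>I. B i) \<union> N)"
      by (intro zmod.span_minimal) auto
    then show ?case using rel_basisD(2)[OF B[OF 1(2)]] by blast
  qed
  show "rel_basis N M (\<Union>i\<in>I. B i)"
    unfolding rel_basis_def
  proof (intro conjI allI impI)
    show "(\<Union>i\<in>I. B i) \<subseteq> M" using rel_basisD(1)[OF B] UM by blast
    show "M \<subseteq> zmod.span ((\<Union>i\<in>I. B i) \<union> N)"
      using Mcont sp zmod.span_superset[of "(\<Union>i\<in>I. B i) \<union> N"] by blast
    fix F c assume A: "finite F \<and> F \<subseteq> (\<Union>i\<in>I. B i) \<and> lincomb c F \<in> N"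
    show "\<forall>b\<in>F. c b = 0"
    proof (rule ccontr)
      assume nz: "\<not> (\<forall>b\<in>F. c b = 0)"
      \<comment> \<open>Zero coefficients are dropped so that the piece with the largest index
        really occurs with a nonzero coefficient.\<close>
      define F' where "F' = {b\<in>F. c b \<noteq> 0}"
      have F': "finite F'" "F' \<noteq> {}" "F' \<subseteq> (\<Union>i\<in>I. B i)" using A nz unfolding F'_def by auto
      have "lincomb c F' = lincomb c F"
        unfolding F'_def using A by (intro sum.mono_neutral_left) auto
      then have N: "lincomb c F' \<in> N" using A by simp
      obtain k where k: "\<And>b. b \<in> F' \<Longrightarrow> k b \<in> I \<and> b \<in> B (k b)" using F'(3) by (metis UN_E subsetD)
      have kI: "k ` F' \<subseteq> I" using k by auto
      obtain m where m: "m \<in> k ` F'" and mmax: "\<And>x. x \<in> k ` F' \<Longrightarrow> (x, m) \<in> r"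
        using Well_order_finite_max[OF r, of "k ` F'"] F'(1,2) kI I by auto
      have mI: "m \<in> I" using kI m by auto
      have "F' = (F' \<inter> B m) \<union> (F' - B m)" by blast
      then have eq: "lincomb c F' = lincomb c (F' \<inter> B m) + lincomb c (F' - B m)"
        using sum.union_disjoint[of "F' \<inter> B m" "F' - B m" "\<lambda>b. of_int (c b) * b"] F'(1) by auto
      have "b \<in> L m" if "b \<in> F' - B m" for b
      proof -
        have "k b \<noteq> m" using k that by blast
        then show ?thesis using BL[of "k b" m] mmax[of "k b"] k[of b] that mI by auto
      qed
      then have "lincomb c (F' - B m) \<in> L m"
        by (intro zmod.subspace_sum[OF L[OF mI]] zmod.subspace_scale[OF L[OF mI]]) auto
      moreover have "lincomb c F' \<in> L m" using N NL[OF mI] by blast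
      ultimately have "lincomb c (F' \<inter> B m) \<in> L m"
        using zmod.subspace_diff[OF L[OF mI]] unfolding eq by fastforce
      moreover have "finite (F' \<inter> B m)" using F'(1) by blast
      ultimately have "\<forall>b\<in>F' \<inter> B m. c b = 0"
        using rel_basisD(3)[OF B[OF mI], of "F' \<inter> B m" c] by blast
      moreover have "F' \<inter> B m \<noteq> {}" using m k by fastforce
      ultimately show False unfolding F'_def by blast
    qed
  qed
qed

text \<open>By \<open>ker\<close> and \<open>onto\<close>, \<open>\<phi>\<close> induces an
  isomorphism from M / N to M' / N'. It will be multiplication by an indicator, which carries a
  quotient of a smaller ring to a graded piece.\<close>

lemma rel_basis_push:
  fixes \<phi> :: "'v::comm_ring_1 \<Rightarrow> 'w::comm_ring_1"
  assumes \<phi>: "zlinear \<phi>" and M: "zmod.subspace M"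
    and ker: "\<And>x. x \<in> M \<Longrightarrow> \<phi> x \<in> N' \<longleftrightarrow> x \<in> N" and N: "N \<subseteq> M"
    and N': "zmod.subspace N'" and im: "\<phi> ` M \<subseteq> M'"
    and onto: "\<And>y. y \<in> M' \<Longrightarrow> \<exists>x\<in>M. y - \<phi> x \<in> N'" and B: "rel_basis N M B"
  shows "rel_basis N' M' (\<phi> ` B)"
proof -
  have BM: "B \<subseteq> M" by (rule rel_basisD(1)[OF B])
  have ind: "c b = 0" if F: "finite F" "F \<subseteq> B" "(\<Sum>b\<in>F. of_int (c b) * \<phi> b) \<in> N'" "b \<in> F" for F c b
  proof -
    have "lincomb c F \<in> M" using M F(2) BM by (intro lincomb_in_subspace) auto
    moreover have "\<phi> (lincomb c F) \<in> N'" unfolding zlinear_lincomb[OF \<phi>] by (rule F(3))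
    ultimately have "lincomb c F \<in> N" using ker by blast
    then show ?thesis using rel_basisD(3)[OF B F(1,2)] F(4) by blast
  qed
  have inj: "inj_on \<phi> B"
  proof (rule inj_onI, rule ccontr)
    fix x y assume xy: "x \<in> B" "y \<in> B" "\<phi> x = \<phi> y" "x \<noteq> y"
    \<comment> \<open>Equal images would give the relation with coefficients 1 and -1 modulo
      \<open>N'\<close>.\<close>
    have "(1::int) = 0"
      using ind[of "{x, y}" "\<lambda>b. if b = x then 1 else -1" x] xy zmod.subspace_0[OF N'] by auto
    then show False by simp
  qed
  show ?thesis unfolding rel_basis_def
  proof (intro conjI allI impI ballI)
    show "\<phi> ` B \<subseteq> M'" using BM im by blast
    have "\<phi> ` N \<subseteq> N'" using ker N by blast
    then have "zmod.span (\<phi> ` (B \<union> N)) \<subseteq> zmod.span (\<phi> ` B \<union> N')"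
      by (intro zmod.span_mono) auto
    then have sp: "\<phi> ` M \<subseteq> zmod.span (\<phi> ` B \<union> N')"
      using module_hom.spans_image[OF \<phi> rel_basisD(2)[OF B]] by (rule order_trans[rotated])
    show "M' \<subseteq> zmod.span (\<phi> ` B \<union> N')"
    proof
      fix y assume "y \<in> M'"
      then obtain x where x: "x \<in> M" "y - \<phi> x \<in> N'" using onto by blast
      have "y - \<phi> x \<in> zmod.span (\<phi> ` B \<union> N')" using x(2) by (intro zmod.span_base) blast
      moreover have "\<phi> x \<in> zmod.span (\<phi> ` B \<union> N')" using sp x(1) by blast
      ultimately show "y \<in> zmod.span (\<phi> ` B \<union> N')" using zmod.span_add by fastforce
    qed
    fix F c y assume A: "finite F \<and> F \<subseteq> \<phi> ` B \<and> lincomb c F \<in> N'" and y: "y \<in> F"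
    then obtain F' where F': "F' \<subseteq> B" "F = \<phi> ` F'" "finite F'"
      using finite_subset_image[of F \<phi> B] by auto
    have "lincomb c F = (\<Sum>b\<in>F'. of_int (c (\<phi> b)) * \<phi> b)"
      unfolding F'(2) sum.reindex[OF inj_on_subset[OF inj F'(1)]] by simp
    then have "(\<Sum>b\<in>F'. of_int (c (\<phi> b)) * \<phi> b) \<in> N'" using A by simp
    then show "c y = 0" using ind[OF F'(3,1), of "\<lambda>b. c (\<phi> b)"] y F'(2) by blast
  qed
qed

text \<open>A surjection onto a free group splits, so arbitrary preimages of a basis form a basis
  modulo the kernel. The bijection is kept because the set of preimages will later index the free
  group.\<close>

lemma rel_basis_lift:
  fixes \<phi> :: "'v::comm_ring_1 \<Rightarrow> 'w::comm_ring_1"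
  assumes \<phi>: "zlinear \<phi>" and M: "zmod.subspace M"
    and ker: "\<And>x. x \<in> M \<Longrightarrow> \<phi> x = 0 \<longleftrightarrow> x \<in> N"
    and onto: "\<phi> ` M = M'" and B: "rel_basis {0} M' B"
  shows "\<exists>S. rel_basis N M S \<and> bij_betw \<phi> S B"
proof -
  have "\<exists>x. x \<in> M \<and> \<phi> x = b" if "b \<in> B" for b
  proof -
    have "b \<in> \<phi> ` M" using that rel_basisD(1)[OF B] onto by blast
    then show ?thesis by blast
  qed
  then obtain l where l: "\<And>b. b \<in> B \<Longrightarrow> l b \<in> M" "\<And>b. b \<in> B \<Longrightarrow> \<phi> (l b) = b" by metis
  have bij: "bij_betw \<phi> (l ` B) B"
    unfolding bij_betw_def inj_on_def using l by force
  have lM: "l ` B \<subseteq> M" using l by blast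
  have "rel_basis N M (l ` B)"
    unfolding rel_basis_def
  proof (intro conjI allI impI ballI, rule lM)
    show "M \<subseteq> zmod.span (l ` B \<union> N)"
    proof
      fix x assume x: "x \<in> M"
      have "\<phi> ` (l ` B) = B" using bij unfolding bij_betw_def by blast
      then have "zmod.span B = \<phi> ` zmod.span (l ` B)"
        using module_hom.span_image[OF \<phi>, of "l ` B"] by simp
      moreover have "zmod.span (B \<union> {0}) \<subseteq> zmod.span B"
        by (intro zmod.span_minimal) (auto intro: zmod.span_base zmod.span_zero)
      ultimately obtain z where z: "z \<in> zmod.span (l ` B)" "\<phi> z = \<phi> x"
        using x onto rel_basisD(2)[OF B] by force
      have zM: "z \<in> M" using zmod.span_minimal[OF lM M] z(1) by blast
      have "\<phi> (x - z) = 0" using module_hom.diff[OF \<phi>] z(2) by simp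
      then have "x - z \<in> N" using ker zmod.subspace_diff[OF M x zM] by blast
      then have "x - z \<in> zmod.span (l ` B \<union> N)" by (intro zmod.span_base) blast
      moreover have "z \<in> zmod.span (l ` B \<union> N)" using z(1) zmod.span_mono[of "l ` B" "l ` B \<union> N"] by blast
      ultimately show "x \<in> zmod.span (l ` B \<union> N)" using zmod.span_add by fastforce
    qed
    fix F c x assume A: "finite F \<and> F \<subseteq> l ` B \<and> lincomb c F \<in> N" and x: "x \<in> F"
    then obtain F' where F': "F' \<subseteq> B" "F = l ` F'" "finite F'"
      using finite_subset_image[of F l B] by auto
    have inj: "inj_on l F'" using F'(1) l by (metis inj_on_inverseI subsetD)
    have FM: "lincomb c F \<in> M" using A lM by (intro lincomb_in_subspace M) auto
    have "\<phi> (lincomb c F) = (\<Sum>b\<in>F. of_int (c b) * \<phi> b)" by (rule zlinear_lincomb[OF \<phi>])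
    also have "\<dots> = (\<Sum>b\<in>F'. of_int (c (l b)) * \<phi> (l b))" unfolding F'(2) sum.reindex[OF inj] by simp
    also have "\<dots> = (\<Sum>b\<in>F'. of_int (c (l b)) * b)" using F'(1) l by (intro sum.cong) auto
    finally have "(\<Sum>b\<in>F'. of_int (c (l b)) * b) \<in> {0}" using ker[OF FM] A by simp
    then show "c x = 0" using rel_basisD(3)[OF B F'(3,1), of "\<lambda>b. c (l b)"] x F'(2) by blast
  qed
  then show ?thesis using bij by blast
qed

definition add_group :: "'v::comm_ring_1 set \<Rightarrow> 'v monoid" where
  "add_group M = \<lparr>carrier = M, monoid.mult = (+), one = 0\<rparr>"

text \<open>The index set \<open>S\<close> is kept separate from the basis \<open>B\<close>, so that
  one group can be presented on lifted representatives or on a set of another type, such as a set of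
  ideals.\<close>

lemma free_Abelian_group_iso_add_group:
  fixes e :: "'s \<Rightarrow> 'v::comm_ring_1"
  assumes M: "zmod.subspace M" and B: "rel_basis {0} M B" and e: "bij_betw e S B"
  shows "free_Abelian_group S \<cong> add_group M"
proof -
  define h where "h = (\<lambda>c. \<Sum>s\<in>Poly_Mapping.keys c. of_int (Poly_Mapping.lookup c s) * e s)"
  have h: "h c = (\<Sum>s\<in>A. of_int (Poly_Mapping.lookup c s) * e s)"
    if "finite A" "Poly_Mapping.keys c \<subseteq> A" for c A
    unfolding h_def using that by (intro sum.mono_neutral_left) (auto simp: in_keys_iff)
  have hadd: "h (c + d) = h c + h d" for c d
  proof -
    let ?A = "Poly_Mapping.keys c \<union> Poly_Mapping.keys d"
    have "finite ?A" "Poly_Mapping.keys (c + d) \<subseteq> ?A" using keys_add[of c d] by auto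
    then show ?thesis using h[of ?A c] h[of ?A d] h[of ?A "c + d"]
      by (simp add: lookup_add sum.distrib algebra_simps)
  qed
  have eM: "e s \<in> M" if "s \<in> S" for s using that e rel_basisD(1)[OF B] unfolding bij_betw_def by blast
  have eS: "e ` S = B" "inj_on e S" using e unfolding bij_betw_def by auto
  have hM: "h c \<in> M" if "Poly_Mapping.keys c \<subseteq> S" for c
    unfolding h_def using that eM by (intro zmod.subspace_sum[OF M] zmod.subspace_scale[OF M]) auto
  have h0: "c = 0" if c: "Poly_Mapping.keys c \<subseteq> S" and z: "h c = 0" for c
  proof -
    have inj: "inj_on e (Poly_Mapping.keys c)" using eS(2) c inj_on_subset by blast
    define g where "g = the_inv_into S e"
    have g: "g (e s) = s" if "s \<in> S" for s unfolding g_def using the_inv_into_f_f[OF eS(2) that] .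
    have "(\<Sum>b\<in>e ` Poly_Mapping.keys c. of_int (Poly_Mapping.lookup c (g b)) * b) = h c"
      unfolding h_def sum.reindex[OF inj] using g c by (intro sum.cong) auto
    then have "\<And>b. b \<in> e ` Poly_Mapping.keys c \<Longrightarrow> Poly_Mapping.lookup c (g b) = 0"
      using rel_basisD(3)[OF B, of "e ` Poly_Mapping.keys c" "\<lambda>b. Poly_Mapping.lookup c (g b)"] z c eS(1) by auto
    then have "\<And>s. s \<in> Poly_Mapping.keys c \<Longrightarrow> Poly_Mapping.lookup c s = 0" using g c by fastforce
    then show "c = 0" by (intro poly_mapping_eqI) (auto simp: in_keys_iff)
  qed
  have hsurj: "\<exists>c. Poly_Mapping.keys c \<subseteq> S \<and> h c = y" if "y \<in> zmod.span (B \<union> {0})" for y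
    using that
  proof (induction rule: zmod.span_induct_alt)
    case base show ?case by (rule exI[of _ 0]) (simp add: h_def)
  next
    case (step n b y)
    then obtain c where c: "Poly_Mapping.keys c \<subseteq> S" "h c = y" by blast
    show ?case
    proof (cases "b \<in> B")
      case True
      then obtain s where s: "s \<in> S" "b = e s" using eS by blast
      have "h (Poly_Mapping.single s n) = of_int n * b"
        using h[of "{s}" "Poly_Mapping.single s n"] s by simp
      moreover have "Poly_Mapping.keys (Poly_Mapping.single s n + c) \<subseteq> S"
        using keys_add[of "Poly_Mapping.single s n" c] c s by (auto split: if_splits)
      ultimately show ?thesis using hadd c by metis
    next
      case False then show ?thesis using step c by auto
    qed
  qed
  have "h \<in> iso (free_Abelian_group S) (add_group M)"
  proof (rule isoI)
    show "h \<in> hom (free_Abelian_group S) (add_group M)"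
      by (rule homI) (auto simp: add_group_def hM hadd)
    show "bij_betw h (carrier (free_Abelian_group S)) (carrier (add_group M))"
      unfolding bij_betw_def
    proof
      show "inj_on h (carrier (free_Abelian_group S))"
      proof (rule inj_onI)
        fix c d assume cd: "c \<in> carrier (free_Abelian_group S)" "d \<in> carrier (free_Abelian_group S)" "h c = h d"
        have "h c = h (c - d) + h d" using hadd[of "c - d" d] by simp
        then have "h (c - d) = 0" using cd(3) by simp
        then have "c - d = 0" using h0[of "c - d"] keys_diff[of c d] cd by auto
        then show "c = d" by simp
      qed
      show "h ` carrier (free_Abelian_group S) = carrier (add_group M)"
      proof
        show "h ` carrier (free_Abelian_group S) \<subseteq> carrier (add_group M)"
          using hM by (auto simp: add_group_def)
        show "carrier (add_group M) \<subseteq> h ` carrier (free_Abelian_group S)"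
        proof
          fix y assume "y \<in> carrier (add_group M)"
          then have "y \<in> zmod.span (B \<union> {0})" using rel_basisD(2)[OF B] unfolding add_group_def by auto
          then obtain c where "Poly_Mapping.keys c \<subseteq> S" "h c = y" using hsurj by blast
          then show "y \<in> h ` carrier (free_Abelian_group S)" by auto
        qed
      qed
    qed
  qed
  then show ?thesis unfolding is_iso_def by blast
qed

subsection \<open>Groups of integer functions spanned by indicators\<close>

lemma of_int_fun_apply [simp]: "(of_int n :: 'a \<Rightarrow> 'b::ring_1) x = of_int n"
proof (cases n)
  case (neg k)
  have "(- of_nat (Suc k) :: 'a \<Rightarrow> 'b) x = - of_nat (Suc k)"
    by (simp only: uminus_apply of_nat_fun_apply)
  then show ?thesis using neg by (simp only: of_int_minus of_int_of_nat_eq)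
qed simp

abbreviation sum_set :: "'v::comm_ring_1 set \<Rightarrow> 'v set \<Rightarrow> 'v set" where
  "sum_set S T \<equiv> {x + y | x y. x \<in> S \<and> y \<in> T}"

lemma subspace_sum_set:
  assumes "zmod.subspace S" "zmod.subspace T"
  shows "zmod.subspace (sum_set S T)"
proof (rule zmod.subspaceI)
  show "0 \<in> sum_set S T" using assms[THEN zmod.subspace_0] by (intro CollectI exI[of _ 0]) simp
  fix x y assume x: "x \<in> sum_set S T" and y: "y \<in> sum_set S T"
  obtain a b where ab: "x = a + b" "a \<in> S" "b \<in> T" using x by blast
  obtain a' b' where ab': "y = a' + b'" "a' \<in> S" "b' \<in> T" using y by blast
  have "x + y = (a + a') + (b + b')" unfolding ab(1) ab'(1) by (simp add: algebra_simps)
  then show "x + y \<in> sum_set S T"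
    using ab ab' zmod.subspace_add[OF assms(1)] zmod.subspace_add[OF assms(2)] by blast
next
  fix n x assume x: "x \<in> sum_set S T"
  obtain a b where ab: "x = a + b" "a \<in> S" "b \<in> T" using x by blast
  have "of_int n * x = of_int n * a + of_int n * b" unfolding ab(1) by (simp add: algebra_simps)
  then show "of_int n * x \<in> sum_set S T"
    using ab zmod.subspace_scale[OF assms(1)] zmod.subspace_scale[OF assms(2)] by blast
qed

lemma sum_setI: "x \<in> S \<Longrightarrow> y \<in> T \<Longrightarrow> x + y \<in> sum_set S T"
  by blast

text \<open>Empty intersections are excluded, so that \<open>ispan D\<close> is a ring without unit in general;
  \<open>ispan (insert UNIV D)\<close> is its unitalization.\<close>

definition ispan :: "'a set set \<Rightarrow> ('a \<Rightarrow> int) set" where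
  "ispan D = zmod.span {indicator (\<Inter>E) | E. E \<subseteq> D \<and> finite E \<and> E \<noteq> {}}"

lemma subspace_ispan [simp]: "zmod.subspace (ispan D)"
  unfolding ispan_def by simp

lemmas ispan_add = zmod.subspace_add[OF subspace_ispan]
  and ispan_scale = zmod.subspace_scale[OF subspace_ispan]
  and ispan_diff = zmod.subspace_diff[OF subspace_ispan]
  and zero_in_ispan [simp] = zmod.subspace_0[OF subspace_ispan]

lemma ispan_mono: "D \<subseteq> D' \<Longrightarrow> ispan D \<subseteq> ispan D'"
  unfolding ispan_def by (intro zmod.span_mono) blast

lemma indicator_Inter_in_ispan: "E \<subseteq> D \<Longrightarrow> finite E \<Longrightarrow> E \<noteq> {} \<Longrightarrow> indicator (\<Inter>E) \<in> ispan D"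
  unfolding ispan_def by (intro zmod.span_base) blast

lemma indicator_in_ispan: "W \<in> D \<Longrightarrow> indicator W \<in> ispan D"
  using indicator_Inter_in_ispan[of "{W}" D] by simp

lemma ispan_induct [consumes 1, case_names base step]:
  assumes "f \<in> ispan D" "P 0"
    "\<And>n E y. E \<subseteq> D \<Longrightarrow> finite E \<Longrightarrow> E \<noteq> {} \<Longrightarrow> y \<in> ispan D \<Longrightarrow> P y \<Longrightarrow> P (of_int n * indicator (\<Inter>E) + y)"
  shows "P f"
proof -
  have "f \<in> ispan D \<and> P f"
    using assms(1) unfolding ispan_def
  proof (induction rule: zmod.span_induct_alt)
    case base
    show ?case by (intro conjI assms(2) zmod.span_zero)
  next
    case (step n x y)
    then obtain E where E: "x = indicator (\<Inter>E)" "E \<subseteq> D" "finite E" "E \<noteq> {}" by blast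
    then have "x \<in> zmod.span {indicator (\<Inter>E) | E. E \<subseteq> D \<and> finite E \<and> E \<noteq> {}}"
      by (intro zmod.span_base) blast
    then have "of_int n * x + y \<in> zmod.span {indicator (\<Inter>E) | E. E \<subseteq> D \<and> finite E \<and> E \<noteq> {}}"
      using step by (intro zmod.span_add zmod.span_scale) blast+
    moreover have "P (of_int n * x + y)"
      unfolding E(1) using step E by (intro assms(3)) (auto simp only: ispan_def)
    ultimately show ?case by (rule conjI)
  qed
  then show ?thesis ..
qed

text \<open>A product of indicators is the indicator of the intersection, so \<open>ispan D'\<close>
  is a module over the unital ring on \<open>D\<close>.\<close>

lemma ispan_mult:
  assumes f: "f \<in> ispan (insert UNIV D)" and g: "g \<in> ispan D'" and "D \<subseteq> D'"
  shows "f * g \<in> ispan D'"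
  using f
proof (induction rule: ispan_induct)
  case base
  have "0 * g = 0" by (rule mult_zero_left)
  then show ?case using zero_in_ispan by metis
next
  case (step n E y)
  have "indicator (\<Inter>E) * g \<in> ispan D'"
    using g
  proof (induction rule: ispan_induct)
    case base
    have "indicator (\<Inter>E) * 0 = (0 :: 'a \<Rightarrow> int)" by (rule mult_zero_right)
    then show ?case using zero_in_ispan by metis
  next
    case (step m E' z)
    \<comment> \<open>\<open>UNIV\<close> is dropped because \<open>D'\<close> may not contain it;
      the family stays nonempty thanks to \<open>E'\<close>.\<close>
    have "\<Inter>(E - {UNIV} \<union> E') = \<Inter>E \<inter> \<Inter>E'" by blast
    then have "indicator (\<Inter>E) * indicator (\<Inter>E') = (indicator (\<Inter>(E - {UNIV} \<union> E')) :: 'a \<Rightarrow> int)"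
      by (auto simp: fun_eq_iff indicator_def)
    also have "\<dots> \<in> ispan D'"
      using step(1-3) \<open>E \<subseteq> insert UNIV D\<close> \<open>finite E\<close> \<open>D \<subseteq> D'\<close> by (intro indicator_Inter_in_ispan) auto
    finally have "of_int m * (indicator (\<Inter>E) * indicator (\<Inter>E')) + indicator (\<Inter>E) * z \<in> ispan D'"
      using step by (intro ispan_add ispan_scale)
    moreover have "indicator (\<Inter>E) * (of_int m * indicator (\<Inter>E') + z) =
        of_int m * (indicator (\<Inter>E) * indicator (\<Inter>E')) + indicator (\<Inter>E) * z"
      by (simp add: algebra_simps)
    ultimately show "indicator (\<Inter>E) * (of_int m * indicator (\<Inter>E') + z) \<in> ispan D'" by metis
  qed
  then have "of_int n * (indicator (\<Inter>E) * g) + y * g \<in> ispan D'"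
    using step by (intro ispan_add ispan_scale)
  moreover have "(of_int n * indicator (\<Inter>E) + y) * g = of_int n * (indicator (\<Inter>E) * g) + y * g"
    by (simp add: algebra_simps)
  ultimately show "(of_int n * indicator (\<Inter>E) + y) * g \<in> ispan D'" by metis
qed

text \<open>Induction over all maps at once: raising \<open>y\<close> by n on one set changes
  \<open>\<phi>\<close> of it there by the constant \<open>\<phi> n\<close> and by the defect of
  additivity \<open>\<psi>\<close>, which again sends 0 to 0. This provides division of values and
  indicators of sets of values, the operations behind the purity arguments.\<close>

lemma ispan_comp:
  fixes \<phi> :: "int \<Rightarrow> int"
  assumes "f \<in> ispan D" "\<phi> 0 = 0"
  shows "(\<lambda>x. \<phi> (f x)) \<in> ispan D"
  using assms
proof (induction arbitrary: \<phi> rule: ispan_induct)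
  case base
  then have "(\<lambda>x. \<phi> ((0::'a \<Rightarrow> int) x)) = 0" by auto
  then show ?case using zero_in_ispan by metis
next
  case (step n E y)
  define \<psi> where "\<psi> m = \<phi> (m + n) - \<phi> m - \<phi> n" for m
  let ?e = "indicator (\<Inter>E) :: 'a \<Rightarrow> int"
  have e: "?e \<in> ispan D" using step by (intro indicator_Inter_in_ispan)
  have p: "(\<lambda>x. \<psi> (y x)) \<in> ispan D" using step(6) by (intro step(5)) (simp add: \<psi>_def)
  then have "?e * (\<lambda>x. \<psi> (y x)) \<in> ispan D"
    using ispan_mult[of ?e D _ D] e ispan_mono[of D "insert UNIV D"] by blast
  moreover have "(\<lambda>x. \<phi> ((of_int n * ?e + y) x)) =
      (\<lambda>x. \<phi> (y x)) + (?e * (\<lambda>x. \<psi> (y x)) + of_int (\<phi> n) * ?e)"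
    using step(6) by (auto simp: fun_eq_iff \<psi>_def indicator_def add.commute)
  moreover have "(\<lambda>x. \<phi> (y x)) \<in> ispan D" using step(6) by (rule step(5))
  ultimately show ?case using e
    by (auto intro!: ispan_add ispan_scale)
qed

lemma finite_range_ispan: "f \<in> ispan D \<Longrightarrow> finite (range f)"
proof (induction rule: ispan_induct)
  case base
  have "range (0 :: 'a \<Rightarrow> int) \<subseteq> {0}" by auto
  then show ?case using finite_subset by blast
next
  case (step n E y)
  have "range (of_int n * indicator (\<Inter>E) + y) \<subseteq> range y \<union> (\<lambda>a. n + a) ` range y"
    by (auto simp: indicator_def)
  then show ?case using step finite_subset by blast
qed

lemma one_in_ispan: "1 \<in> ispan (insert UNIV D)"
proof -
  have "(1 :: 'a \<Rightarrow> int) = indicator UNIV" by (auto simp: fun_eq_iff)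
  then show ?thesis using indicator_in_ispan[of UNIV "insert UNIV D"] by simp
qed

text \<open>With the constants available, the value at 0 can be subtracted first and added
  back.\<close>

lemma ispan_UNIV_comp:
  fixes \<phi> :: "int \<Rightarrow> int"
  assumes "f \<in> ispan (insert UNIV D)"
  shows "(\<lambda>x. \<phi> (f x)) \<in> ispan (insert UNIV D)"
proof -
  have "(\<lambda>x. \<phi> (f x)) = (\<lambda>x. (\<lambda>m. \<phi> m - \<phi> 0) (f x)) + of_int (\<phi> 0) * 1"
    by (auto simp: fun_eq_iff)
  moreover have "(\<lambda>x. (\<lambda>m. \<phi> m - \<phi> 0) (f x)) \<in> ispan (insert UNIV D)"
    using assms by (rule ispan_comp) simp
  ultimately show ?thesis using one_in_ispan[of D]
    ispan_add ispan_scale by metis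
qed

text \<open>Generators whose family contains \<open>k\<close> factor through
  \<open>indicator k\<close>. The cofactor can be an empty intersection, hence it lives in the
  unital ring even when \<open>E0\<close> is empty.\<close>

lemma ispan_insert_decomp:
  assumes "f \<in> ispan (insert k D \<union> E0)" "E0 \<subseteq> {UNIV}"
  shows "\<exists>g\<in>ispan (D \<union> E0). \<exists>b\<in>ispan (insert UNIV D). f = g + b * indicator k"
  using assms(1)
proof (induction rule: ispan_induct)
  case base
  have "(0 :: 'a \<Rightarrow> int) = 0 + 0 * indicator k" by simp
  then show ?case using zero_in_ispan by blast
next
  case (step n E y)
  from step(5) obtain g b where gb: "g \<in> ispan (D \<union> E0)" "b \<in> ispan (insert UNIV D)"
    "y = g + b * indicator k" by blast
  let ?e = "indicator (\<Inter>E) :: 'a \<Rightarrow> int"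
  show ?case
  proof (cases "k \<in> E")
    case False
    then have "?e \<in> ispan (D \<union> E0)" using step by (intro indicator_Inter_in_ispan) auto
    then have "of_int n * ?e + g \<in> ispan (D \<union> E0)"
      using gb by (intro ispan_add ispan_scale)
    moreover have "of_int n * ?e + y = (of_int n * ?e + g) + b * indicator k"
      using gb(3) by simp
    ultimately show ?thesis using gb(2) by blast
  next
    case True
    \<comment> \<open>Inserting \<open>UNIV\<close> keeps the family nonempty when \<open>E\<close>
      is \<open>{k}\<close>.\<close>
    let ?d = "indicator (\<Inter>(insert UNIV (E - {k}))) :: 'a \<Rightarrow> int"
    have "?d \<in> ispan (insert UNIV D)" using step assms(2) by (intro indicator_Inter_in_ispan) auto
    then have "of_int n * ?d + b \<in> ispan (insert UNIV D)"
      using gb by (intro ispan_add ispan_scale)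
    moreover have "?e = ?d * indicator k"
      using True by (auto simp: fun_eq_iff indicator_def)
    then have "of_int n * ?e + y = g + (of_int n * ?d + b) * indicator k"
      using gb(3) by (simp add: algebra_simps)
    ultimately show ?thesis using gb(1) by blast
  qed
qed

lemma ispan_finite_support:
  assumes "f \<in> ispan (D \<union> E0)"
  shows "\<exists>E. finite E \<and> E \<subseteq> D \<and> f \<in> ispan (E \<union> E0)"
  using assms
proof (induction rule: ispan_induct)
  case base
  then show ?case using zero_in_ispan by blast
next
  case (step n E y)
  then obtain E1 where E1: "finite E1" "E1 \<subseteq> D" "y \<in> ispan (E1 \<union> E0)" by blast
  let ?E = "E1 \<union> (E \<inter> D)"
  have "y \<in> ispan (?E \<union> E0)" using E1(3) ispan_mono[of "E1 \<union> E0" "?E \<union> E0"] by blast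
  moreover have "indicator (\<Inter>E) \<in> ispan (?E \<union> E0)" using step by (intro indicator_Inter_in_ispan) auto
  ultimately have "of_int n * indicator (\<Inter>E) + y \<in> ispan (?E \<union> E0)"
    by (intro ispan_add ispan_scale)
  moreover have "finite ?E" "?E \<subseteq> D" using E1 step by auto
  ultimately show ?case by blast
qed

section \<open>Pure ideals and the transfinite induction for freeness\<close>

definition pure_ideal :: "('a \<Rightarrow> int) set \<Rightarrow> ('a \<Rightarrow> int) set \<Rightarrow> bool" where
  "pure_ideal Q C \<longleftrightarrow> zmod.subspace C \<and> C \<subseteq> Q \<and> (\<forall>q\<in>Q. \<forall>c\<in>C. q * c \<in> C) \<and>
     (\<forall>x\<in>Q. \<forall>n. n \<noteq> 0 \<longrightarrow> of_int n * x \<in> C \<longrightarrow> x \<in> C)"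

lemma pure_idealD:
  assumes "pure_ideal Q C"
  shows "zmod.subspace C" "C \<subseteq> Q" "\<And>q c. q \<in> Q \<Longrightarrow> c \<in> C \<Longrightarrow> q * c \<in> C"
    "\<And>x n. x \<in> Q \<Longrightarrow> n \<noteq> 0 \<Longrightarrow> of_int n * x \<in> C \<Longrightarrow> x \<in> C"
  using assms unfolding pure_ideal_def by auto

text \<open>If \<open>n x = q + c\<close> with \<open>c \<in> C\<close>, then \<open>c\<close> does not vanish where \<open>n\<close> fails to divide \<open>q\<close>; hence by
  purity the indicator of that set lies in \<open>C\<close>, and elsewhere \<open>q\<close> can be divided by \<open>n\<close>.\<close>

lemma pure_ideal_sum_pure:
  assumes C: "pure_ideal (ispan (insert UNIV D)) C" and "D' \<subseteq> D"
    and x: "x \<in> ispan (insert UNIV D)" and n: "n \<noteq> 0"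
    and nx: "of_int n * x \<in> sum_set (ispan (insert UNIV D')) C"
  shows "x \<in> sum_set (ispan (insert UNIV D')) C"
proof -
  let ?Q = "ispan (insert UNIV D)" and ?Q' = "ispan (insert UNIV D')"
  note C' = pure_idealD[OF C]
  have Q'Q: "?Q' \<subseteq> ?Q" using \<open>D' \<subseteq> D\<close> by (intro ispan_mono) blast
  obtain q c where q: "q \<in> ?Q'" and c: "c \<in> C" and eq: "of_int n * x = q + c" using nx by blast
  define z where "z = (\<lambda>t. (\<lambda>m. if n dvd m then 0 else (1::int)) (q t))"
  have z: "z \<in> ?Q'" unfolding z_def using q by (rule ispan_UNIV_comp)
  define d where "d = z * c"
  have dC: "d \<in> C" unfolding d_def using C'(3) z Q'Q c by blast
  have eqt: "n * x t = q t + c t" for t using eq by (simp add: fun_eq_iff)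
  have dz: "d t = 0 \<longleftrightarrow> z t = 0" for t
  proof -
    have "c t \<noteq> 0" if "\<not> n dvd q t" using that eqt[of t] by (metis add.right_neutral dvd_triv_left)
    then show ?thesis unfolding d_def z_def by auto
  qed
  have z01: "z t = 0 \<or> z t = 1" for t unfolding z_def by auto
  have fin: "finite (range d)" using dC C'(2) finite_range_ispan by blast
  \<comment> \<open>A common multiple of the finitely many nonzero values of \<open>d\<close>. The
    ring element \<open>u\<close> with values \<open>N div d\<close> turns \<open>d\<close> into
    \<open>N z\<close>, and purity cancels \<open>N\<close>.\<close>
  define N where "N = \<Prod>(range d - {0})"
  have N0: "N \<noteq> 0" unfolding N_def using fin by simp
  have dN: "d t dvd N" if "d t \<noteq> 0" for t
    unfolding N_def using fin that dvd_prodI[of "range d - {0}" "d t" "\<lambda>x. x"] by simp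
  define u where "u = (\<lambda>t. (\<lambda>m. if m = 0 then 0 else N div m) (d t))"
  have "u \<in> ?Q" unfolding u_def using dC C'(2)
    by (intro ispan_UNIV_comp[where \<phi> = "\<lambda>m. if m = 0 then 0 else N div m" and f = d]) auto
  then have "u * d \<in> C" using dC C'(3) by blast
  moreover have "u * d = of_int N * z"
  proof
    fix t
    show "(u * d) t = (of_int N * z) t"
      using dz[of t] z01[of t] dN[of t] by (cases "d t = 0") (auto simp: u_def)
  qed
  ultimately have "z \<in> C" using C'(4)[of z N] z Q'Q N0 by auto
  then have qz: "q * z \<in> C" using C'(3) q Q'Q by blast
  define w where "w = (\<lambda>t. (\<lambda>m. if n dvd m then m div n else 0) (q t))"
  have w: "w \<in> ?Q'" unfolding w_def using q by (rule ispan_UNIV_comp)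
  have "of_int n * (x - w) = c + q * z"
  proof
    fix t
    show "(of_int n * (x - w)) t = (c + q * z) t"
      using eqt[of t] by (auto simp: w_def z_def algebra_simps)
  qed
  then have "of_int n * (x - w) \<in> C" using c qz zmod.subspace_add[OF C'(1)] by simp
  moreover have "x - w \<in> ?Q" using x w Q'Q ispan_diff by blast
  ultimately have "x - w \<in> C" using C'(4) n by blast
  then have "w + (x - w) \<in> sum_set ?Q' C" using w by (intro sum_setI)
  then show ?thesis by simp
qed

lemma underS_trans:
  assumes "Well_order r" "k \<in> underS r l" shows "underS r k \<subseteq> underS r l"
  using assms(2) Well_orderD(2,3)[OF assms(1)] unfolding underS_def by blast

text \<open>A finite family of generators has a largest member in the well-order, so the filtration
  by initial segments acquires nothing new at limits.\<close>

lemma ispan_initial_segment: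
  assumes r: "Well_order r" and D: "D \<subseteq> Field r" "\<And>k. k \<in> D \<Longrightarrow> underS r k \<subseteq> D"
    and f: "f \<in> ispan (D \<union> E0)"
  shows "f \<in> ispan E0 \<or> (\<exists>k\<in>D. f \<in> ispan (insert k (underS r k) \<union> E0))"
proof -
  obtain E where E: "finite E" "E \<subseteq> D" "f \<in> ispan (E \<union> E0)" using ispan_finite_support[OF f] by blast
  show ?thesis
  proof (cases "E = {}")
    case True then show ?thesis using E by simp
  next
    case False
    obtain m where m: "m \<in> E" "\<And>x. x \<in> E \<Longrightarrow> (x, m) \<in> r"
      using Well_order_finite_max[OF r E(1) False] E(2) D(1) by blast
    have "E \<subseteq> insert m (underS r m)" using m(2) unfolding underS_def by blast
    then have "f \<in> ispan (insert m (underS r m) \<union> E0)"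
      using E(3) ispan_mono[of "E \<union> E0" "insert m (underS r m) \<union> E0"] by blast
    then show ?thesis using m(1) E(2) by blast
  qed
qed

text \<open>The case \<open>E0 = {UNIV}\<close> is the inductive step, the case \<open>E0 = {}\<close> gives the nonunital conclusion.\<close>

lemma rel_basis_ispan_step:
  assumes r: "Well_order r" and D: "D \<subseteq> Field r" "\<And>k. k \<in> D \<Longrightarrow> underS r k \<subseteq> D"
    and E0: "E0 \<subseteq> {UNIV}"
    and IH: "\<And>k C. k \<in> D \<Longrightarrow> pure_ideal (ispan (insert UNIV (underS r k))) C \<Longrightarrow>
        \<exists>B. rel_basis C (ispan (insert UNIV (underS r k))) B"
    and C: "zmod.subspace C" "\<And>q c. q \<in> ispan (insert UNIV D) \<Longrightarrow> c \<in> C \<Longrightarrow> q * c \<in> C"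
    and pure: "\<And>k x n. k \<in> D \<Longrightarrow> x \<in> ispan (insert UNIV D) \<Longrightarrow> n \<noteq> 0 \<Longrightarrow>
        of_int n * x \<in> sum_set (ispan (underS r k \<union> E0)) C \<Longrightarrow> x \<in> sum_set (ispan (underS r k \<union> E0)) C"
  shows "\<exists>B. rel_basis (sum_set (ispan E0) C) (sum_set (ispan (D \<union> E0)) C) B"
proof -
  define L where "L k = sum_set (ispan (underS r k \<union> E0)) C" for k
  define U where "U k = sum_set (ispan (insert k (underS r k) \<union> E0)) C" for k
  have subL: "zmod.subspace (L k)" for k
    unfolding L_def by (intro subspace_sum_set C(1) subspace_ispan)
  have "\<exists>B. rel_basis (L k) (U k) B" if k: "k \<in> D" for k
  proof -
    let ?Q = "ispan (insert UNIV (underS r k))"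
    let ?\<phi> = "\<lambda>b. b * indicator k :: 'a \<Rightarrow> int"
    \<comment> \<open>The kernel of multiplication by \<open>indicator k\<close> modulo
      \<open>L k\<close>. By \<open>ispan_insert_decomp\<close> this map is onto \<open>U k\<close>
      modulo \<open>L k\<close>, so the graded piece is the quotient of the smaller ring by
      \<open>Ck\<close>, to which the induction hypothesis applies.\<close>
    define Ck where "Ck = {b \<in> ?Q. ?\<phi> b \<in> L k}"
    have QQ: "?Q \<subseteq> ispan (insert UNIV D)" using D(2)[OF k] by (intro ispan_mono) blast
    have ideal: "q * p \<in> L k" if "q \<in> ?Q" "p \<in> L k" for q p
    proof -
      obtain a c where ac: "a \<in> ispan (underS r k \<union> E0)" "c \<in> C" "p = a + c"
        using \<open>p \<in> L k\<close> unfolding L_def by blast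
      have "q * a \<in> ispan (underS r k \<union> E0)" using that(1) ac(1) by (rule ispan_mult) blast
      moreover have "q * c \<in> C" using C(2) ac(2) that(1) QQ by blast
      ultimately have "q * a + q * c \<in> L k" unfolding L_def by (rule sum_setI)
      then show ?thesis using ac(3) by (simp add: distrib_left)
    qed
    have subCk: "zmod.subspace Ck"
    proof (rule zmod.subspaceI)
      show "0 \<in> Ck" unfolding Ck_def using zmod.subspace_0[OF subL] by simp
      show "x + y \<in> Ck" if "x \<in> Ck" "y \<in> Ck" for x y
        using that zmod.subspace_add[OF subL, of "x * indicator k" k "y * indicator k"]
          zmod.subspace_add[OF subspace_ispan, of x "insert UNIV (underS r k)" y]
        unfolding Ck_def by (simp add: distrib_right)
      show "of_int n * x \<in> Ck" if "x \<in> Ck" for n x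
        using that zmod.subspace_scale[OF subL, of "x * indicator k" k n]
          zmod.subspace_scale[OF subspace_ispan, of x "insert UNIV (underS r k)" n]
        unfolding Ck_def by (simp add: mult.assoc)
    qed
    have "\<exists>B. rel_basis Ck ?Q B"
    proof (rule IH[OF k])
      show "pure_ideal ?Q Ck"
        unfolding pure_ideal_def
      proof (intro conjI ballI allI impI)
        show "zmod.subspace Ck" by (rule subCk)
        show "Ck \<subseteq> ?Q" unfolding Ck_def by blast
        show "q * c \<in> Ck" if "q \<in> ?Q" "c \<in> Ck" for q c
        proof -
          have "q * c \<in> ?Q" using ispan_mult[of q "underS r k" c "insert UNIV (underS r k)"] that
            unfolding Ck_def by blast
          moreover have "q * ?\<phi> c \<in> L k" using ideal that unfolding Ck_def by blast
          ultimately show ?thesis unfolding Ck_def by (simp add: mult.assoc)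
        qed
        show "x \<in> Ck" if "x \<in> ?Q" "n \<noteq> 0" "of_int n * x \<in> Ck" for x n
        proof -
          \<comment> \<open>Purity is inherited through \<open>indicator k\<close>: the product lies
            in the ring on all of \<open>D\<close>, where \<open>pure\<close> cancels n.\<close>
          have "?\<phi> x \<in> ispan (insert UNIV D)"
          proof (rule ispan_mult)
            show "x \<in> ispan (insert UNIV D)" using that QQ by blast
            show "indicator k \<in> ispan (insert UNIV D)" using k by (intro indicator_in_ispan) blast
          qed blast
          moreover have "of_int n * ?\<phi> x \<in> L k" using that(3) unfolding Ck_def by (simp add: mult.assoc)
          ultimately have "?\<phi> x \<in> L k" using pure[OF k _ that(2)] unfolding L_def by blast
          then show ?thesis using that(1) unfolding Ck_def by blast
        qed
      qed
    qed
    then obtain B where B: "rel_basis Ck ?Q B" by blast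
    have bU: "?\<phi> b \<in> U k" if "b \<in> ?Q" for b
    proof -
      have "?\<phi> b \<in> ispan (insert k (underS r k) \<union> E0)"
        using that by (rule ispan_mult) (auto intro: indicator_in_ispan)
      then have "?\<phi> b + 0 \<in> U k" unfolding U_def by (rule sum_setI) (rule zmod.subspace_0[OF C(1)])
      then show ?thesis by simp
    qed
    have "rel_basis (L k) (U k) (?\<phi> ` B)"
    proof (rule rel_basis_push)
      show "zlinear ?\<phi>" by (rule zlinearI) (simp_all add: distrib_right mult.assoc)
      show "zmod.subspace ?Q" by (rule subspace_ispan)
      show "?\<phi> x \<in> L k \<longleftrightarrow> x \<in> Ck" if "x \<in> ?Q" for x using that unfolding Ck_def by simp
      show "Ck \<subseteq> ?Q" unfolding Ck_def by blast
      show "zmod.subspace (L k)" by (rule subL)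
      show "?\<phi> ` ?Q \<subseteq> U k" using bU by blast
      show "\<exists>x\<in>?Q. y - ?\<phi> x \<in> L k" if y: "y \<in> U k" for y
      proof -
        obtain p c where pc: "p \<in> ispan (insert k (underS r k) \<union> E0)" "c \<in> C" "y = p + c"
          using y unfolding U_def by blast
        obtain g b where gb: "g \<in> ispan (underS r k \<union> E0)" "b \<in> ?Q" "p = g + b * indicator k"
          using ispan_insert_decomp[OF pc(1) E0] by blast
        have "y - ?\<phi> b = g + c" using pc(3) gb(3) by simp
        then have "y - ?\<phi> b \<in> L k" unfolding L_def using gb(1) pc(2) by blast
        then show ?thesis using gb(2) by blast
      qed
      show "rel_basis Ck ?Q B" by (rule B)
    qed
    then show ?thesis by blast
  qed
  then obtain B where B: "\<And>k. k \<in> D \<Longrightarrow> rel_basis (L k) (U k) (B k)" by metis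
  have "rel_basis (sum_set (ispan E0) C) (sum_set (ispan (D \<union> E0)) C) (\<Union>k\<in>D. B k)"
  proof (rule conjunct2[OF rel_basis_filtration[OF r D(1), where L = L and U = U]])
    show "zmod.subspace (L k)" for k by (rule subL)
    show "sum_set (ispan E0) C \<subseteq> L k" for k
      unfolding L_def using ispan_mono[of E0 "underS r k \<union> E0"] by blast
    show "U i \<subseteq> L j" if "(i, j) \<in> r" "i \<noteq> j" for i j
    proof -
      have "i \<in> underS r j" using that unfolding underS_def by simp
      then have "insert i (underS r i) \<subseteq> underS r j" using underS_trans[OF r] by blast
      then show ?thesis unfolding U_def L_def
        using ispan_mono[of "insert i (underS r i) \<union> E0" "underS r j \<union> E0"] by blast
    qed
    \<comment> \<open>Needed for \<open>D\<close> itself and for the initial segment below an index,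
      whose stages exhaust \<open>L i\<close>.\<close>
    have key: "x \<in> sum_set (ispan E0) C \<or> (\<exists>j\<in>D'. x \<in> U j)"
      if D': "D' \<subseteq> Field r" "\<And>k. k \<in> D' \<Longrightarrow> underS r k \<subseteq> D'" and x: "x \<in> sum_set (ispan (D' \<union> E0)) C" for D' x
    proof -
      obtain p c where pc: "p \<in> ispan (D' \<union> E0)" "c \<in> C" "x = p + c" using x by blast
      from ispan_initial_segment[OF r D' pc(1)] show ?thesis
        unfolding U_def using pc(2,3) by blast
    qed
    show "x \<in> sum_set (ispan E0) C \<or> (\<exists>j\<in>D. (j, i) \<in> r \<and> j \<noteq> i \<and> x \<in> U j)"
      if i: "i \<in> D" and x: "x \<in> L i" for i x
    proof -
      have "underS r i \<subseteq> Field r" using D i by blast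
      then have "x \<in> sum_set (ispan E0) C \<or> (\<exists>j\<in>underS r i. x \<in> U j)"
        using underS_trans[OF r] x unfolding L_def by (intro key) auto
      then show ?thesis using D(2)[OF i] unfolding underS_def by blast
    qed
    show "x \<in> sum_set (ispan E0) C \<or> (\<exists>j\<in>D. x \<in> U j)" if "x \<in> sum_set (ispan (D \<union> E0)) C" for x
      using D that by (rule key)
    show "U i \<subseteq> sum_set (ispan (D \<union> E0)) C" if "i \<in> D" for i
      unfolding U_def using ispan_mono[of "insert i (underS r i) \<union> E0" "D \<union> E0"] D(2)[OF that] that by blast
    show "rel_basis (L i) (U i) (B i)" if "i \<in> D" for i using B that .
  qed
  then show ?thesis by blast
qed

lemma ispan_UNIV: "x \<in> ispan {UNIV} \<Longrightarrow> \<exists>n. x = of_int n"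
proof (induction rule: ispan_induct)
  case base
  show ?case by (rule exI[of _ 0]) simp
next
  case (step n E y)
  then obtain m where m: "y = of_int m" by blast
  have "\<Inter>E = UNIV" using step by blast
  then have "indicator (\<Inter>E) = (1 :: 'a \<Rightarrow> int)" by (simp only: indicator_UNIV one_fun_def)
  then have "of_int n * indicator (\<Inter>E) + y = of_int (n + m)" using m by simp
  then show ?case by blast
qed

text \<open>The filtration by generators starts at the constants plus \<open>C\<close>, not at
  \<open>C\<close>. This first piece is zero or infinite cyclic, since by purity no nonzero multiple
  of 1 lies in \<open>C\<close> unless 1 does.\<close>

lemma rel_basis_const:
  assumes "pure_ideal (ispan (insert UNIV D)) C"
  shows "\<exists>B. rel_basis C (sum_set (ispan {UNIV}) C) B"
proof (cases "1 \<in> C")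
  note C = pure_idealD[OF assms]
  case True
  have "sum_set (ispan {UNIV}) C \<subseteq> C"
  proof
    fix x assume "x \<in> sum_set (ispan {UNIV}) C"
    then obtain n c where "x = of_int n + c" "c \<in> C" using ispan_UNIV by blast
    then show "x \<in> C" using zmod.subspace_add[OF C(1)] zmod.subspace_scale[OF C(1) True, of n] by simp
  qed
  also have "C \<subseteq> zmod.span ({} \<union> C)" using zmod.span_superset by auto
  finally have "rel_basis C (sum_set (ispan {UNIV}) C) {}"
    unfolding rel_basis_def by auto
  then show ?thesis by blast
next
  note C = pure_idealD[OF assms]
  case False
  have "rel_basis C (sum_set (ispan {UNIV}) C) {1}"
    unfolding rel_basis_def
  proof (intro conjI allI impI ballI)
    have "1 + 0 \<in> sum_set (ispan {UNIV}) C"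
      using one_in_ispan[of "{}"] zmod.subspace_0[OF C(1)] by (intro sum_setI)
    then show "{1} \<subseteq> sum_set (ispan {UNIV}) C" by simp
    show "sum_set (ispan {UNIV}) C \<subseteq> zmod.span ({1} \<union> C)"
    proof
      fix x assume "x \<in> sum_set (ispan {UNIV}) C"
      then obtain n c where x: "x = of_int n + c" "c \<in> C" using ispan_UNIV by blast
      have "of_int n * 1 + c \<in> zmod.span ({1} \<union> C)"
        using x by (intro zmod.span_add zmod.span_scale zmod.span_base) auto
      then show "x \<in> zmod.span ({1} \<union> C)" using x by simp
    qed
    fix F c b assume A: "finite F \<and> F \<subseteq> {1} \<and> (\<Sum>b\<in>F. of_int (c b) * b) \<in> C" and b: "b \<in> F"
    then have F: "F = {1}" "b = 1" by auto
    then have "of_int (c 1) * 1 \<in> C" using A by simp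
    then show "c b = 0" using C(4)[of 1 "c 1"] False one_in_ispan F by auto
  qed
  then show ?thesis by blast
qed

text \<open>The generators themselves carry the well-order. \<open>C\<close> is arbitrary in the
  induction because the piece at an earlier generator is a quotient by a different ideal.\<close>

lemma rel_basis_pure_ideal:
  assumes r: "Well_order r" and k: "k \<in> Field r"
    and C: "pure_ideal (ispan (insert UNIV (underS r k))) C"
  shows "\<exists>B. rel_basis C (ispan (insert UNIV (underS r k))) B"
  using k C
proof (induction k arbitrary: C rule: wf_induct_rule[OF Well_orderD(4)[OF r]])
  case (1 k)
  let ?D = "underS r k"
  note C = pure_idealD[OF 1(3)]
  have D: "?D \<subseteq> Field r" unfolding underS_def Field_def by auto
  have "\<exists>B. rel_basis (sum_set (ispan {UNIV}) C) (sum_set (ispan (?D \<union> {UNIV})) C) B"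
  proof (rule rel_basis_ispan_step[OF r D])
    show "underS r j \<subseteq> ?D" if "j \<in> ?D" for j using underS_trans[OF r that] .
    show "\<exists>B. rel_basis C' (ispan (insert UNIV (underS r j))) B"
      if "j \<in> ?D" "pure_ideal (ispan (insert UNIV (underS r j))) C'" for j C'
      using 1(1)[of j C'] that D unfolding underS_def by auto
    show "zmod.subspace C" by (rule C(1))
    show "q * c \<in> C" if "q \<in> ispan (insert UNIV ?D)" "c \<in> C" for q c using C(3) that .
    show "x \<in> sum_set (ispan (underS r j \<union> {UNIV})) C"
      if "j \<in> ?D" "x \<in> ispan (insert UNIV ?D)" "n \<noteq> 0"
        "of_int n * x \<in> sum_set (ispan (underS r j \<union> {UNIV})) C" for j x n
      using pure_ideal_sum_pure[OF 1(3) underS_trans[OF r that(1)] that(2,3)] that(4) by simp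
  qed simp
  then obtain B where B: "rel_basis (sum_set (ispan {UNIV}) C) (sum_set (ispan (?D \<union> {UNIV})) C) B" by blast
  have eq: "sum_set (ispan (?D \<union> {UNIV})) C = ispan (insert UNIV ?D)"
  proof
    show "sum_set (ispan (?D \<union> {UNIV})) C \<subseteq> ispan (insert UNIV ?D)"
      using C(2) ispan_add by auto
    show "ispan (insert UNIV ?D) \<subseteq> sum_set (ispan (?D \<union> {UNIV})) C"
    proof
      fix x assume "x \<in> ispan (insert UNIV ?D)"
      then have "x + 0 \<in> sum_set (ispan (?D \<union> {UNIV})) C"
        using zmod.subspace_0[OF C(1)] by (intro sum_setI) auto
      then show "x \<in> sum_set (ispan (?D \<union> {UNIV})) C" by simp
    qed
  qed
  obtain B1 where B1: "rel_basis C (sum_set (ispan {UNIV}) C) B1" using rel_basis_const[OF 1(3)] by blast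
  have "rel_basis C (ispan (insert UNIV ?D)) (B1 \<union> B)"
  proof (rule rel_basis_trans[OF _ _ B1])
    show "zmod.subspace (sum_set (ispan {UNIV}) C)" by (intro subspace_sum_set C(1) subspace_ispan)
    show "C \<subseteq> sum_set (ispan {UNIV}) C"
    proof
      fix x assume "x \<in> C"
      then have "0 + x \<in> sum_set (ispan {UNIV}) C"
        using zero_in_ispan by (intro sum_setI)
      then show "x \<in> sum_set (ispan {UNIV}) C" by simp
    qed
    show "rel_basis (sum_set (ispan {UNIV}) C) (ispan (insert UNIV ?D)) B" using B eq by simp
    show "sum_set (ispan {UNIV}) C \<subseteq> ispan (insert UNIV ?D)"
      unfolding eq[symmetric] using ispan_mono[of "{UNIV}" "?D \<union> {UNIV}"] by blast
  qed
  then show ?case by blast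
qed

text \<open>The constants need not belong to this group, so the step is run with \<open>E0\<close>
  empty and the zero ideal, on top of the unital result for all initial segments.\<close>

theorem ispan_has_basis: "\<exists>B. rel_basis {0} (ispan A) B"
proof -
  obtain r where r: "well_order_on A r" using well_order_on by blast
  have F: "Field r = A" using well_order_on_Field[OF r] by simp
  then have wo: "Well_order r" using r by simp
  have 0: "ispan {} = {0::'a \<Rightarrow> int}" unfolding ispan_def by simp
  have P0: "sum_set (ispan D) {0} = ispan D" for D :: "'a set set" by auto
  have "\<exists>B. rel_basis (sum_set (ispan {}) {0}) (sum_set (ispan (A \<union> {})) {0}) B"
  proof (rule rel_basis_ispan_step[OF wo])
    show "A \<subseteq> Field r" using F by simp
    show "underS r k \<subseteq> A" for k using F unfolding underS_def Field_def by blast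
    show "\<exists>B. rel_basis C (ispan (insert UNIV (underS r k))) B"
      if "k \<in> A" "pure_ideal (ispan (insert UNIV (underS r k))) C" for k C
      using rel_basis_pure_ideal[OF wo _ that(2)] that(1) F by simp
    show "x \<in> sum_set (ispan (underS r k \<union> {})) {0}"
      if "n \<noteq> 0" "of_int n * x \<in> sum_set (ispan (underS r k \<union> {})) {0}" for k n and x :: "'a \<Rightarrow> int"
    proof -
      \<comment> \<open>Purity of the nonunital span: dividing all values by n is a map that sends 0
        to 0 and so preserves the span.\<close>
      have "(\<lambda>t. (\<lambda>m. m div n) ((of_int n * x) t)) \<in> ispan (underS r k)"
        using that(2) unfolding P0
        by (intro ispan_comp[where \<phi> = "\<lambda>m. m div n" and f = "of_int n * x"]) simp_all
      moreover have "(\<lambda>t. (\<lambda>m. m div n) ((of_int n * x) t)) = x" using that(1) by auto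
      ultimately show ?thesis unfolding P0 by simp
    qed
  qed auto
  then show ?thesis unfolding P0 0 by simp
qed

subsection \<open>Integer functions on a space whose positivity sets are compact open\<close>

lemma sum_apply: "(\<Sum>i\<in>A. h i) x = (\<Sum>i\<in>A. (h i :: 'a \<Rightarrow> 'b::comm_monoid_add) x)"
  by (induction A rule: infinite_finite_induct) simp_all

section \<open>Compactly supported continuous integer functions\<close>

definition compact_clopens :: "'a topology \<Rightarrow> 'a set set" where
  "compact_clopens Y = {W. compactin Y W \<and> openin Y W \<and> closedin Y W}"

lemma continuous_map_discrete_UNIV_iff:
  "continuous_map X (discrete_topology UNIV) f \<longleftrightarrow> (\<forall>m. openin X {x \<in> topspace X. f x = m})"
proof
  assume L: "continuous_map X (discrete_topology UNIV) f"
  then have "openin X {x \<in> topspace X. f x \<in> {m}}" for m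
    by (rule openin_continuous_map_preimage) simp
  then show "\<forall>m. openin X {x \<in> topspace X. f x = m}" by simp
next
  assume R: "\<forall>m. openin X {x \<in> topspace X. f x = m}"
  have "openin X {x \<in> topspace X. f x \<in> U}" for U
  proof -
    have "{x \<in> topspace X. f x \<in> U} = (\<Union>m\<in>U. {x \<in> topspace X. f x = m})" by blast
    then show ?thesis using R by auto
  qed
  then show "continuous_map X (discrete_topology UNIV) f" unfolding continuous_map_def by auto
qed

definition Cc_funs :: "'a topology \<Rightarrow> ('a \<Rightarrow> int) set" where
  "Cc_funs X = carrier (Cc_group X)"

lemma Cc_funs_iff:
  "f \<in> Cc_funs X \<longleftrightarrow> (\<forall>m. openin X {x \<in> topspace X. f x = m}) \<and>
     compactin X (X closure_of {x \<in> topspace X. f x \<noteq> 0}) \<and> (\<forall>x. x \<notin> topspace X \<longrightarrow> f x = 0)"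
  unfolding Cc_funs_def Cc_group_def by (simp add: continuous_map_discrete_UNIV_iff)

lemma Cc_group_eq_add_group: "Cc_group X = add_group (Cc_funs X)"
proof -
  have "(\<lambda>f g x. f x + g x) = ((+) :: ('a \<Rightarrow> int) \<Rightarrow> _)" by (intro ext) simp
  moreover have "(\<lambda>x. 0) = (0 :: 'a \<Rightarrow> int)" by (intro ext) simp
  ultimately show ?thesis unfolding Cc_funs_def Cc_group_def add_group_def by simp
qed

lemma compactin_closure_of_subset:
  assumes "compactin X (X closure_of T)" "S \<subseteq> T"
  shows "compactin X (X closure_of S)"
  using closed_compactin[OF assms(1) closure_of_mono[OF assms(2)]] by simp

lemma subspace_Cc_funs: "zmod.subspace (Cc_funs X)"
proof (rule zmod.subspaceI)
  have "{x \<in> topspace X. (0 :: 'a \<Rightarrow> int) x = m} = (if m = 0 then topspace X else {})" for m by auto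
  then show "0 \<in> Cc_funs X" unfolding Cc_funs_iff by auto
next
  fix f g assume f: "f \<in> Cc_funs X" and g: "g \<in> Cc_funs X"
  have "openin X {x \<in> topspace X. (f + g) x = m}" for m
  proof -
    have "{x \<in> topspace X. (f + g) x = m} =
        (\<Union>a. {x \<in> topspace X. f x = a} \<inter> {x \<in> topspace X. g x = m - a})" by auto
    moreover have "openin X ({x \<in> topspace X. f x = a} \<inter> {x \<in> topspace X. g x = m - a})" for a
      using f g unfolding Cc_funs_iff by (intro openin_Int) blast+
    ultimately show ?thesis by auto
  qed
  moreover have "compactin X (X closure_of ({x \<in> topspace X. f x \<noteq> 0} \<union> {x \<in> topspace X. g x \<noteq> 0}))"
    using f g unfolding Cc_funs_iff by (auto simp: closure_of_Un intro: compactin_Un)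
  then have "compactin X (X closure_of {x \<in> topspace X. (f + g) x \<noteq> 0})"
    by (rule compactin_closure_of_subset) auto
  ultimately show "f + g \<in> Cc_funs X" using f g unfolding Cc_funs_iff by simp
next
  fix n f assume f: "f \<in> Cc_funs X"
  have "openin X {x \<in> topspace X. (of_int n * f) x = m}" for m
  proof -
    have "{x \<in> topspace X. (of_int n * f) x = m} = (\<Union>a\<in>{a. n * a = m}. {x \<in> topspace X. f x = a})" by auto
    then show ?thesis using f unfolding Cc_funs_iff by auto
  qed
  moreover have "compactin X (X closure_of {x \<in> topspace X. f x \<noteq> 0})"
    using f unfolding Cc_funs_iff by auto
  then have "compactin X (X closure_of {x \<in> topspace X. (of_int n * f) x \<noteq> 0})"
    by (rule compactin_closure_of_subset) auto
  ultimately show "of_int n * f \<in> Cc_funs X" using f unfolding Cc_funs_iff by simp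
qed

lemma compact_clopens_Inter:
  assumes "E \<subseteq> compact_clopens Y" "finite E" "E \<noteq> {}"
  shows "\<Inter>E \<in> compact_clopens Y"
proof -
  obtain W where W: "W \<in> E" using assms(3) by blast
  have "closedin Y (\<Inter>E)" using assms unfolding compact_clopens_def by (intro closedin_Inter) auto
  moreover have "openin Y (\<Inter>E)" using assms unfolding compact_clopens_def by (intro openin_Inter) auto
  moreover have "compactin Y W" using assms(1) W unfolding compact_clopens_def by auto
  ultimately show ?thesis using closed_compactin[of Y W "\<Inter>E"] W unfolding compact_clopens_def by auto
qed

lemma indicator_in_Cc_funs:
  assumes "W \<in> compact_clopens X"
  shows "indicator W \<in> Cc_funs X"
proof -
  have W: "compactin X W" "openin X W" "closedin X W" using assms unfolding compact_clopens_def by auto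
  have sub: "W \<subseteq> topspace X" using W(2) openin_subset by blast
  have "openin X {x \<in> topspace X. indicator W x = m}" for m :: int
  proof -
    have "{x \<in> topspace X. indicator W x = m} = (if m = 1 then W else if m = 0 then topspace X - W else {})"
      using sub by (auto simp: indicator_def)
    then show ?thesis using W by auto
  qed
  moreover have "{x \<in> topspace X. indicator W x \<noteq> (0::int)} = W" using sub by (auto simp: indicator_def)
  ultimately show ?thesis unfolding Cc_funs_iff
    using W sub closure_of_closedin[OF W(3)] by (auto simp: indicator_def)
qed

text \<open>A continuous map to a discrete space has finite image on a compact set, and the level
  sets off 0 are compact clopen, being closed inside the support. This makes the freeness theorem
  applicable.\<close>

lemma Cc_funs_eq_ispan: "Cc_funs X = ispan (compact_clopens X)"
proof
  show "ispan (compact_clopens X) \<subseteq> Cc_funs X"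
    unfolding ispan_def
    by (intro zmod.span_minimal subspace_Cc_funs) (auto intro!: indicator_in_Cc_funs compact_clopens_Inter)
  show "Cc_funs X \<subseteq> ispan (compact_clopens X)"
  proof
    fix f assume "f \<in> Cc_funs X"
    then have f: "\<And>m. openin X {x \<in> topspace X. f x = m}"
      "compactin X (X closure_of {x \<in> topspace X. f x \<noteq> 0})" "\<And>x. x \<notin> topspace X \<Longrightarrow> f x = 0"
      unfolding Cc_funs_iff by auto
    define K where "K = X closure_of {x \<in> topspace X. f x \<noteq> 0}"
    define W where "W m = {x \<in> topspace X. f x = m}" for m
    have sub: "{x \<in> topspace X. f x \<noteq> 0} \<subseteq> K" unfolding K_def by (intro closure_of_subset) auto
    have "compactin (discrete_topology UNIV) (f ` K)"
      using f(1,2) unfolding K_def by (intro image_compactin) (auto simp: continuous_map_discrete_UNIV_iff)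
    then have fin: "finite (f ` K)" by (simp add: compactin_discrete_topology)
    have W: "W m \<in> compact_clopens X" if "m \<noteq> 0" for m
    proof -
      have "topspace X - W m = (\<Union>a\<in>-{m}. W a)" unfolding W_def by auto
      moreover have "openin X (\<Union>a\<in>-{m}. W a)" using f(1) unfolding W_def by auto
      ultimately have "closedin X (W m)" unfolding closedin_def by (auto simp: W_def)
      moreover have "W m \<subseteq> K" using sub that unfolding W_def by auto
      ultimately show ?thesis using closed_compactin[of X K "W m"] f(1,2) unfolding compact_clopens_def K_def W_def by auto
    qed
    have "f = (\<Sum>m\<in>f ` K - {0}. of_int m * indicator (W m))"
    proof
      fix x
      have xt: "f x \<noteq> 0 \<longrightarrow> x \<in> topspace X" using f(3) by blast
      have "(\<Sum>m\<in>f ` K - {0}. of_int m * indicator (W m)) x = (\<Sum>m\<in>f ` K - {0}. m * indicator (W m) x)"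
        by (simp add: sum_apply)
      also have "\<dots> = (\<Sum>m\<in>f ` K - {0}. if m = f x then f x else 0)"
        using xt by (intro sum.cong) (auto simp: W_def indicator_def)
      also have "\<dots> = f x" using fin sub f(3)[of x]
        by (cases "x \<in> topspace X") (auto simp: sum.delta image_iff)
      finally show "f x = (\<Sum>m\<in>f ` K - {0}. of_int m * indicator (W m)) x" by simp
    qed
    moreover have "(\<Sum>m\<in>f ` K - {0}. of_int m * indicator (W m)) \<in> ispan (compact_clopens X)"
      using W by (intro zmod.subspace_sum[OF subspace_ispan] ispan_scale indicator_in_ispan) auto
    ultimately show "f \<in> ispan (compact_clopens X)" by simp
  qed
qed

text \<open>For an almost Dedekind domain, \<open>X\<close> will be the inverse topology on the
  maximal ideals and \<open>G\<close> the group of value functions of invertible ideals. These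
  axioms carry the topological half of the argument, in which no ideals occur.\<close>

locale positivity_space =
  fixes X :: "'a topology" and G :: "('a \<Rightarrow> int) set"
  assumes subspace_G: "zmod.subspace G"
    and min_G: "\<And>f g. f \<in> G \<Longrightarrow> g \<in> G \<Longrightarrow> (\<lambda>x. min (f x) (g x)) \<in> G"
    and zero_outside: "\<And>f x. f \<in> G \<Longrightarrow> x \<notin> topspace X \<Longrightarrow> f x = 0"
    and open_pos: "\<And>f. f \<in> G \<Longrightarrow> openin X {x. f x > 0}"
    and compact_pos: "\<And>f. f \<in> G \<Longrightarrow> compactin X {x. f x > 0}"
    and base_pos: "\<And>S x. openin X S \<Longrightarrow> x \<in> S \<Longrightarrow> \<exists>f\<in>G. f x > 0 \<and> {y. f y > 0} \<subseteq> S"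
    and Hausdorff: "Hausdorff_space X"
begin

lemma max_G: "f \<in> G \<Longrightarrow> g \<in> G \<Longrightarrow> (\<lambda>x. max (f x) (g x)) \<in> G"
proof -
  assume fg: "f \<in> G" "g \<in> G"
  have "(\<lambda>x. max (f x) (g x)) = f + g - (\<lambda>x. min (f x) (g x))" by (auto simp: fun_eq_iff)
  then show ?thesis
    using fg min_G zmod.subspace_add[OF subspace_G] zmod.subspace_diff[OF subspace_G] by metis
qed

lemma zero_G: "0 \<in> G" and uminus_G: "f \<in> G \<Longrightarrow> - f \<in> G"
  using zmod.subspace_0[OF subspace_G] zmod.subspace_neg[OF subspace_G] by auto

lemma pos_part_G: "f \<in> G \<Longrightarrow> (\<lambda>x. max (f x) 0) \<in> G"
  using max_G[OF _ zero_G] by simp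

lemma closed_pos: "f \<in> G \<Longrightarrow> closedin X {x. f x > 0}"
  using compactin_imp_closedin[OF Hausdorff compact_pos] .

definition nonzeros :: "('a \<Rightarrow> int) \<Rightarrow> 'a set" where
  "nonzeros f = {x. f x \<noteq> 0}"

lemma nonzeros_G:
  assumes "f \<in> G"
  shows "compactin X (nonzeros f)" "closedin X (nonzeros f)" "nonzeros f \<subseteq> topspace X"
proof -
  have "nonzeros f = {x. f x > 0} \<union> {x. (- f) x > 0}" unfolding nonzeros_def by auto
  then show "compactin X (nonzeros f)" "closedin X (nonzeros f)"
    using compact_pos[OF assms] compact_pos[OF uminus_G[OF assms]]
      closed_pos[OF assms] closed_pos[OF uminus_G[OF assms]] by (auto intro: compactin_Un)
  then show "nonzeros f \<subseteq> topspace X" using closedin_subset by blast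
qed

text \<open>If \<open>f\<close> holds the values of an ideal of the overring attached to
  \<open>C\<close>, then \<open>f x \<ge> 1\<close> says that the ideal lies in the maximal ideal at
  x, and \<open>f y \<ge> 2\<close> that it lies in the square of the one at y. So this is
  criticality expressed by values; \<open>critical_overring_eq_Cr\<close> makes it precise.\<close>

definition Cr :: "'a set \<Rightarrow> 'a set" where
  "Cr C = {x \<in> C. \<forall>f\<in>G. (\<forall>y\<in>C. f y \<ge> 0) \<and> f x \<ge> 1 \<longrightarrow> (\<exists>y\<in>C. f y \<ge> 2)}"

abbreviation noncritical :: "'a set \<Rightarrow> 'a topology" where
  "noncritical C \<equiv> subtopology X (C - Cr C)"

text \<open>Nonnegativity is required everywhere, the bound only on \<open>C\<close>. On
  \<open>C\<close> such a function is an indicator and can play the role of a local constant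
  1.\<close>

definition cut_funs :: "'a set \<Rightarrow> ('a \<Rightarrow> int) set" where
  "cut_funs C = {f \<in> G. (\<forall>y. f y \<ge> 0) \<and> (\<forall>y\<in>C. f y \<le> 1)}"

lemma cut_funs_exists:
  assumes "x \<in> C - Cr C"
  shows "\<exists>f\<in>cut_funs C. f x = 1"
proof -
  obtain f where f: "f \<in> G" "\<forall>y\<in>C. f y \<ge> 0" "f x \<ge> 1" "\<not> (\<exists>y\<in>C. f y \<ge> 2)"
    using assms unfolding Cr_def by blast
  have "f x = 1" using f(3,4) assms by force
  have "(\<lambda>x. max (f x) 0) \<in> cut_funs C" using pos_part_G[OF f(1)] f unfolding cut_funs_def by force
  then show ?thesis using \<open>f x = 1\<close> by (intro bexI[of _ "\<lambda>x. max (f x) 0"]) simp_all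
qed

text \<open>A value at least 1 at a critical point would force a value at least 2 somewhere in
  \<open>C\<close>.\<close>

lemma cut_funs_not_Cr: "f \<in> cut_funs C \<Longrightarrow> y \<in> Cr C \<Longrightarrow> f y = 0"
proof (rule ccontr)
  assume A: "f \<in> cut_funs C" "y \<in> Cr C" "f y \<noteq> 0"
  then have "f y \<ge> 1" unfolding cut_funs_def using mem_Collect_eq by (smt (verit))
  then obtain z where "z \<in> C" "f z \<ge> 2" using A unfolding Cr_def cut_funs_def by blast
  then show False using A(1) unfolding cut_funs_def by force
qed

text \<open>The points of \<open>C\<close> outside \<open>Cr C\<close> are those where some cut
  function is positive, and positivity sets are open.\<close>

lemma closed_Cr:
  assumes "closedin X C"
  shows "closedin X (Cr C)" "Cr C \<subseteq> C"
proof -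
  show "Cr C \<subseteq> C" unfolding Cr_def by blast
  have "Cr C = C - (\<Union>f\<in>cut_funs C. {x. f x > 0})"
  proof
    show "Cr C \<subseteq> C - (\<Union>f\<in>cut_funs C. {x. f x > 0})"
      using cut_funs_not_Cr unfolding Cr_def by fastforce
    show "C - (\<Union>f\<in>cut_funs C. {x. f x > 0}) \<subseteq> Cr C"
    proof
      fix x assume x: "x \<in> C - (\<Union>f\<in>cut_funs C. {x. f x > 0})"
      show "x \<in> Cr C"
      proof (rule ccontr)
        assume "x \<notin> Cr C"
        then obtain f where "f \<in> cut_funs C" "f x = 1" using cut_funs_exists x by blast
        then show False using x by force
      qed
    qed
  qed
  moreover have "openin X (\<Union>f\<in>cut_funs C. {x. f x > 0})"
    using open_pos unfolding cut_funs_def by (intro openin_Union) auto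
  ultimately show "closedin X (Cr C)" using assms by (simp add: closedin_diff)
qed

definition vanishing :: "'a set \<Rightarrow> ('a \<Rightarrow> int) set" where
  "vanishing C = {f \<in> G. \<forall>x\<in>C. f x = 0}"

lemma subspace_vanishing: "zmod.subspace (vanishing C)"
proof (rule zmod.subspaceI)
  show "0 \<in> vanishing C" unfolding vanishing_def using zero_G by simp
  show "f + g \<in> vanishing C" if "f \<in> vanishing C" "g \<in> vanishing C" for f g
    using that zmod.subspace_add[OF subspace_G] unfolding vanishing_def by simp
  show "of_int n * f \<in> vanishing C" if "f \<in> vanishing C" for n f
    using that zmod.subspace_scale[OF subspace_G] unfolding vanishing_def by simp
qed

definition restr :: "'a set \<Rightarrow> ('a \<Rightarrow> int) \<Rightarrow> 'a \<Rightarrow> int" where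
  "restr C f = (\<lambda>x. if x \<in> C then f x else 0)"

lemma zlinear_restr: "zlinear (restr C)"
  by (rule zlinearI) (auto simp: restr_def fun_eq_iff)

lemma restr_eq_0_iff: "f \<in> G \<Longrightarrow> restr C f = 0 \<longleftrightarrow> f \<in> vanishing C"
  unfolding restr_def vanishing_def by (auto simp: fun_eq_iff)

text \<open>Continuity is shown by comparing \<open>f\<close> with multiples of a cut function. The
  support meets \<open>C\<close> away from \<open>Cr C\<close>, so it remains compact and closed in
  the noncritical part.\<close>

lemma restr_in_Cc_funs:
  assumes C: "closedin X C" and f: "f \<in> vanishing (Cr C)"
  shows "restr C f \<in> Cc_funs (noncritical C)"
proof -
  let ?Y = "noncritical C" and ?g = "restr C f"
  have fG: "f \<in> G" and f0: "\<And>x. x \<in> Cr C \<Longrightarrow> f x = 0" using f unfolding vanishing_def by auto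
  have top: "topspace ?Y = C - Cr C" using closedin_subset[OF C] by auto
  have "openin ?Y {x \<in> topspace ?Y. ?g x = m}" for m
  proof (subst openin_subopen, intro ballI)
    fix x assume x: "x \<in> {x \<in> topspace ?Y. ?g x = m}"
    then have xC: "x \<in> C - Cr C" "f x = m" unfolding top restr_def by auto
    obtain u where u: "u \<in> cut_funs C" "u x = 1" using cut_funs_exists[OF xC(1)] by blast
    have uG: "u \<in> G" using u unfolding cut_funs_def by auto
    \<comment> \<open>Where \<open>u\<close> is positive on \<open>C\<close> it equals 1, so there
      \<open>h = 0\<close> amounts to \<open>f = m\<close>; and the zero set of \<open>h\<close> is
      open because \<open>nonzeros h\<close> is closed.\<close>
    define h where "h = f - of_int m * u"
    have hG: "h \<in> G" unfolding h_def
      using zmod.subspace_diff[OF subspace_G fG zmod.subspace_scale[OF subspace_G uG]] .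
    let ?T = "((topspace X - nonzeros h) \<inter> {x. u x > 0}) \<inter> (C - Cr C)"
    have "openin ?Y ?T"
      using nonzeros_G(2)[OF hG] open_pos[OF uG] by (intro openin_subtopology_Int) auto
    moreover have "x \<in> ?T" using xC u closedin_subset[OF C] unfolding nonzeros_def h_def by auto
    moreover have "?T \<subseteq> {x \<in> topspace ?Y. ?g x = m}"
    proof
      fix y assume y: "y \<in> ?T"
      then have "u y = 1" using u(1) unfolding cut_funs_def by force
      moreover have "h y = 0" using y unfolding nonzeros_def by auto
      ultimately have "f y = m" unfolding h_def by simp
      then show "y \<in> {x \<in> topspace ?Y. ?g x = m}" using y unfolding top restr_def by auto
    qed
    ultimately show "\<exists>T. openin ?Y T \<and> x \<in> T \<and> T \<subseteq> {x \<in> topspace ?Y. ?g x = m}" by blast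
  qed
  moreover have "compactin ?Y (?Y closure_of {x \<in> topspace ?Y. ?g x \<noteq> 0})"
  proof -
    have eq: "{x \<in> topspace ?Y. ?g x \<noteq> 0} = nonzeros f \<inter> C"
      unfolding top nonzeros_def restr_def using f0 by auto
    have sub: "nonzeros f \<inter> C \<subseteq> C - Cr C" using f0 unfolding nonzeros_def by auto
    have "compactin X (nonzeros f \<inter> C)" using compact_Int_closedin[OF nonzeros_G(1)[OF fG] C] .
    then have comp: "compactin ?Y (nonzeros f \<inter> C)" using sub by (simp add: compactin_subtopology)
    have "closedin X (nonzeros f \<inter> C)" using nonzeros_G(2)[OF fG] C by blast
    then have "closedin ?Y (nonzeros f \<inter> C)" using sub by (simp add: closedin_closed_subtopology closedin_subset_topspace)
    then show ?thesis unfolding eq using comp by (simp add: closure_of_closedin)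
  qed
  moreover have "?g x = 0" if "x \<notin> topspace ?Y" for x using that f0 unfolding top restr_def by auto
  ultimately show ?thesis unfolding Cc_funs_iff by blast
qed

text \<open>Compactness covers \<open>W\<close> by finitely many positivity sets of cut functions
  whose trace on \<open>C\<close> stays in \<open>W\<close>. Their pointwise maximum is again such a
  function, and on \<open>C\<close> it takes only the values 0 and 1.\<close>

lemma indicator_in_restr_image:
  assumes C: "closedin X C" and W: "W \<in> compact_clopens (noncritical C)"
  shows "\<exists>f\<in>vanishing (Cr C). restr C f = indicator W"
proof -
  let ?Y = "noncritical C"
  have comp: "compactin X W" and WC: "W \<subseteq> C - Cr C" and op: "openin ?Y W"
    using W unfolding compact_clopens_def by (auto simp: compactin_subtopology)
  obtain S where S: "openin X S" "W = S \<inter> (C - Cr C)" using op unfolding openin_subtopology by auto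
  \<comment> \<open>\<open>S\<close> may meet \<open>Cr C\<close>; after removing this closed set,
    positivity sets inside \<open>S - Cr C\<close> meet \<open>C\<close> only in
    \<open>W\<close>.\<close>
  have S': "openin X (S - Cr C)" using S(1) closed_Cr[OF C] by blast
  define \<F> where "\<F> = {f \<in> cut_funs C. {x. f x > 0} \<inter> C \<subseteq> W}"
  have "\<exists>f\<in>\<F>. f x > 0" if x: "x \<in> W" for x
  proof -
    have xx: "x \<in> S - Cr C" "x \<in> C - Cr C" using x S(2) by auto
    obtain f where f: "f \<in> G" "f x > 0" "{y. f y > 0} \<subseteq> S - Cr C" using base_pos[OF S' xx(1)] by blast
    obtain u where u: "u \<in> cut_funs C" "u x = 1" using cut_funs_exists[OF xx(2)] by blast
    \<comment> \<open>\<open>f\<close> confines the positivity set, \<open>u\<close> keeps the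
      values on \<open>C\<close> at most 1.\<close>
    let ?h = "\<lambda>x. min (max (f x) 0) (u x)"
    have "?h \<in> G" using min_G[OF pos_part_G[OF f(1)], of u] u(1) unfolding cut_funs_def by blast
    moreover have "0 \<le> ?h y" for y using u(1) unfolding cut_funs_def by auto
    moreover have "?h y \<le> 1" if "y \<in> C" for y using u(1) that unfolding cut_funs_def by (auto simp: min_le_iff_disj)
    moreover have "{x. ?h x > 0} \<inter> C \<subseteq> W" using f(3) S(2) by (auto simp: less_max_iff_disj)
    ultimately have "?h \<in> \<F>" unfolding \<F>_def cut_funs_def by blast
    moreover have "?h x > 0" using f(2) u(2) by simp
    ultimately show ?thesis by (intro bexI[of _ ?h])
  qed
  then have cov: "W \<subseteq> \<Union>((\<lambda>f. {x. f x > 0}) ` \<F>)" by blast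
  have "\<And>U. U \<in> (\<lambda>f. {x. f x > 0}) ` \<F> \<Longrightarrow> openin X U"
    using open_pos unfolding \<F>_def cut_funs_def by blast
  then obtain \<U> where U: "finite \<U>" "\<U> \<subseteq> (\<lambda>f. {x. f x > 0}) ` \<F>" "W \<subseteq> \<Union>\<U>"
    using compactinD[OF comp _ cov] by blast
  obtain F where F: "F \<subseteq> \<F>" "finite F" "\<U> = (\<lambda>f. {x. f x > 0}) ` F"
    using finite_subset_image[OF U(1,2)] by blast
  have "\<exists>g\<in>\<F>. \<forall>x. (\<exists>f\<in>F. f x > 0) \<longrightarrow> g x > 0"
    using F(2,1)
  proof (induction F rule: finite_induct)
    case empty
    have "0 \<in> \<F>" unfolding \<F>_def cut_funs_def using zero_G by auto
    then show ?case by blast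
  next
    case (insert f F)
    then obtain g where g: "g \<in> \<F>" "\<forall>x. (\<exists>f\<in>F. f x > 0) \<longrightarrow> g x > 0" by blast
    have f: "f \<in> \<F>" using insert by blast
    let ?h = "\<lambda>x. max (f x) (g x)"
    have "?h \<in> G" using max_G f g(1) unfolding \<F>_def cut_funs_def by blast
    moreover have "0 \<le> ?h y" for y using f unfolding \<F>_def cut_funs_def by (auto simp: le_max_iff_disj)
    moreover have "?h y \<le> 1" if "y \<in> C" for y using f g(1) that unfolding \<F>_def cut_funs_def by auto
    moreover have "{x. ?h x > 0} \<inter> C \<subseteq> W"
      using f g(1) unfolding \<F>_def by (auto simp: less_max_iff_disj)
    ultimately have "?h \<in> \<F>" unfolding \<F>_def cut_funs_def by blast
    moreover have "\<forall>x. (\<exists>f\<in>insert f F. f x > 0) \<longrightarrow> ?h x > 0" using g(2) by (auto simp: less_max_iff_disj)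
    ultimately show ?case by (intro bexI[of _ ?h])
  qed
  then obtain g where g: "g \<in> \<F>" "\<And>x f. f \<in> F \<Longrightarrow> f x > 0 \<Longrightarrow> g x > 0" by blast
  have gW: "g x > 0" if x: "x \<in> W" for x
  proof -
    obtain f where "f \<in> F" "f x > 0" using U(3) F(3) x by blast
    then show ?thesis by (rule g(2))
  qed
  have gc: "g \<in> cut_funs C" "{x. g x > 0} \<inter> C \<subseteq> W" using g(1) unfolding \<F>_def by auto
  have g01: "g x \<ge> 0" for x using gc(1) unfolding cut_funs_def by auto
  have g1: "g x \<le> 1" if "x \<in> C" for x using gc(1) that unfolding cut_funs_def by auto
  have "g \<in> vanishing (Cr C)"
    unfolding vanishing_def using cut_funs_not_Cr[OF gc(1)] gc(1) unfolding cut_funs_def by auto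
  moreover have "restr C g = indicator W"
  proof
    fix x
    consider "x \<in> W" | "x \<in> C" "x \<notin> W" | "x \<notin> C" by blast
    then show "restr C g x = indicator W x"
    proof cases
      case 1
      then have "g x = 1" using gW[OF 1] g1[of x] WC by fastforce
      then show ?thesis using 1 WC unfolding restr_def by auto
    next
      case 2
      then have "\<not> 0 < g x" using gc(2) by blast
      then have "g x = 0" using g01[of x] by simp
      then show ?thesis using 2 unfolding restr_def by auto
    next
      case 3 then show ?thesis using WC unfolding restr_def by (auto simp: indicator_def)
    qed
  qed
  ultimately show ?thesis by blast
qed

text \<open>The image is a subgroup, so only the indicators of compact clopen sets have to be
  lifted.\<close>

theorem restr_image:
  assumes C: "closedin X C"
  shows "restr C ` vanishing (Cr C) = Cc_funs (noncritical C)"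
proof
  show "restr C ` vanishing (Cr C) \<subseteq> Cc_funs (noncritical C)"
    using restr_in_Cc_funs[OF C] by blast
  have "zmod.subspace (restr C ` vanishing (Cr C))"
    by (rule module_hom.subspace_image[OF zlinear_restr subspace_vanishing])
  then show "Cc_funs (noncritical C) \<subseteq> restr C ` vanishing (Cr C)"
    unfolding Cc_funs_eq_ispan ispan_def
  proof (rule zmod.span_minimal[rotated])
    show "{indicator (\<Inter>E) |E. E \<subseteq> compact_clopens (noncritical C) \<and> finite E \<and> E \<noteq> {}}
        \<subseteq> restr C ` vanishing (Cr C)"
    proof
      fix h :: "'a \<Rightarrow> int" 
      assume "h \<in> {indicator (\<Inter>E) |E. E \<subseteq> compact_clopens (noncritical C) \<and> finite E \<and> E \<noteq> {}}"
      then obtain E where E: "h = indicator (\<Inter>E)" "E \<subseteq> compact_clopens (noncritical C)"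
        "finite E" "E \<noteq> {}" by blast
      show "h \<in> restr C ` vanishing (Cr C)"
        using indicator_in_restr_image[OF C compact_clopens_Inter[OF E(2-4)]] E(1) by (metis image_eqI)
    qed
  qed
qed

text \<open>Restriction to \<open>C\<close> has kernel \<open>vanishing C\<close>, so lifting a
  basis of the function group yields representatives for the graded piece.\<close>

corollary vanishing_rel_basis:
  assumes C: "closedin X C"
  shows "\<exists>S. rel_basis (vanishing C) (vanishing (Cr C)) S \<and>
    free_Abelian_group S \<cong> Cc_group (noncritical C)"
proof -
  let ?Y = "noncritical C"
  obtain B where B: "rel_basis {0} (Cc_funs ?Y) B"
    using ispan_has_basis[of "compact_clopens ?Y"] unfolding Cc_funs_eq_ispan by blast
  have "\<exists>S. rel_basis (vanishing C) (vanishing (Cr C)) S \<and> bij_betw (restr C) S B"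
    using restr_eq_0_iff restr_image[OF C] B
    by (intro rel_basis_lift[OF zlinear_restr subspace_vanishing]) (auto simp: vanishing_def)
  then obtain S where S: "rel_basis (vanishing C) (vanishing (Cr C)) S" "bij_betw (restr C) S B" by blast
  have "free_Abelian_group S \<cong> add_group (Cc_funs ?Y)"
    by (rule free_Abelian_group_iso_add_group[OF subspace_Cc_funs B S(2)])
  then show ?thesis using S(1) unfolding Cc_group_eq_add_group by blast
qed

text \<open>The set where \<open>f\<close> is nonzero is compact and covered by the complements of
  the members; a finite subcover and the chain condition leave a single member. This gives the
  continuity of the filtration at limit stages.\<close>

lemma vanishing_chain:
  assumes chain: "\<C> \<noteq> {}" "\<And>C D. C \<in> \<C> \<Longrightarrow> D \<in> \<C> \<Longrightarrow> C \<subseteq> D \<or> D \<subseteq> C"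
    and closed: "\<And>C. C \<in> \<C> \<Longrightarrow> closedin X C"
    and f: "f \<in> vanishing (\<Inter>\<C>)"
  shows "\<exists>C\<in>\<C>. f \<in> vanishing C"
proof -
  have fG: "f \<in> G" and f0: "\<And>x. x \<in> \<Inter>\<C> \<Longrightarrow> f x = 0" using f unfolding vanishing_def by auto
  have cov: "nonzeros f \<subseteq> \<Union>((\<lambda>C. topspace X - C) ` \<C>)"
  proof
    fix x assume x: "x \<in> nonzeros f"
    then have "x \<notin> \<Inter>\<C>" using f0 unfolding nonzeros_def by auto
    then show "x \<in> \<Union>((\<lambda>C. topspace X - C) ` \<C>)" using x nonzeros_G(3)[OF fG] by blast
  qed
  obtain \<U> where U: "finite \<U>" "\<U> \<subseteq> (\<lambda>C. topspace X - C) ` \<C>" "nonzeros f \<subseteq> \<Union>\<U>"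
    using compactinD[OF nonzeros_G(1)[OF fG] _ cov] closed by blast
  obtain F where F: "F \<subseteq> \<C>" "finite F" "\<U> = (\<lambda>C. topspace X - C) ` F"
    using finite_subset_image[OF U(1,2)] by blast
  obtain C where C: "C \<in> \<C>" "\<And>D. D \<in> F \<Longrightarrow> C \<subseteq> D"
  proof (cases "F = {}")
    case True then show ?thesis using chain(1) that by blast
  next
    case False
    then obtain C where C: "C \<in> F" "\<forall>D\<in>F. D \<subseteq> C \<longrightarrow> C = D"
      using finite_has_minimal[OF F(2) False] by blast
    then show ?thesis using chain(2) F(1) by (intro that[of C]) blast+
  qed
  have "C \<inter> nonzeros f = {}" using U(3) F(3) C(2) by blast
  then have "f \<in> vanishing C" using fG unfolding vanishing_def nonzeros_def by auto
  then show ?thesis using C(1) by blast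
qed

end

subsection \<open>Valuations and invertible ideals of an almost Dedekind domain\<close>

lemma zmod_subspace_diffI:
  fixes S :: "'v::comm_ring_1 set"
  assumes 0: "0 \<in> S" and diff: "\<And>x y. x \<in> S \<Longrightarrow> y \<in> S \<Longrightarrow> x - y \<in> S"
  shows "zmod.subspace S"
proof (rule zmod.subspaceI)
  have neg: "- x \<in> S" if "x \<in> S" for x using diff[OF 0 that] by simp
  show add: "x + y \<in> S" if "x \<in> S" "y \<in> S" for x y using diff[OF that(1) neg[OF that(2)]] by simp
  have nat: "of_nat k * x \<in> S" if "x \<in> S" for k x
  proof (induction k)
    case (Suc k)
    then show ?case using add[OF that Suc] by (simp add: algebra_simps)
  qed (simp add: 0)
  show "of_int n * x \<in> S" if "x \<in> S" for n x
  proof (cases "n \<ge> 0")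
    case True then show ?thesis using nat[OF that, of "nat n"] by simp
  next
    case False then show ?thesis using neg[OF nat[OF that, of "nat (- n)"]] by simp
  qed
qed (rule 0)

lemma subringD:
  assumes "subring R"
  shows "0 \<in> R" "1 \<in> R" "\<And>x y. x \<in> R \<Longrightarrow> y \<in> R \<Longrightarrow> x + y \<in> R"
    "\<And>x y. x \<in> R \<Longrightarrow> y \<in> R \<Longrightarrow> x * y \<in> R" "\<And>x. x \<in> R \<Longrightarrow> - x \<in> R"
    "\<And>x y. x \<in> R \<Longrightarrow> y \<in> R \<Longrightarrow> x - y \<in> R"
proof -
  show a: "0 \<in> R" "1 \<in> R" "\<And>x y. x \<in> R \<Longrightarrow> y \<in> R \<Longrightarrow> x + y \<in> R"
    "\<And>x y. x \<in> R \<Longrightarrow> y \<in> R \<Longrightarrow> x * y \<in> R" "\<And>x. x \<in> R \<Longrightarrow> - x \<in> R"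
    using assms unfolding subring_def by auto
  show "x - y \<in> R" if "x \<in> R" "y \<in> R" for x y using a(3)[OF that(1) a(5)[OF that(2)]] by simp
qed

lemma subring_sum: "subring R \<Longrightarrow> (\<And>i. i \<in> A \<Longrightarrow> f i \<in> R) \<Longrightarrow> sum f A \<in> R"
  by (induction A rule: infinite_finite_induct) (auto intro: subringD)

section \<open>Ideals, maximal ideals and prime ideals of a subring of a field\<close>

lemma is_idealD:
  assumes "is_ideal R I"
  shows "I \<subseteq> R" "0 \<in> I" "\<And>x y. x \<in> I \<Longrightarrow> y \<in> I \<Longrightarrow> x + y \<in> I"
    "\<And>r x. r \<in> R \<Longrightarrow> x \<in> I \<Longrightarrow> r * x \<in> I"
  using assms unfolding is_ideal_def by auto

lemma ideal_sum: "is_ideal R I \<Longrightarrow> (\<And>i. i \<in> A \<Longrightarrow> f i \<in> I) \<Longrightarrow> sum f A \<in> I"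
  by (induction A rule: infinite_finite_induct) (auto intro: is_idealD)

lemma ideal_eq_ring: "is_ideal R I \<Longrightarrow> 1 \<in> I \<Longrightarrow> I = R"
  using is_idealD(1,4)[of R I] by fastforce

lemma ideal_multI:
  assumes "finite A" "\<And>i. i \<in> A \<Longrightarrow> f i \<in> I" "\<And>i. i \<in> A \<Longrightarrow> g i \<in> J"
  shows "(\<Sum>i\<in>A. f i * g i) \<in> ideal_mult I J"
proof -
  obtain h where h: "bij_betw h {0..<card A} A" using ex_bij_betw_nat_finite[OF assms(1)] by blast
  have "h i \<in> A" if "i < card A" for i using bij_betwE[OF h] that by auto
  moreover have "(\<Sum>i\<in>A. f i * g i) = (\<Sum>i<card A. f (h i) * g (h i))"
    using sum.reindex_bij_betw[OF h, of "\<lambda>i. f i * g i"] by (simp add: atLeast0LessThan)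
  ultimately show ?thesis unfolding ideal_mult_def
    using assms(2,3) by (intro CollectI exI[of _ "card A"] exI[of _ "\<lambda>i. f (h i)"] exI[of _ "\<lambda>i. g (h i)"]) auto
qed

lemma ideal_multI1: "x \<in> I \<Longrightarrow> y \<in> J \<Longrightarrow> x * y \<in> ideal_mult I J"
  using ideal_multI[of "{0::nat}" "\<lambda>_. x" I "\<lambda>_. y" J] by simp

lemma ideal_multI2:
  assumes "x \<in> I" "y \<in> J" "x' \<in> I" "y' \<in> J"
  shows "x * y + x' * y' \<in> ideal_mult I J"
  using ideal_multI[of "{True, False}" "\<lambda>b. if b then x else x'" I "\<lambda>b. if b then y else y'" J] assms
  by (simp split: if_splits)

lemma ideal_multE:
  assumes "z \<in> ideal_mult I J"
  obtains n :: nat and f g where "\<And>i. i < n \<Longrightarrow> f i \<in> I" "\<And>i. i < n \<Longrightarrow> g i \<in> J" "z = (\<Sum>i<n. f i * g i)"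
  using assms unfolding ideal_mult_def by blast

lemma max_idealsD:
  assumes "M \<in> max_ideals R"
  shows "is_ideal R M" "M \<noteq> R" "1 \<notin> M" "\<And>J. is_ideal R J \<Longrightarrow> M \<subseteq> J \<Longrightarrow> J = M \<or> J = R"
  using assms ideal_eq_ring unfolding max_ideals_def by auto

lemmas max_ideal_closed = is_idealD[OF max_idealsD(1)]

text \<open>Zorn's lemma in a form that serves twice: \<open>A = {1}\<close> leads to maximal
  ideals, a multiplicatively closed \<open>A\<close> to primes.\<close>

lemma exists_ideal_avoiding:
  assumes I: "is_ideal R I" "I \<inter> A = {}"
  shows "\<exists>P. is_ideal R P \<and> I \<subseteq> P \<and> P \<inter> A = {} \<and> (\<forall>J. is_ideal R J \<and> P \<subseteq> J \<and> J \<inter> A = {} \<longrightarrow> J = P)"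
proof -
  define S where "S = {J. is_ideal R J \<and> I \<subseteq> J \<and> J \<inter> A = {}}"
  have "\<exists>M\<in>S. \<forall>X\<in>S. M \<subseteq> X \<longrightarrow> X = M"
  proof (rule subset_Zorn_nonempty)
    show "S \<noteq> {}" using I unfolding S_def by blast
    fix \<C> assume C: "\<C> \<noteq> {}" "subset.chain S \<C>"
    then have CS: "\<C> \<subseteq> S" and lin: "\<And>A B. A \<in> \<C> \<Longrightarrow> B \<in> \<C> \<Longrightarrow> A \<subseteq> B \<or> B \<subseteq> A"
      by (auto simp: subset_chain_def)
    have id: "is_ideal R B" "I \<subseteq> B" "B \<inter> A = {}" if "B \<in> \<C>" for B using CS that unfolding S_def by auto
    have "is_ideal R (\<Union>\<C>)"
      unfolding is_ideal_def
    proof (intro conjI ballI)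
      show "\<Union>\<C> \<subseteq> R" using is_idealD(1)[OF id(1)] by blast
      show "0 \<in> \<Union>\<C>" using is_idealD(2)[OF id(1)] C(1) by blast
      show "x + y \<in> \<Union>\<C>" if xy: "x \<in> \<Union>\<C>" "y \<in> \<Union>\<C>" for x y
      proof -
        obtain A B where AB: "A \<in> \<C>" "B \<in> \<C>" "x \<in> A" "y \<in> B" using xy by blast
        then obtain D where "D \<in> \<C>" "x \<in> D" "y \<in> D" using lin by blast
        then show ?thesis using is_idealD(3)[OF id(1)] by blast
      qed
      show "r * x \<in> \<Union>\<C>" if "r \<in> R" "x \<in> \<Union>\<C>" for r x
        using is_idealD(4)[OF id(1)] that by blast
    qed
    then show "\<Union>\<C> \<in> S" using id(2,3) C(1) unfolding S_def by blast
  qed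
  then obtain P where P: "P \<in> S" "\<And>X. X \<in> S \<Longrightarrow> P \<subseteq> X \<Longrightarrow> X = P" by blast
  have "J = P" if "is_ideal R J" "P \<subseteq> J" "J \<inter> A = {}" for J
    using P that unfolding S_def by blast
  then show ?thesis using P(1) unfolding S_def by blast
qed

lemma exists_max_ideal:
  assumes R: "subring R" and I: "is_ideal R I" "1 \<notin> I"
  shows "\<exists>M\<in>max_ideals R. I \<subseteq> M"
proof -
  obtain M where M: "is_ideal R M" "I \<subseteq> M" "1 \<notin> M"
    "\<forall>J. is_ideal R J \<and> M \<subseteq> J \<and> 1 \<notin> J \<longrightarrow> J = M"
    using exists_ideal_avoiding[OF I(1), of "{1}"] I(2) by auto
  have "M \<noteq> R" using M(3) subringD(2)[OF R] by blast
  moreover have "J = M \<or> J = R" if "is_ideal R J" "M \<subseteq> J" for J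
    using M(4) ideal_eq_ring[OF that(1)] that by blast
  ultimately have "M \<in> max_ideals R" unfolding max_ideals_def using M(1) by simp
  then show ?thesis using M(2) by blast
qed

lemma is_ideal_adjoin:
  assumes R: "subring R" and M: "is_ideal R M" and b: "b \<in> R"
  shows "is_ideal R {m + r * b | m r. m \<in> M \<and> r \<in> R}" (is "is_ideal R ?J")
    "M \<subseteq> {m + r * b | m r. m \<in> M \<and> r \<in> R}" "b \<in> {m + r * b | m r. m \<in> M \<and> r \<in> R}"
proof -
  note id = is_idealD[OF M] and ring = subringD[OF R]
  show "M \<subseteq> ?J" using ring(1) by force
  show "b \<in> ?J" using id(2) ring(2) by force
  show "is_ideal R ?J"
    unfolding is_ideal_def
  proof (intro conjI ballI)
    show "?J \<subseteq> R" using id(1) ring b by auto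
    show "0 \<in> ?J" using id(2) ring(1) by force
  next
    fix x y assume x: "x \<in> ?J" and y: "y \<in> ?J"
    obtain m r where mr: "x = m + r * b" "m \<in> M" "r \<in> R" using x by blast
    obtain m' r' where mr': "y = m' + r' * b" "m' \<in> M" "r' \<in> R" using y by blast
    have "x + y = (m + m') + (r + r') * b" using mr(1) mr'(1) by (simp add: algebra_simps)
    then show "x + y \<in> ?J" using mr mr' id(3) ring(3) by blast
  next
    fix s x assume s: "s \<in> R" and x: "x \<in> ?J"
    obtain m r where mr: "x = m + r * b" "m \<in> M" "r \<in> R" using x by blast
    have "s * x = s * m + (s * r) * b" using mr(1) by (simp add: algebra_simps)
    then show "s * x \<in> ?J" using mr s id(4) ring(4) by blast
  qed
qed

text \<open>An ideal maximal among those avoiding \<open>A\<close> is prime: if x and y lie outside,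
  adjoining either one meets \<open>A\<close>, and the product of the two elements found lies in
  \<open>A\<close>, but also in \<open>P\<close> as soon as x y does.\<close>

lemma exists_prime_avoiding:
  assumes R: "subring R" and I: "is_ideal R I" "I \<inter> A = {}"
    and A: "1 \<in> A" "\<And>s t. s \<in> A \<Longrightarrow> t \<in> A \<Longrightarrow> s * t \<in> A"
  shows "\<exists>P\<in>prime_ideals R. I \<subseteq> P \<and> P \<inter> A = {}"
proof -
  obtain P where P: "is_ideal R P" "I \<subseteq> P" "P \<inter> A = {}"
    "\<forall>J. is_ideal R J \<and> P \<subseteq> J \<and> J \<inter> A = {} \<longrightarrow> J = P"
    using exists_ideal_avoiding[OF I] by (elim exE conjE)
  note id = is_idealD[OF P(1)] and ring = subringD[OF R]
  have meets: "\<exists>m\<in>P. \<exists>r\<in>R. m + r * x \<in> A" if x: "x \<in> R" "x \<notin> P" for x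
  proof (rule ccontr)
    assume A: "\<not> ?thesis"
    let ?J = "{m + r * x | m r. m \<in> P \<and> r \<in> R}"
    note J = is_ideal_adjoin[OF R P(1) x(1)]
    have "?J \<inter> A = {}" using A by blast
    then have "?J = P" using P(4) J(1,2) by simp
    then show False using J(3) x(2) by simp
  qed
  have "x \<in> P \<or> y \<in> P" if xy: "x \<in> R" "y \<in> R" "x * y \<in> P" for x y
  proof (rule ccontr)
    assume "\<not> ?thesis"
    then obtain m r m' r' where mr: "m \<in> P" "r \<in> R" "m + r * x \<in> A" and mr': "m' \<in> P" "r' \<in> R" "m' + r' * y \<in> A"
      using meets[OF xy(1)] meets[OF xy(2)] by blast
    have "(m + r * x) * (m' + r' * y) = (m + r * x) * m' + (r' * y) * m + (r * r') * (x * y)"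
      by (simp add: algebra_simps)
    also have "\<dots> \<in> P"
    proof (intro id(3))
      have "m + r * x \<in> R" using id(1) mr(1,2) xy(1) ring(3,4) by blast
      then show "(m + r * x) * m' \<in> P" using mr'(1) by (rule id(4))
      show "r' * y * m \<in> P" "r * r' * (x * y) \<in> P"
        using mr(1,2) mr'(2) xy ring(4) by (blast intro: id(4))+
    qed
    finally show False using A(2)[OF mr(3) mr'(3)] P(3) by blast
  qed
  moreover have "P \<noteq> R" using P(3) A(1) ring(2) by blast
  ultimately show ?thesis using P(1-3) unfolding prime_ideals_def by blast
qed

lemma max_ideal_complement:
  assumes R: "subring R" and M: "M \<in> max_ideals R" and b: "b \<in> R" "b \<notin> M"
  shows "\<exists>m\<in>M. \<exists>r\<in>R. 1 = m + r * b"
proof -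
  note J = is_ideal_adjoin[OF R max_idealsD(1)[OF M] b(1)]
  have "{m + r * b | m r. m \<in> M \<and> r \<in> R} = R" using max_idealsD(4)[OF M J(1,2)] J(3) b(2) by blast
  then show ?thesis using subringD(2)[OF R] by blast
qed

lemma max_ideal_prime:
  assumes R: "subring R" and M: "M \<in> max_ideals R" and xy: "x \<in> R" "y \<in> R" "x * y \<in> M" "x \<notin> M"
  shows "y \<in> M"
proof -
  note id = max_ideal_closed[OF M]
  obtain m r where mr: "m \<in> M" "r \<in> R" "1 = m + r * x" using max_ideal_complement[OF R M xy(1,4)] by blast
  have "y = (m + r * x) * y" using mr(3) by simp
  also have "\<dots> = y * m + r * (x * y)" by (simp add: algebra_simps)
  finally show ?thesis using id(3,4) mr xy by metis
qed

lemma max_ideals_subset_prime_ideals: "subring R \<Longrightarrow> max_ideals R \<subseteq> prime_ideals R"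
  using max_ideal_prime max_idealsD(1,2) unfolding prime_ideals_def by blast

section \<open>Discrete valuations\<close>

definition valuation :: "('k::field \<Rightarrow> int) \<Rightarrow> bool" where
  "valuation v \<longleftrightarrow> (\<forall>x y. x \<noteq> 0 \<longrightarrow> y \<noteq> 0 \<longrightarrow> v (x * y) = v x + v y) \<and>
     (\<forall>x y. x \<noteq> 0 \<longrightarrow> y \<noteq> 0 \<longrightarrow> x + y \<noteq> 0 \<longrightarrow> min (v x) (v y) \<le> v (x + y)) \<and>
     (\<exists>t. t \<noteq> 0 \<and> v t = 1)"

lemma valuationD:
  assumes "valuation v"
  shows "\<And>x y. x \<noteq> 0 \<Longrightarrow> y \<noteq> 0 \<Longrightarrow> v (x * y) = v x + v y"
    "\<And>x y. x \<noteq> 0 \<Longrightarrow> y \<noteq> 0 \<Longrightarrow> x + y \<noteq> 0 \<Longrightarrow> min (v x) (v y) \<le> v (x + y)"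
    "\<exists>t. t \<noteq> 0 \<and> v t = 1" "v 1 = 0" "\<And>x. x \<noteq> 0 \<Longrightarrow> v (1 / x) = - v x"
    "\<And>x y. x \<noteq> 0 \<Longrightarrow> y \<noteq> 0 \<Longrightarrow> v (x / y) = v x - v y"
    "\<And>x k. x \<noteq> 0 \<Longrightarrow> v (x ^ k) = int k * v x"
proof -
  show m: "v (x * y) = v x + v y" if "x \<noteq> 0" "y \<noteq> 0" for x y
    using assms that unfolding valuation_def by blast
  show "min (v x) (v y) \<le> v (x + y)" if "x \<noteq> 0" "y \<noteq> 0" "x + y \<noteq> 0" for x y
    using assms that unfolding valuation_def by blast
  show "\<exists>t. t \<noteq> 0 \<and> v t = 1" using assms unfolding valuation_def by blast
  show one: "v 1 = 0" using m[of 1 1] by simp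
  show inv: "v (1 / x) = - v x" if "x \<noteq> 0" for x using m[of x "1 / x"] that one by simp
  show "v (x / y) = v x - v y" if "x \<noteq> 0" "y \<noteq> 0" for x y using m[of x "1 / y"] inv[of y] that by simp
  show "v (x ^ k) = int k * v x" if "x \<noteq> 0" for x k
    by (induction k) (auto simp: one m that algebra_simps)
qed

text \<open>The condition \<open>v x \<ge> n\<close> with the convention \<open>v 0 = \<infinity>\<close>.\<close>

definition vge :: "('k::field \<Rightarrow> int) \<Rightarrow> int \<Rightarrow> 'k \<Rightarrow> bool" where
  "vge v n x \<longleftrightarrow> x = 0 \<or> n \<le> v x"

lemma vge_0 [simp]: "vge v n 0"
  unfolding vge_def by simp

lemma vge_mono: "vge v n x \<Longrightarrow> m \<le> n \<Longrightarrow> vge v m x"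
  unfolding vge_def by auto

lemma vge_add:
  assumes "valuation v" "vge v n x" "vge v n y"
  shows "vge v n (x + y)"
proof (cases "x = 0 \<or> y = 0 \<or> x + y = 0")
  case True then show ?thesis using assms unfolding vge_def by auto
next
  case False
  then have "min (v x) (v y) \<le> v (x + y)" using valuationD(2)[OF assms(1)] by blast
  then show ?thesis using assms False unfolding vge_def by auto
qed

lemma vge_mult:
  assumes "valuation v" "vge v m x" "vge v n y"
  shows "vge v (m + n) (x * y)"
proof (cases "x = 0 \<or> y = 0")
  case True then show ?thesis by auto
next
  case False then show ?thesis using assms valuationD(1)[OF assms(1), of x y] unfolding vge_def by auto
qed

lemma vge_sum: "valuation v \<Longrightarrow> (\<And>i. i \<in> A \<Longrightarrow> vge v n (f i)) \<Longrightarrow> vge v n (sum f A)"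
  by (induction A rule: infinite_finite_induct) (auto intro: vge_add)

section \<open>The valuations of an almost Dedekind domain and the values of finitely generated
  fractional ideals\<close>

locale almost_dedekind_domain =
  fixes R :: "'k::field set"
  assumes almost_dedekind: "almost_dedekind R"
begin

abbreviation Max_R :: "'k set set" where
  "Max_R \<equiv> max_ideals R"

lemma subring: "subring R" and quotient_field: "\<exists>a\<in>R. \<exists>b\<in>R. b \<noteq> 0 \<and> x = a / b"
  using almost_dedekind unfolding almost_dedekind_def has_quotient_field_def by auto

lemmas ring = subringD[OF subring]

definition val :: "'k set \<Rightarrow> 'k \<Rightarrow> int" where
  "val M = (SOME v. valuation v \<and> localization R M = {x. vge v 0 x})"

lemma val:
  assumes "M \<in> Max_R"
  shows "valuation (val M)" "localization R M = {x. vge (val M) 0 x}"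
proof -
  have "is_dvr (localization R M)" using assms almost_dedekind unfolding almost_dedekind_def by blast
  then have "\<exists>v. valuation v \<and> localization R M = {x. vge v 0 x}"
    unfolding is_dvr_def valuation_def vge_def by blast
  from someI_ex[OF this] show "valuation (val M)" "localization R M = {x. vge (val M) 0 x}"
    unfolding val_def by auto
qed

lemmas valD = valuationD[OF val(1)]

lemma in_localizationE:
  assumes "M \<in> Max_R" "vge (val M) 0 x"
  obtains a b where "a \<in> R" "b \<in> R" "b \<notin> M" "b \<noteq> 0" "x = a / b"
proof -
  have "x \<in> localization R M" using val(2) assms by blast
  then obtain a b where "a \<in> R" "b \<in> R" "b \<notin> M" "x = a / b" unfolding localization_def by blast
  moreover have "b \<noteq> 0" using calculation max_ideal_closed(2)[OF assms(1)] by blast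
  ultimately show ?thesis using that by blast
qed

lemma in_localizationI:
  assumes "M \<in> Max_R" "a \<in> R" "b \<in> R" "b \<notin> M"
  shows "vge (val M) 0 (a / b)"
  using assms val(2)[OF assms(1)] unfolding localization_def by blast

lemma vge_R:
  assumes "M \<in> Max_R" "x \<in> R"
  shows "vge (val M) 0 x"
  using in_localizationI[OF assms ring(2) max_idealsD(3)[OF assms(1)]] by simp

lemma in_max_iff:
  assumes M: "M \<in> Max_R" and x: "x \<in> R"
  shows "x \<in> M \<longleftrightarrow> vge (val M) 1 x"
proof
  note id = max_ideal_closed[OF M]
  assume xM: "x \<in> M"
  show "vge (val M) 1 x"
  proof (rule ccontr)
    assume "\<not> vge (val M) 1 x"
    then have "x \<noteq> 0" "vge (val M) 0 (1 / x)" using valD(5)[OF M, of x] unfolding vge_def by auto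
    then obtain a b where ab: "a \<in> R" "b \<in> R" "b \<notin> M" "b \<noteq> 0" "1 / x = a / b"
      using in_localizationE[OF M] by blast
    then have "b = a * x" using \<open>x \<noteq> 0\<close> by (simp add: field_simps)
    then show False using id(4)[OF ab(1) xM] ab(3) by simp
  qed
next
  assume A: "vge (val M) 1 x"
  show "x \<in> M"
  proof (rule ccontr)
    assume n: "x \<notin> M"
    then have "x \<noteq> 0" using max_ideal_closed(2)[OF M] by blast
    then show False using in_localizationI[OF M ring(2) x n] valD(5)[OF M, of x] A unfolding vge_def by auto
  qed
qed

text \<open>The r with r x in \<open>R\<close> form an ideal. If x lies in every localization, this
  ideal is contained in no maximal ideal, hence contains 1.\<close>

lemma in_R_iff: "x \<in> R \<longleftrightarrow> (\<forall>M\<in>Max_R. vge (val M) 0 x)"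
proof
  assume A: "\<forall>M\<in>Max_R. vge (val M) 0 x"
  let ?I = "{r \<in> R. r * x \<in> R}"
  have I: "is_ideal R ?I" unfolding is_ideal_def using ring by (auto simp: distrib_right mult.assoc)
  show "x \<in> R"
  proof (rule ccontr)
    assume "x \<notin> R"
    then have "1 \<notin> ?I" by simp
    then obtain M where M: "M \<in> Max_R" "?I \<subseteq> M" using exists_max_ideal[OF subring I] by blast
    obtain a b where ab: "a \<in> R" "b \<in> R" "b \<notin> M" "b \<noteq> 0" "x = a / b"
      using in_localizationE[OF M(1)] A M(1) by blast
    then have "b \<in> ?I" by simp
    then show False using ab(3) M(2) by blast
  qed
qed (use vge_R in blast)

text \<open>A uniformizer of the valuation is a fraction with denominator outside \<open>M\<close>,
  and its numerator has the same value.\<close>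

lemma uniformizer_exists:
  assumes M: "M \<in> Max_R"
  shows "\<exists>t\<in>M. t \<noteq> 0 \<and> val M t = 1"
proof -
  obtain s where s: "s \<noteq> 0" "val M s = 1" using valD(3)[OF M] by blast
  then have "vge (val M) 0 s" unfolding vge_def by simp
  then obtain a b where ab: "a \<in> R" "b \<in> R" "b \<notin> M" "b \<noteq> 0" "s = a / b" using in_localizationE[OF M] by blast
  have a0: "a \<noteq> 0" using s(1) ab(5) by auto
  have "val M s = val M a - val M b" using valD(6)[OF M a0 ab(4)] ab(5) by simp
  moreover have "val M b = 0" using vge_R[OF M ab(2)] in_max_iff[OF M ab(2)] ab(3,4) unfolding vge_def by auto
  ultimately have "val M a = 1" using s(2) by simp
  then show ?thesis using a0 in_max_iff[OF M ab(1)] unfolding vge_def by auto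
qed

lemma common_denominator:
  assumes M: "M \<in> Max_R" and "finite S" "\<And>s. s \<in> S \<Longrightarrow> vge (val M) 0 s"
  shows "\<exists>b\<in>R. b \<notin> M \<and> (\<forall>s\<in>S. b * s \<in> R)"
  using assms(2,3)
proof (induction S rule: finite_induct)
  case empty
  show ?case using ring(2) max_idealsD(3)[OF M] by blast
next
  case (insert x S)
  then obtain b where b: "b \<in> R" "b \<notin> M" "\<forall>s\<in>S. b * s \<in> R" by auto
  obtain a d where ad: "a \<in> R" "d \<in> R" "d \<notin> M" "d \<noteq> 0" "x = a / d"
    using in_localizationE[OF M] insert.prems by blast
  have "b * d \<notin> M" using max_ideal_prime[OF subring M b(1) ad(2)] b(2) ad(3) by blast
  moreover have eq: "(b * d) * x = b * a" using ad(4,5) by simp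
  have "(b * d) * x \<in> R" unfolding eq by (rule ring(4)[OF b(1) ad(1)])
  moreover have "(b * d) * s \<in> R" if "s \<in> S" for s
  proof -
    have eq: "(b * d) * s = d * (b * s)" by simp
    show ?thesis unfolding eq using ring(4)[OF ad(2), of "b * s"] b(3) that by blast
  qed
  ultimately show ?case using ring(4)[OF b(1) ad(2)] by blast
qed

text \<open>Zero is excluded because valuations are unconstrained there, the empty set because a
  minimum of values is taken.\<close>

definition fsets :: "'k set set" where
  "fsets = {F. finite F \<and> F \<noteq> {} \<and> 0 \<notin> F}"

text \<open>The values of the fractional ideal generated by \<open>F\<close>, extended by 0 outside the maximal ideals.\<close>

definition nu :: "'k set \<Rightarrow> 'k set \<Rightarrow> int" where
  "nu F M = (if M \<in> Max_R then Min (val M ` F) else 0)"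

lemma nu_le: "F \<in> fsets \<Longrightarrow> M \<in> Max_R \<Longrightarrow> f \<in> F \<Longrightarrow> nu F M \<le> val M f"
  unfolding nu_def fsets_def by auto

lemma nu_attained:
  assumes "F \<in> fsets" "M \<in> Max_R"
  shows "\<exists>f\<in>F. nu F M = val M f"
proof -
  have "Min (val M ` F) \<in> val M ` F" using assms(1) unfolding fsets_def by (intro Min_in) auto
  then show ?thesis using assms(2) unfolding nu_def by auto
qed

lemma nu_eqI:
  assumes "F \<in> fsets" "M \<in> Max_R" "\<And>f. f \<in> F \<Longrightarrow> n \<le> val M f" "\<exists>f\<in>F. val M f \<le> n"
  shows "nu F M = n"
  using nu_attained[OF assms(1,2)] nu_le[OF assms(1,2)] assms(3,4) by force

lemma nu_ge_iff: "F \<in> fsets \<Longrightarrow> M \<in> Max_R \<Longrightarrow> n \<le> nu F M \<longleftrightarrow> (\<forall>f\<in>F. n \<le> val M f)"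
  unfolding nu_def fsets_def by auto

text \<open>The elements \<open>y f\<close> lie in the inverse of the fractional ideal generated by \<open>F\<close>, so this says that
  finitely generated fractional ideals are invertible.\<close>

lemma partition_of_unity:
  assumes F: "F \<in> fsets"
  shows "\<exists>y. (\<forall>f\<in>F. \<forall>g\<in>F. y f * g \<in> R) \<and> 1 = (\<Sum>f\<in>F. f * y f)"
proof -
  have fin: "finite F" "0 \<notin> F" using F unfolding fsets_def by auto
  define J where "J = {(\<Sum>f\<in>F. f * y f) | y. \<forall>f\<in>F. \<forall>g\<in>F. y f * g \<in> R}"
  have J: "is_ideal R J"
    unfolding is_ideal_def
  proof (intro conjI ballI)
    show "J \<subseteq> R"
    proof
      fix x assume "x \<in> J"
      then obtain y where y: "x = (\<Sum>f\<in>F. f * y f)" "\<forall>f\<in>F. \<forall>g\<in>F. y f * g \<in> R" unfolding J_def by blast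
      show "x \<in> R" unfolding y(1) using y(2) by (intro subring_sum[OF subring]) (simp add: mult.commute)
    qed
    show "0 \<in> J" unfolding J_def using ring(1) by (intro CollectI exI[of _ "\<lambda>_. 0"]) simp
  next
    fix x x' assume "x \<in> J" "x' \<in> J"
    then obtain y y' where y: "x = (\<Sum>f\<in>F. f * y f)" "\<forall>f\<in>F. \<forall>g\<in>F. y f * g \<in> R"
      and y': "x' = (\<Sum>f\<in>F. f * y' f)" "\<forall>f\<in>F. \<forall>g\<in>F. y' f * g \<in> R" unfolding J_def by blast
    show "x + x' \<in> J" unfolding J_def y(1) y'(1) using y(2) y'(2) ring(3)
      by (intro CollectI exI[of _ "\<lambda>f. y f + y' f"]) (simp add: algebra_simps sum.distrib)
  next
    fix r x assume r: "r \<in> R" and "x \<in> J"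
    then obtain y where y: "x = (\<Sum>f\<in>F. f * y f)" "\<forall>f\<in>F. \<forall>g\<in>F. y f * g \<in> R" unfolding J_def by blast
    show "r * x \<in> J" unfolding J_def y(1) using y(2) ring(4)[OF r]
      by (intro CollectI exI[of _ "\<lambda>f. r * y f"]) (simp add: mult.assoc mult.left_commute sum_distrib_left)
  qed
  have "1 \<in> J"
  proof (rule ccontr)
    assume "1 \<notin> J"
    then obtain M where M: "M \<in> Max_R" "J \<subseteq> M" using exists_max_ideal[OF subring J] by blast
    \<comment> \<open>At \<open>M\<close> the ideal is generated by an element of least value. With
      a common denominator \<open>b\<close> of the quotients \<open>g / f0\<close>, the element
      \<open>b / f0\<close> lies in the inverse and contributes \<open>b\<close>, which is outside
      \<open>M\<close>.\<close>
    obtain f0 where f0: "f0 \<in> F" "nu F M = val M f0" using nu_attained[OF F M(1)] by blast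
    have f00: "f0 \<noteq> 0" using f0(1) fin(2) by auto
    have "vge (val M) 0 (g / f0)" if "g \<in> F" for g
      using nu_le[OF F M(1) that] f0(2) valD(6)[OF M(1), of g f0] that fin(2) f00 unfolding vge_def by force
    then obtain b where b: "b \<in> R" "b \<notin> M" "\<forall>s\<in>(\<lambda>g. g / f0) ` F. b * s \<in> R"
      using common_denominator[OF M(1), of "(\<lambda>g. g / f0) ` F"] fin(1) by auto
    define y where "y f = (if f = f0 then b / f0 else 0)" for f
    have "\<forall>f\<in>F. \<forall>g\<in>F. y f * g \<in> R" using b(3) ring(1) unfolding y_def by auto
    moreover have "(\<Sum>f\<in>F. f * y f) = (\<Sum>f\<in>F. if f = f0 then b else 0)"
      using f00 unfolding y_def by (intro sum.cong) auto
    then have "b = (\<Sum>f\<in>F. f * y f)" using fin(1) f0(1) by simp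
    ultimately have "b \<in> J" unfolding J_def by blast
    then show False using M(2) b(2) by blast
  qed
  then show ?thesis unfolding J_def by blast
qed

text \<open>Tested against an element g of least value at \<open>M\<close>: the product
  \<open>y f * g\<close> lies in \<open>R\<close>, so \<open>y f\<close> has value at least minus
  that of g.\<close>

lemma partition_of_unity_vge:
  assumes F: "F \<in> fsets" and y: "\<forall>f\<in>F. \<forall>g\<in>F. y f * g \<in> R" and M: "M \<in> Max_R" and f: "f \<in> F"
  shows "vge (val M) (- nu F M) (y f)"
proof -
  obtain g where g: "g \<in> F" "nu F M = val M g" using nu_attained[OF F M] by blast
  have g0: "g \<noteq> 0" using F g(1) unfolding fsets_def by auto
  have "vge (val M) 0 (y f * g)" using vge_R[OF M] y f g(1) by blast
  then show ?thesis using valD(1)[OF M, of "y f" g] g(2) g0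
    unfolding vge_def by (cases "y f = 0") auto
qed

definition vfuns :: "('k set \<Rightarrow> int) set" where
  "vfuns = nu ` fsets"

text \<open>The elements \<open>y f\<close> of a partition of unity serve as generators of the
  inverse. Their values are at least \<open>- nu F\<close>; if all were larger at some M, then 1
  would have positive value there.\<close>

lemma nu_inverse:
  assumes F: "F \<in> fsets"
  shows "\<exists>F'\<in>fsets. nu F' = - nu F"
proof -
  obtain y where y: "\<forall>f\<in>F. \<forall>g\<in>F. y f * g \<in> R" "1 = (\<Sum>f\<in>F. f * y f)"
    using partition_of_unity[OF F] by blast
  have fin: "finite F" using F unfolding fsets_def by auto
  define F' where "F' = y ` F - {0}"
  have "F' \<noteq> {}"
  proof
    assume "F' = {}"
    then have "(\<Sum>f\<in>F. f * y f) = 0" unfolding F'_def by (intro sum.neutral) auto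
    then show False using y(2) by simp
  qed
  then have F': "F' \<in> fsets" using fin unfolding fsets_def F'_def by auto
  have "nu F' M = - nu F M" if M: "M \<in> Max_R" for M
  proof (rule nu_eqI[OF F' M])
    show "- nu F M \<le> val M z" if "z \<in> F'" for z
      using partition_of_unity_vge[OF F y(1) M] that unfolding F'_def vge_def by auto
    show "\<exists>z\<in>F'. val M z \<le> - nu F M"
    proof (rule ccontr)
      assume A: "\<not> ?thesis"
      have "vge (val M) 1 (f * y f)" if "f \<in> F" for f
      proof -
        have "vge (val M) (- nu F M + 1) (y f)" using A that unfolding F'_def vge_def by force
        moreover have "vge (val M) (nu F M) f" using nu_le[OF F M that] unfolding vge_def by simp
        ultimately show ?thesis using vge_mult[OF val(1)[OF M]] by fastforce
      qed
      then have "vge (val M) 1 1" using vge_sum[OF val(1)[OF M], of F 1 "\<lambda>f. f * y f"] y(2) by simp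
      then show False using valD(4)[OF M] unfolding vge_def by simp
    qed
  qed
  then have "nu F' = - nu F" by (auto simp: fun_eq_iff nu_def)
  then show ?thesis using F' by blast
qed

lemma nu_mult:
  assumes F: "F \<in> fsets" and F': "F' \<in> fsets"
  shows "(\<lambda>(x, y). x * y) ` (F \<times> F') \<in> fsets" "nu ((\<lambda>(x, y). x * y) ` (F \<times> F')) = nu F + nu F'"
proof -
  let ?P = "(\<lambda>(x, y). x * y) ` (F \<times> F')"
  show P: "?P \<in> fsets" using F F' unfolding fsets_def by auto
  have "nu ?P M = nu F M + nu F' M" if M: "M \<in> Max_R" for M
  proof (rule nu_eqI[OF P M])
    have v: "val M (x * y) = val M x + val M y" if "x \<in> F" "y \<in> F'" for x y
      using that F F' valD(1)[OF M, of x y] unfolding fsets_def by blast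
    show "nu F M + nu F' M \<le> val M z" if "z \<in> ?P" for z
      using that v nu_le[OF F M] nu_le[OF F' M] by (force intro: add_mono)
    obtain f f' where "f \<in> F" "nu F M = val M f" "f' \<in> F'" "nu F' M = val M f'"
      using nu_attained[OF F M] nu_attained[OF F' M] by blast
    then show "\<exists>z\<in>?P. val M z \<le> nu F M + nu F' M" using v by (intro bexI[of _ "f * f'"]) auto
  qed
  then show "nu ?P = nu F + nu F'" by (auto simp: fun_eq_iff nu_def)
qed

lemma subspace_vfuns: "zmod.subspace vfuns"
proof (rule zmod_subspace_diffI)
  have "{1} \<in> fsets" unfolding fsets_def by simp
  moreover have "nu {1} = 0" unfolding nu_def using valD(4) by (auto simp: fun_eq_iff)
  ultimately show "0 \<in> vfuns" unfolding vfuns_def by (metis image_eqI)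
next
  fix f g assume "f \<in> vfuns" "g \<in> vfuns"
  then obtain F H where FH: "f = nu F" "g = nu H" "F \<in> fsets" "H \<in> fsets" unfolding vfuns_def by blast
  obtain H' where H': "H' \<in> fsets" "nu H' = - nu H" using nu_inverse[OF FH(4)] by blast
  have "f - g = nu F + nu H'" using FH H' by simp
  then show "f - g \<in> vfuns" using nu_mult[OF FH(3) H'(1)] unfolding vfuns_def by (metis image_eqI)
qed

text \<open>The union of two generating sets generates the sum of the ideals, whose values are the
  pointwise minima.\<close>

lemma min_vfuns:
  assumes "f \<in> vfuns" "g \<in> vfuns"
  shows "(\<lambda>x. min (f x) (g x)) \<in> vfuns"
proof -
  obtain F H where FH: "f = nu F" "g = nu H" "F \<in> fsets" "H \<in> fsets" using assms unfolding vfuns_def by blast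
  have "F \<union> H \<in> fsets" using FH(3,4) unfolding fsets_def by auto
  moreover have "nu (F \<union> H) = (\<lambda>x. min (f x) (g x))"
  proof
    fix M show "nu (F \<union> H) M = min (f M) (g M)"
      using FH(3,4) Min.union[of "val M ` F" "val M ` H"] unfolding FH(1,2) nu_def fsets_def by (auto simp: image_Un)
  qed
  ultimately show ?thesis unfolding vfuns_def by (metis image_eqI)
qed

section \<open>From value functions to invertible ideals\<close>

definition ideal_of :: "('k set \<Rightarrow> int) \<Rightarrow> 'k set" where
  "ideal_of f = {x. \<forall>M\<in>Max_R. vge (val M) (f M) x}"

lemma ideal_of_0: "ideal_of 0 = R"
  unfolding ideal_of_def using in_R_iff by auto

lemma fset_in_ideal_of: "F \<in> fsets \<Longrightarrow> F \<subseteq> ideal_of (nu F)"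
  unfolding ideal_of_def vge_def using nu_le by auto

text \<open>A partition of unity for \<open>F\<close> writes x as the sum of the
  \<open>f * (y f * x)\<close>, and multiplication by \<open>y f\<close> lowers the required value
  by exactly \<open>nu F\<close>, so the second factors lie in \<open>ideal_of g\<close>.\<close>

lemma ideal_of_add:
  assumes F: "F \<in> fsets"
  shows "ideal_of (nu F + g) = ideal_mult (ideal_of (nu F)) (ideal_of g)"
proof
  show "ideal_mult (ideal_of (nu F)) (ideal_of g) \<subseteq> ideal_of (nu F + g)"
  proof
    fix z assume "z \<in> ideal_mult (ideal_of (nu F)) (ideal_of g)"
    then obtain n :: nat and a b where ab: "\<And>i. i < n \<Longrightarrow> a i \<in> ideal_of (nu F)" "\<And>i. i < n \<Longrightarrow> b i \<in> ideal_of g"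
      "z = (\<Sum>i<n. a i * b i)" by (rule ideal_multE) blast
    show "z \<in> ideal_of (nu F + g)"
      unfolding ideal_of_def ab(3)
    proof (intro CollectI ballI vge_sum val(1))
      fix M i assume "M \<in> Max_R" "i \<in> {..<n}"
      then show "vge (val M) ((nu F + g) M) (a i * b i)"
        using ab(1,2) vge_mult[OF val(1), of M "nu F M" "a i" "g M" "b i"] unfolding ideal_of_def by auto
    qed
  qed
  show "ideal_of (nu F + g) \<subseteq> ideal_mult (ideal_of (nu F)) (ideal_of g)"
  proof
    fix x assume x: "x \<in> ideal_of (nu F + g)"
    obtain y where y: "\<forall>f\<in>F. \<forall>g\<in>F. y f * g \<in> R" "1 = (\<Sum>f\<in>F. f * y f)"
      using partition_of_unity[OF F] by blast
    have "y f * x \<in> ideal_of g" if f: "f \<in> F" for f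
      unfolding ideal_of_def
    proof (intro CollectI ballI)
      fix M assume M: "M \<in> Max_R"
      have "vge (val M) (- nu F M + (nu F + g) M) (y f * x)"
        using x M by (intro vge_mult[OF val(1)[OF M]] partition_of_unity_vge[OF F y(1) M f]) (simp add: ideal_of_def)
      then show "vge (val M) (g M) (y f * x)" by simp
    qed
    then have "(\<Sum>f\<in>F. f * (y f * x)) \<in> ideal_mult (ideal_of (nu F)) (ideal_of g)"
      using F fset_in_ideal_of[OF F] by (intro ideal_multI) (auto simp: fsets_def)
    moreover have "x = (\<Sum>f\<in>F. f * y f) * x" using y(2) by simp
    then have "x = (\<Sum>f\<in>F. f * (y f * x))" by (simp add: sum_distrib_right mult.assoc)
    ultimately show "x \<in> ideal_mult (ideal_of (nu F)) (ideal_of g)" by simp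
  qed
qed

lemma frac_ideal_ideal_of:
  assumes F: "F \<in> fsets"
  shows "frac_ideal R (ideal_of (nu F))"
  unfolding frac_ideal_def
proof (intro conjI ballI)
  show "0 \<in> ideal_of (nu F)" unfolding ideal_of_def by simp
  show "ideal_of (nu F) \<noteq> {0}" using fset_in_ideal_of[OF F] F unfolding fsets_def by auto
  show "x + y \<in> ideal_of (nu F)" if "x \<in> ideal_of (nu F)" "y \<in> ideal_of (nu F)" for x y
    using that vge_add[OF val(1)] unfolding ideal_of_def by blast
  show "r * x \<in> ideal_of (nu F)" if "r \<in> R" "x \<in> ideal_of (nu F)" for r x
    using that vge_mult[OF val(1) vge_R] unfolding ideal_of_def by fastforce
  obtain F' where F': "F' \<in> fsets" "nu F' = - nu F" using nu_inverse[OF F] by blast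
  \<comment> \<open>A nonzero element of the inverse ideal multiplies the ideal into
    \<open>R\<close>; its numerator does the same and lies in \<open>R\<close>.\<close>
  obtain y where y: "y \<in> F'" "y \<noteq> 0" using F'(1) unfolding fsets_def by auto
  obtain a b where ab: "a \<in> R" "b \<in> R" "b \<noteq> 0" "y = a / b" using quotient_field by blast
  show "\<exists>d\<in>R. d \<noteq> 0 \<and> (\<forall>x\<in>ideal_of (nu F). d * x \<in> R)"
  proof (intro bexI[of _ a] conjI ballI)
    show "a \<in> R" "a \<noteq> 0" using ab y(2) by auto
    fix x assume x: "x \<in> ideal_of (nu F)"
    have "y * x \<in> ideal_mult (ideal_of (nu F')) (ideal_of (nu F))"
      using fset_in_ideal_of[OF F'(1)] y(1) x by (intro ideal_multI1) auto
    then have "y * x \<in> R" using ideal_of_add[OF F'(1), of "nu F"] F'(2) ideal_of_0 by simp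
    then have "b * (y * x) \<in> R" using ring(4) ab(2) by blast
    then show "a * x \<in> R" using ab by simp
  qed
qed

text \<open>If 1 is the sum of the products \<open>f i * g i\<close>, then x is the sum of the
  \<open>f i * (g i * x)\<close>. So the nonzero \<open>f i\<close> have the least values on
  \<open>I\<close>, and conversely these value bounds put every \<open>g i * x\<close> into
  \<open>R\<close> and x into \<open>I\<close>.\<close>

lemma invertible_ideal_iff: "invertible_ideal R I \<longleftrightarrow> I \<in> ideal_of ` vfuns"
proof
  assume "I \<in> ideal_of ` vfuns"
  then obtain F where F: "F \<in> fsets" "I = ideal_of (nu F)" unfolding vfuns_def by blast
  obtain F' where F': "F' \<in> fsets" "nu F' = - nu F" using nu_inverse[OF F(1)] by blast
  have "ideal_mult I (ideal_of (nu F')) = R" using ideal_of_add[OF F(1), of "nu F'"] F F' ideal_of_0 by simp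
  then show "invertible_ideal R I"
    unfolding invertible_ideal_def using frac_ideal_ideal_of F F'(1) by blast
next
  assume "invertible_ideal R I"
  then obtain J where I: "frac_ideal R I" and J: "frac_ideal R J" and IJ: "ideal_mult I J = R"
    unfolding invertible_ideal_def by blast
  have "1 \<in> ideal_mult I J" using IJ ring(2) by simp
  then obtain n :: nat and f g where fg: "\<And>i. i < n \<Longrightarrow> f i \<in> I" "\<And>i. i < n \<Longrightarrow> g i \<in> J"
    "1 = (\<Sum>i<n. f i * g i)" by (rule ideal_multE) blast
  have prod: "x * y \<in> R" if "x \<in> I" "y \<in> J" for x y using ideal_multI1[OF that] IJ by simp
  define F where "F = f ` {..<n} - {0}"
  have "F \<noteq> {}"
  proof
    assume "F = {}"
    then have "(\<Sum>i<n. f i * g i) = 0" unfolding F_def by (intro sum.neutral) auto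
    then show False using fg(3) by simp
  qed
  then have F: "F \<in> fsets" unfolding fsets_def F_def by auto
  have expand: "x = (\<Sum>i<n. f i * (g i * x))" for x
  proof -
    have "x = (\<Sum>i<n. f i * g i) * x" using fg(3) by simp
    then show ?thesis by (simp add: sum_distrib_right mult.assoc)
  qed
  have fv: "vge (val M) (nu F M) (f i)" if "M \<in> Max_R" "i < n" for M i
    using nu_le[OF F that(1), of "f i"] that(2) unfolding F_def vge_def by auto
  have gv: "vge (val M) (- nu F M) (g i)" if M: "M \<in> Max_R" and i: "i < n" for M i
  proof -
    obtain z where z: "z \<in> F" "nu F M = val M z" using nu_attained[OF F M] by blast
    then have z': "z \<in> I" "z \<noteq> 0" using fg(1) unfolding F_def by auto
    then have "vge (val M) 0 (z * g i)" using prod fg(2)[OF i] vge_R[OF M] by blast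
    then show ?thesis using valD(1)[OF M, of z "g i"] z(2) z'(2)
      unfolding vge_def by (cases "g i = 0") auto
  qed
  have "I = ideal_of (nu F)"
  proof
    show "I \<subseteq> ideal_of (nu F)"
    proof
      fix x assume x: "x \<in> I"
      show "x \<in> ideal_of (nu F)"
        unfolding ideal_of_def
      proof (intro CollectI ballI)
        fix M assume M: "M \<in> Max_R"
        have "vge (val M) (nu F M) (f i * (g i * x))" if "i < n" for i
        proof -
          have "g i * x \<in> R" using prod[OF x fg(2)[OF that]] by (simp add: mult.commute)
          then show ?thesis using vge_mult[OF val(1)[OF M] fv[OF M that] vge_R[OF M]] by fastforce
        qed
        then have "vge (val M) (nu F M) (\<Sum>i<n. f i * (g i * x))" by (intro vge_sum[OF val(1)[OF M]]) simp
        then show "vge (val M) (nu F M) x" using expand[of x] by simp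
      qed
    qed
    show "ideal_of (nu F) \<subseteq> I"
    proof
      fix x assume x: "x \<in> ideal_of (nu F)"
      have "g i * x \<in> R" if i: "i < n" for i
        unfolding in_R_iff
      proof
        fix M assume M: "M \<in> Max_R"
        have "vge (val M) (- nu F M + nu F M) (g i * x)"
          using x M by (intro vge_mult[OF val(1)[OF M] gv[OF M i]]) (simp add: ideal_of_def)
        then show "vge (val M) 0 (g i * x)" by simp
      qed
      then have fgI: "f i * (g i * x) \<in> I" if "i < n" for i
        using I fg(1) that unfolding frac_ideal_def by (metis mult.commute)
      have sumI: "sum h A \<in> I" if "\<And>i. i \<in> A \<Longrightarrow> h i \<in> I" for h and A :: "nat set"
        using that I by (induction A rule: infinite_finite_induct) (auto simp: frac_ideal_def)
      have "(\<Sum>i<n. f i * (g i * x)) \<in> I" by (rule sumI) (simp add: fgI)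
      then show "x \<in> I" using expand[of x] by simp
    qed
  qed
  then show "I \<in> ideal_of ` vfuns" using F unfolding vfuns_def by blast
qed

text \<open>The value \<open>nu H M\<close> is attained by an element of \<open>H\<close>, which
  belongs to the ideal; so the ideal determines the values.\<close>

lemma inj_on_ideal_of: "inj_on ideal_of vfuns"
proof (rule inj_onI)
  have le: "nu F M \<le> nu H M" if F: "F \<in> fsets" and H: "H \<in> fsets" and eq: "ideal_of (nu F) = ideal_of (nu H)"
    and M: "M \<in> Max_R" for F H M
  proof -
    obtain h where h: "h \<in> H" "nu H M = val M h" using nu_attained[OF H M] by blast
    then have "h \<in> ideal_of (nu F)" using fset_in_ideal_of[OF H] eq by blast
    then show ?thesis using h H M unfolding ideal_of_def vge_def fsets_def by auto
  qed
  fix f g assume "f \<in> vfuns" "g \<in> vfuns" and eq: "ideal_of f = ideal_of g"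
  then obtain F H where FH: "f = nu F" "g = nu H" "F \<in> fsets" "H \<in> fsets" unfolding vfuns_def by blast
  have "nu F M = nu H M" for M
    using le[OF FH(3,4), of M] le[OF FH(4,3), of M] eq FH(1,2) by (cases "M \<in> Max_R") (auto simp: nu_def)
  then show "f = g" using FH(1,2) by (simp add: fun_eq_iff)
qed

theorem add_group_vfuns_iso_Inv: "add_group vfuns \<cong> Inv_group R"
proof -
  have "ideal_of \<in> iso (add_group vfuns) (Inv_group R)"
  proof (rule isoI)
    show "ideal_of \<in> hom (add_group vfuns) (Inv_group R)"
    proof (rule homI)
      show "ideal_of f \<in> carrier (Inv_group R)" if "f \<in> carrier (add_group vfuns)" for f
        using that invertible_ideal_iff unfolding add_group_def Inv_group_def by auto
      fix f g assume "f \<in> carrier (add_group vfuns)" "g \<in> carrier (add_group vfuns)"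
      then obtain F where "F \<in> fsets" "f = nu F" unfolding add_group_def vfuns_def by auto
      then show "ideal_of (f \<otimes>\<^bsub>add_group vfuns\<^esub> g) = ideal_of f \<otimes>\<^bsub>Inv_group R\<^esub> ideal_of g"
        using ideal_of_add unfolding add_group_def Inv_group_def by simp
    qed
    show "bij_betw ideal_of (carrier (add_group vfuns)) (carrier (Inv_group R))"
      unfolding bij_betw_def using inj_on_ideal_of invertible_ideal_iff unfolding add_group_def Inv_group_def by auto
  qed
  then show ?thesis unfolding is_iso_def by blast
qed

end

subsection \<open>The inverse topology on the maximal spectrum\<close>

lemma is_ideal_gen:
  assumes R: "subring R" and G: "G \<subseteq> R"
  shows "is_ideal R {x. \<exists>F c. finite F \<and> F \<subseteq> G \<and> (\<forall>g\<in>F. c g \<in> R) \<and> x = (\<Sum>g\<in>F. c g * g)}" (is "is_ideal R ?I")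
  unfolding is_ideal_def
proof (intro conjI ballI)
  note ring = subringD[OF R]
  show "?I \<subseteq> R"
  proof
    fix x assume "x \<in> ?I"
    then obtain F c where F: "F \<subseteq> G" "\<forall>g\<in>F. c g \<in> R" "x = (\<Sum>g\<in>F. c g * g)" by blast
    show "x \<in> R" unfolding F(3) using F(1,2) G ring(4) by (intro subring_sum[OF R]) blast
  qed
  show "0 \<in> ?I" by (intro CollectI exI[of _ "{}"]) simp
next
  note ring = subringD[OF R]
  fix x y assume "x \<in> ?I" "y \<in> ?I"
  then obtain F c F' c' where F: "finite F" "F \<subseteq> G" "\<forall>g\<in>F. c g \<in> R" "x = (\<Sum>g\<in>F. c g * g)"
    and F': "finite F'" "F' \<subseteq> G" "\<forall>g\<in>F'. c' g \<in> R" "y = (\<Sum>g\<in>F'. c' g * g)" by blast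
  let ?c = "\<lambda>g. (if g \<in> F then c g else 0) + (if g \<in> F' then c' g else 0)"
  have "(\<Sum>g\<in>F \<union> F'. (if g \<in> F then c g else 0) * g) = x"
    unfolding F(4) using F(1) F'(1) by (intro sum.mono_neutral_cong_right) auto
  moreover have "(\<Sum>g\<in>F \<union> F'. (if g \<in> F' then c' g else 0) * g) = y"
    unfolding F'(4) using F(1) F'(1) by (intro sum.mono_neutral_cong_right) auto
  ultimately have "x + y = (\<Sum>g\<in>F \<union> F'. ?c g * g)" by (simp only: distrib_right sum.distrib)
  moreover have "\<forall>g\<in>F \<union> F'. ?c g \<in> R" using F(3) F'(3) ring(1,3) by auto
  ultimately show "x + y \<in> ?I" using F(1,2) F'(1,2)
    by (intro CollectI exI[of _ "F \<union> F'"] exI[of _ ?c]) blast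
next
  note ring = subringD[OF R]
  fix r x assume r: "r \<in> R" and "x \<in> ?I"
  then obtain F c where F: "finite F" "F \<subseteq> G" "\<forall>g\<in>F. c g \<in> R" "x = (\<Sum>g\<in>F. c g * g)" by blast
  show "r * x \<in> ?I" using F ring(4)[OF r]
    by (intro CollectI exI[of _ F] exI[of _ "\<lambda>g. r * c g"]) (auto simp: sum_distrib_left mult.assoc)
qed

lemma prime_idealsD:
  assumes "P \<in> prime_ideals R"
  shows "is_ideal R P" "1 \<notin> P" "\<And>x y. x \<in> R \<Longrightarrow> y \<in> R \<Longrightarrow> x * y \<in> P \<Longrightarrow> x \<in> P \<or> y \<in> P"
  using assms ideal_eq_ring unfolding prime_ideals_def by auto

lemma contraction_prime:
  assumes R: "subring R" and T: "subring T" and RT: "R \<subseteq> T" and N: "N \<in> max_ideals T"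
  shows "N \<inter> R \<in> prime_ideals R"
proof -
  note idN = max_ideal_closed[OF N]
  have "is_ideal R (N \<inter> R)"
    unfolding is_ideal_def using idN(2-4) subringD[OF R] RT by auto
  moreover have "N \<inter> R \<noteq> R" using max_idealsD(3)[OF N] subringD(2)[OF R] by blast
  moreover have "x \<in> N \<inter> R \<or> y \<in> N \<inter> R" if "x \<in> R" "y \<in> R" "x * y \<in> N \<inter> R" for x y
    using max_ideal_prime[OF T N, of x y] that RT by blast
  ultimately show ?thesis unfolding prime_ideals_def by blast
qed

section \<open>Basic open sets of the Zariski topology\<close>

definition basic_open :: "'k::field set \<Rightarrow> 'k \<Rightarrow> 'k set set" where
  "basic_open R f = {P \<in> prime_ideals R. f \<notin> P}"

lemma zariski_eq: "zariski R = topology_generated_by (basic_open R ` R)"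
  unfolding zariski_def basic_open_def by (simp add: Setcompr_eq_image)

lemma openin_basic_open: "f \<in> R \<Longrightarrow> openin (zariski R) (basic_open R f)"
  unfolding zariski_eq by (intro topology_generated_by_Basis) blast

lemma zariski_base:
  assumes R: "subring R" and U: "openin (zariski R) U" and P: "P \<in> U"
  shows "\<exists>g\<in>R. P \<in> basic_open R g \<and> basic_open R g \<subseteq> U"
proof -
  have "generate_topology_on (basic_open R ` R) U"
    using U unfolding zariski_eq by (simp add: openin_topology_generated_by_iff)
  then show ?thesis using P
  proof (induction rule: generate_topology_on.induct)
    case (Int a b)
    then obtain g h where g: "g \<in> R" "P \<in> basic_open R g" "basic_open R g \<subseteq> a"
      and h: "h \<in> R" "P \<in> basic_open R h" "basic_open R h \<subseteq> b" by blast
    have "P \<in> basic_open R (g * h)"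
      using g h prime_idealsD(3)[of P R g h] unfolding basic_open_def by blast
    moreover have "basic_open R (g * h) \<subseteq> basic_open R g \<inter> basic_open R h"
    proof
      fix Q assume Q: "Q \<in> basic_open R (g * h)"
      then have "Q \<in> prime_ideals R" unfolding basic_open_def by blast
      note id = is_idealD[OF prime_idealsD(1)[OF this]]
      have "g \<in> Q \<Longrightarrow> g * h \<in> Q" using id(4)[OF h(1), of g] by (simp add: mult.commute)
      moreover have "h \<in> Q \<Longrightarrow> g * h \<in> Q" using id(4)[OF g(1), of h] by simp
      ultimately show "Q \<in> basic_open R g \<inter> basic_open R h" using Q unfolding basic_open_def by blast
    qed
    ultimately show ?case using g h subringD(4)[OF R] by blast
  qed blast+
qed

text \<open>Consider the ideal generated by all g whose basic set lies in a member of the cover. If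
  it contained no power of f, a prime containing it and avoiding those powers would be an uncovered
  point. This makes complements of basic sets open in the inverse topology.\<close>

lemma compactin_basic_open:
  assumes R: "subring R" and f: "f \<in> R"
  shows "compactin (zariski R) (basic_open R f)"
  unfolding compactin_def
proof (intro conjI allI impI)
  note ring = subringD[OF R]
  show "basic_open R f \<subseteq> topspace (zariski R)" using openin_subset[OF openin_basic_open[OF f]] .
  fix \<U> assume U: "(\<forall>U\<in>\<U>. openin (zariski R) U) \<and> basic_open R f \<subseteq> \<Union>\<U>"
  define G where "G = {g \<in> R. \<exists>U\<in>\<U>. basic_open R g \<subseteq> U}"
  let ?I = "{x. \<exists>F c. finite F \<and> F \<subseteq> G \<and> (\<forall>g\<in>F. c g \<in> R) \<and> x = (\<Sum>g\<in>F. c g * g)}"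
  have I: "is_ideal R ?I" by (rule is_ideal_gen[OF R]) (auto simp: G_def)
  have "?I \<inter> range (\<lambda>n. f ^ n) \<noteq> {}"
  proof
    assume dis: "?I \<inter> range (\<lambda>n. f ^ n) = {}"
    have "1 \<in> range (\<lambda>n. f ^ n)" by (rule image_eqI[of _ _ 0]) simp_all
    moreover have "s * t \<in> range (\<lambda>n. f ^ n)" if "s \<in> range (\<lambda>n. f ^ n)" "t \<in> range (\<lambda>n. f ^ n)" for s t
      using that by (auto simp: power_add[symmetric])
    ultimately have "\<exists>P\<in>prime_ideals R. ?I \<subseteq> P \<and> P \<inter> range (\<lambda>n. f ^ n) = {}"
      by (rule exists_prime_avoiding[OF R I dis])
    then obtain P where P: "P \<in> prime_ideals R" "?I \<subseteq> P" "P \<inter> range (\<lambda>n. f ^ n) = {}" by (elim bexE conjE)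
    have "f \<in> range (\<lambda>n. f ^ n)" by (rule image_eqI[of _ _ 1]) simp_all
    then have Pf: "P \<in> basic_open R f" using P(1,3) unfolding basic_open_def by blast
    then obtain U where "U \<in> \<U>" "P \<in> U" using U by blast
    then obtain g where g: "g \<in> R" "P \<in> basic_open R g" "g \<in> G"
      using zariski_base[OF R, of U P] U unfolding G_def by blast
    have "g \<in> ?I" using g(3) ring(2) by (intro CollectI exI[of _ "{g}"] exI[of _ "\<lambda>_. 1"]) simp
    then show False using g(2) P(2) unfolding basic_open_def by blast
  qed
  then obtain x where "x \<in> ?I" "x \<in> range (\<lambda>n. f ^ n)" by auto
  then obtain n F c where F: "finite F" "F \<subseteq> G" "\<forall>g\<in>F. c g \<in> R" "f ^ n = (\<Sum>g\<in>F. c g * g)"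
    by (elim CollectE imageE exE conjE) simp
  have sub: "basic_open R f \<subseteq> (\<Union>g\<in>F. basic_open R g)"
  proof
    fix P assume "P \<in> basic_open R f"
    then have P: "P \<in> prime_ideals R" "f \<notin> P" unfolding basic_open_def by auto
    show "P \<in> (\<Union>g\<in>F. basic_open R g)"
    proof (rule ccontr)
      assume "P \<notin> (\<Union>g\<in>F. basic_open R g)"
      then have "\<And>g. g \<in> F \<Longrightarrow> g \<in> P" using P(1) unfolding basic_open_def by blast
      then have "f ^ n \<in> P"
        unfolding F(4) using F(3) is_idealD(4)[OF prime_idealsD(1)[OF P(1)]]
        by (intro ideal_sum[OF prime_idealsD(1)[OF P(1)]]) blast
      moreover have "f ^ k \<in> R" for k by (induction k) (auto simp: ring f)
      then have "f ^ k \<notin> P" for k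
        by (induction k) (use prime_idealsD(2,3)[OF P(1)] P(2) f in auto)
      ultimately show False by blast
    qed
  qed
  have "\<forall>g\<in>F. \<exists>U\<in>\<U>. basic_open R g \<subseteq> U" using F(2) unfolding G_def by blast
  then obtain u where u: "\<And>g. g \<in> F \<Longrightarrow> u g \<in> \<U> \<and> basic_open R g \<subseteq> u g" by metis
  show "\<exists>\<F>. finite \<F> \<and> \<F> \<subseteq> \<U> \<and> basic_open R f \<subseteq> \<Union>\<F>"
    using F(1) u sub by (intro exI[of _ "u ` F"]) blast
qed

section \<open>Loci of finite sets as a clopen base on the maximal spectrum\<close>

definition max_locus :: "'k::field set \<Rightarrow> 'k set \<Rightarrow> 'k set set" where
  "max_locus R F = {M \<in> max_ideals R. F \<subseteq> M}"

lemma topspace_max_inverse: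
  assumes R: "subring R"
  shows "topspace (max_inverse R) = max_ideals R"
proof -
  have "prime_ideals R \<subseteq> topspace (inverse_topology R)"
    \<comment> \<open>The choice \<open>U = {}\<close> shows that every prime is a point of the
      space.\<close>
    unfolding inverse_topology_def topology_generated_by_topspace by (intro Sup_upper) (auto intro!: exI[of _ "{}"])
  then show ?thesis
    unfolding max_inverse_def using max_ideals_subset_prime_ideals[OF R] by auto
qed

lemma openin_max_locus:
  assumes R: "subring R" and F: "finite F" "F \<subseteq> R"
  shows "openin (max_inverse R) (max_locus R F)"
  using F
proof (induction F rule: finite_induct)
  case empty
  have "max_locus R {} = topspace (max_inverse R)"
    unfolding max_locus_def topspace_max_inverse[OF R] by simp
  then show ?case by simp
next
  case (insert f F)
  have "openin (inverse_topology R) (prime_ideals R - basic_open R f)"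
    unfolding inverse_topology_def
    using openin_basic_open[of f R] compactin_basic_open[OF R, of f] insert.prems
    by (intro topology_generated_by_Basis) blast
  then have "openin (max_inverse R) ((prime_ideals R - basic_open R f) \<inter> max_ideals R)"
    unfolding max_inverse_def by (rule openin_subtopology_Int)
  moreover have "max_locus R (insert f F) = ((prime_ideals R - basic_open R f) \<inter> max_ideals R) \<inter> max_locus R F"
    using max_ideals_subset_prime_ideals[OF R] unfolding max_locus_def basic_open_def by blast
  ultimately show ?case using insert by auto
qed

text \<open>A compact Zariski-open set is a finite union of basic sets, so on maximal ideals its
  complement is the locus of a finite set; finite intersections correspond to unions of these
  sets.\<close>

lemma max_inverse_base:
  assumes R: "subring R" and S: "openin (max_inverse R) S" and M: "M \<in> S"
  shows "\<exists>F. finite F \<and> F \<subseteq> R \<and> M \<in> max_locus R F \<and> max_locus R F \<subseteq> S"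
proof -
  let ?B = "{prime_ideals R - U | U. openin (zariski R) U \<and> compactin (zariski R) U}"
  obtain W where W: "openin (inverse_topology R) W" "S = W \<inter> max_ideals R"
    using S unfolding max_inverse_def openin_subtopology by blast
  have Mm: "M \<in> max_ideals R" using M W by blast
  have "generate_topology_on ?B W"
    using W(1) unfolding inverse_topology_def by (simp add: openin_topology_generated_by_iff)
  then have ex: "M \<in> W \<Longrightarrow> \<exists>F. finite F \<and> F \<subseteq> R \<and> M \<in> max_locus R F \<and> max_locus R F \<subseteq> W"
  proof (induction rule: generate_topology_on.induct)
    case (Int a b)
    then obtain F F' where F: "finite F" "F \<subseteq> R" "M \<in> max_locus R F" "max_locus R F \<subseteq> a"
      and F': "finite F'" "F' \<subseteq> R" "M \<in> max_locus R F'" "max_locus R F' \<subseteq> b" by blast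
    have "max_locus R (F \<union> F') = max_locus R F \<inter> max_locus R F'" unfolding max_locus_def by blast
    then show ?case using F F' by (intro exI[of _ "F \<union> F'"]) blast
  next
    case (Basis s)
    then obtain U where U: "s = prime_ideals R - U" "openin (zariski R) U" "compactin (zariski R) U" by blast
    have cov: "U \<subseteq> \<Union>(basic_open R ` {g \<in> R. basic_open R g \<subseteq> U})" using zariski_base[OF R U(2)] by blast
    have "openin (zariski R) W" if "W \<in> basic_open R ` {g \<in> R. basic_open R g \<subseteq> U}" for W
      using that openin_basic_open by blast
    then obtain \<F> where FF: "finite \<F>" "\<F> \<subseteq> basic_open R ` {g \<in> R. basic_open R g \<subseteq> U}" "U \<subseteq> \<Union>\<F>"
      using compactinD[OF U(3) _ cov] by blast
    obtain F where "F \<subseteq> {g \<in> R. basic_open R g \<subseteq> U}" "finite F" "\<F> = basic_open R ` F"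
      using finite_subset_image[OF FF(1,2)] by blast
    then have F: "F \<subseteq> {g \<in> R. basic_open R g \<subseteq> U}" "finite F" "U \<subseteq> \<Union>(basic_open R ` F)"
      using FF(3) by auto
    have "M \<in> max_locus R F" using Basis(2) Mm U(1) F(1) unfolding max_locus_def basic_open_def by blast
    moreover have "max_locus R F \<subseteq> s"
      using U(1) F(3) max_ideals_subset_prime_ideals[OF R] unfolding max_locus_def basic_open_def by blast
    ultimately show ?case using F(1,2) by blast
  next
    case (UN K)
    then obtain k where k: "k \<in> K" "M \<in> k" by blast
    obtain F where "finite F" "F \<subseteq> R" "M \<in> max_locus R F" "max_locus R F \<subseteq> k"
      using UN(2)[OF k] by (elim exE conjE)
    then show ?case using k(1) by (intro exI[of _ F]) auto
  qed simp
  have "M \<in> W" using M W(2) by simp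
  from ex[OF this] obtain F where F: "finite F" "F \<subseteq> R" "M \<in> max_locus R F" "max_locus R F \<subseteq> W"
    by (elim exE conjE)
  moreover have "max_locus R F \<subseteq> max_ideals R" unfolding max_locus_def by simp
  ultimately show ?thesis using W(2) by (intro exI[of _ F]) simp
qed

text \<open>Maximality enters here: f outside M is witnessed by m in M with
  \<open>1 = m + r * f\<close>, and no maximal ideal contains both m and f. So the locus of m is a
  neighbourhood of M that misses f.\<close>

lemma openin_max_locus_compl:
  assumes R: "subring R" and f: "f \<in> R"
  shows "openin (max_inverse R) (max_ideals R - max_locus R {f})"
proof (subst openin_subopen, intro ballI)
  fix M assume "M \<in> max_ideals R - max_locus R {f}"
  then have M: "M \<in> max_ideals R" "f \<notin> M" unfolding max_locus_def by auto
  obtain m r where mr: "m \<in> M" "r \<in> R" "1 = m + r * f" using max_ideal_complement[OF R M(1) f M(2)] by blast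
  have "openin (max_inverse R) (max_locus R {m})"
    using mr(1) max_ideal_closed(1)[OF M(1)] by (intro openin_max_locus[OF R]) auto
  moreover have "M \<in> max_locus R {m}" using M(1) mr(1) unfolding max_locus_def by blast
  moreover have "max_locus R {m} \<subseteq> max_ideals R - max_locus R {f}"
  proof
    fix N assume N: "N \<in> max_locus R {m}"
    then have N': "N \<in> max_ideals R" "m \<in> N" unfolding max_locus_def by auto
    have "f \<notin> N"
    proof
      assume "f \<in> N"
      then have "m + r * f \<in> N" using N'(2) mr(2) max_ideal_closed(3,4)[OF N'(1)] by blast
      then show False using mr(3) max_idealsD(3)[OF N'(1)] by simp
    qed
    then show "N \<in> max_ideals R - max_locus R {f}" using N'(1) unfolding max_locus_def by blast
  qed
  ultimately show "\<exists>T. openin (max_inverse R) T \<and> M \<in> T \<and> T \<subseteq> max_ideals R - max_locus R {f}" by blast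
qed

lemma closedin_max_locus:
  assumes R: "subring R" and F: "F \<subseteq> R"
  shows "closedin (max_inverse R) (max_locus R F)"
proof -
  have "max_ideals R - max_locus R F = (\<Union>f\<in>F. max_ideals R - max_locus R {f})"
    unfolding max_locus_def by blast
  moreover have "openin (max_inverse R) (\<Union>f\<in>F. max_ideals R - max_locus R {f})"
    using openin_max_locus_compl[OF R] F by (intro openin_Union) auto
  ultimately show ?thesis unfolding closedin_def topspace_max_inverse[OF R] by (auto simp: max_locus_def)
qed

lemma Hausdorff_max_inverse:
  assumes R: "subring R"
  shows "Hausdorff_space (max_inverse R)"
  unfolding Hausdorff_space_def topspace_max_inverse[OF R]
proof (intro allI impI, elim conjE)
  fix M N assume MN: "M \<in> max_ideals R" "N \<in> max_ideals R" "M \<noteq> N"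
  have "\<not> M \<subseteq> N"
    using max_idealsD(4)[OF MN(1) max_idealsD(1)[OF MN(2)]] max_idealsD(2)[OF MN(2)] MN(3) by blast
  then obtain f where f: "f \<in> M" "f \<notin> N" by blast
  then have fR: "f \<in> R" using max_ideal_closed(1)[OF MN(1)] by blast
  show "\<exists>U V. openin (max_inverse R) U \<and> openin (max_inverse R) V \<and> M \<in> U \<and> N \<in> V \<and> disjnt U V"
    using openin_max_locus[OF R, of "{f}"] openin_max_locus_compl[OF R fR] f fR MN
    by (intro exI[of _ "max_locus R {f}"] exI[of _ "max_ideals R - max_locus R {f}"])
      (auto simp: max_locus_def disjnt_def)
qed

section \<open>Compactness of the loci\<close>

lemma prime_ideal_prod_list:
  assumes R: "subring R" and P: "P \<in> prime_ideals R" and xs: "set xs \<subseteq> R" "prod_list xs \<in> P"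
  shows "\<exists>x\<in>set xs. x \<in> P"
  using xs
proof (induction xs)
  case Nil
  then show ?case using prime_idealsD(2)[OF P] by simp
next
  case (Cons x xs)
  have "prod_list xs \<in> R" using Cons.prems(1) by (induction xs) (auto simp: subringD[OF R])
  then show ?case using prime_idealsD(3)[OF P, of x "prod_list xs"] Cons by auto
qed

context almost_dedekind_domain
begin

text \<open>Dimension at most one: for nonzero p in P and x in a maximal M above P, some power of x
  is divisible by p in the localization at M. Clearing the denominator b, which is outside M, puts
  that power of x into P.\<close>

lemma nonzero_prime_max:
  assumes P: "P \<in> prime_ideals R" and p: "p \<in> P" "p \<noteq> 0"
  shows "P \<in> Max_R"
proof -
  note idP = is_idealD[OF prime_idealsD(1)[OF P]]
  obtain M where M: "M \<in> Max_R" "P \<subseteq> M"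
    using exists_max_ideal[OF subring prime_idealsD(1)[OF P] prime_idealsD(2)[OF P]] by blast
  have pR: "p \<in> R" using p(1) idP(1) by blast
  have "M \<subseteq> P"
  proof
    fix x assume x: "x \<in> M"
    have xR: "x \<in> R" using x max_ideal_closed(1)[OF M(1)] by blast
    show "x \<in> P"
    proof (cases "x = 0")
      case True then show ?thesis using idP(2) by simp
    next
      case False
      then have v: "1 \<le> val M x" using x in_max_iff[OF M(1) xR] unfolding vge_def by auto
      define k where "k = nat (val M p)"
      have "val M p \<le> int k * val M x"
      proof -
        have "val M p \<le> int k * 1" unfolding k_def by simp
        also have "\<dots> \<le> int k * val M x" using v by (intro mult_left_mono) auto
        finally show ?thesis .
      qed
      then have "vge (val M) 0 (x ^ k / p)"
        using valD(6)[OF M(1), of "x ^ k" p] valD(7)[OF M(1), of x k] False p(2) unfolding vge_def by auto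
      then obtain a b where ab: "a \<in> R" "b \<in> R" "b \<notin> M" "b \<noteq> 0" "x ^ k / p = a / b"
        using in_localizationE[OF M(1)] by blast
      then have "b * x ^ k = a * p" using p(2) by (simp add: field_simps)
      then have "b * x ^ k \<in> P" using idP(4)[OF ab(1) p(1)] by simp
      have xk: "x ^ j \<in> R" for j by (induction j) (auto simp: ring xR)
      then have "x ^ k \<in> P" using prime_idealsD(3)[OF P ab(2) xk \<open>b * x ^ k \<in> P\<close>] ab(3) M(2) by blast
      moreover have "x ^ j \<in> P \<Longrightarrow> x \<in> P" for j
        by (induction j) (use prime_idealsD(2,3)[OF P] xR xk in auto)
      ultimately show ?thesis by blast
    qed
  qed
  then have "P = M" using M(2) by (intro subset_antisym)
  then show ?thesis using M(1) by simp
qed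

text \<open>If no product of elements of \<open>G\<close> were a multiple of f, some prime would
  contain f and avoid \<open>G\<close>; as f is nonzero, this prime is maximal, so the cover would
  miss it. The factors of such a product give the finite subcover.\<close>

lemma max_locus_finite_cover:
  assumes f: "f \<in> R" "f \<noteq> 0" and G: "G \<subseteq> R" and cov: "max_locus R {f} \<subseteq> (\<Union>g\<in>G. max_locus R {g})"
  shows "\<exists>F. finite F \<and> F \<subseteq> G \<and> max_locus R {f} \<subseteq> (\<Union>g\<in>F. max_locus R {g})"
proof -
  let ?S = "{prod_list xs | xs. set xs \<subseteq> G}" and ?I = "{r * f | r. r \<in> R}"
  have I: "is_ideal R ?I"
    using is_ideal_adjoin(1)[OF subring _ f(1), of "{0}"] ring by (simp add: is_ideal_def)
  have "?I \<inter> ?S \<noteq> {}"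
  proof
    assume dis: "?I \<inter> ?S = {}"
    have one: "1 \<in> ?S" by (intro CollectI exI[of _ "[]"]) simp
    have mult: "s * t \<in> ?S" if st: "s \<in> ?S" "t \<in> ?S" for s t
    proof -
      obtain xs ys where "s = prod_list xs" "set xs \<subseteq> G" "t = prod_list ys" "set ys \<subseteq> G" using st by blast
      then show ?thesis by (intro CollectI exI[of _ "xs @ ys"]) simp
    qed
    have "\<exists>P\<in>prime_ideals R. ?I \<subseteq> P \<and> P \<inter> ?S = {}"
      using one mult by (rule exists_prime_avoiding[OF subring I dis])
    then obtain P where P: "P \<in> prime_ideals R" "?I \<subseteq> P" "P \<inter> ?S = {}" by (elim bexE conjE)
    have "1 * f \<in> ?I" using ring(2) by blast
    then have fP: "f \<in> P" using P(2) by auto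
    then have "P \<in> max_locus R {f}" using nonzero_prime_max[OF P(1) fP f(2)] unfolding max_locus_def by blast
    then obtain g where g: "g \<in> G" "g \<in> P" using cov unfolding max_locus_def by blast
    have "g \<in> ?S" using g(1) by (intro CollectI exI[of _ "[g]"]) simp
    then show False using g(2) P(3) by blast
  qed
  then obtain x where "x \<in> ?I" "x \<in> ?S" by auto
  then obtain a xs where axs: "a \<in> R" "set xs \<subseteq> G" and eq: "prod_list xs = a * f" by auto
  have "max_locus R {f} \<subseteq> (\<Union>g\<in>set xs. max_locus R {g})"
  proof
    fix M assume "M \<in> max_locus R {f}"
    then have M: "M \<in> Max_R" "f \<in> M" unfolding max_locus_def by auto
    then have "prod_list xs \<in> M" unfolding eq using max_ideal_closed(4)[OF M(1) axs(1)] by blast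
    then show "M \<in> (\<Union>g\<in>set xs. max_locus R {g})"
      using prime_ideal_prod_list[OF subring, of M xs] M(1) max_ideals_subset_prime_ideals[OF subring] axs(2) G
      unfolding max_locus_def by blast
  qed
  then show ?thesis using axs(2) by (intro exI[of _ "set xs"]) simp
qed

text \<open>The covering property for single loci feeds Alexander's subbase theorem for an auxiliary
  topology \<open>Y\<close> on the locus. The identity from \<open>Y\<close> to the inverse topology
  is continuous and transports compactness.\<close>

lemma compactin_max_locus_single:
  assumes f: "f \<in> R" "f \<noteq> 0"
  shows "compactin (max_inverse R) (max_locus R {f})"
proof -
  define V where "V = max_locus R {f}"
  let ?B = "(\<lambda>g. max_locus R {g}) ` R"
  let ?Q = "finite intersection_of (\<lambda>x. x \<in> ?B) relative_to V"
  define Y where "Y = topology (arbitrary union_of ?Q)"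
  have "compact_space Y"
  proof (rule Alexander_subbase_alt[of V ?B])
    show "V \<subseteq> \<Union>?B" unfolding V_def using f(1) by blast
    show "\<exists>C'. finite C' \<and> C' \<subseteq> C \<and> V \<subseteq> \<Union>C'" if C: "C \<subseteq> ?B" "V \<subseteq> \<Union>C" for C
    proof -
      define G where "G = {g \<in> R. max_locus R {g} \<in> C}"
      have GR: "G \<subseteq> R" unfolding G_def by blast
      have "C = (\<lambda>g. max_locus R {g}) ` G" using C(1) unfolding G_def by auto
      then have "max_locus R {f} \<subseteq> (\<Union>g\<in>G. max_locus R {g})" using C(2) unfolding V_def by simp
      from max_locus_finite_cover[OF f GR this]
      obtain F where F: "finite F" "F \<subseteq> G" "V \<subseteq> (\<Union>g\<in>F. max_locus R {g})" unfolding V_def by auto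
      have "(\<lambda>g. max_locus R {g}) ` F \<subseteq> C" using F(2) unfolding G_def by auto
      then show ?thesis using F(1,3) by (intro exI[of _ "(\<lambda>g. max_locus R {g}) ` F"]) simp
    qed
    show "topology (arbitrary union_of ?Q) = Y" unfolding Y_def ..
  qed
  have openY: "openin Y (V \<inter> max_locus R {g})" if "g \<in> R" for g
    unfolding Y_def using that
    by (auto simp: openin_subbase intro!: arbitrary_union_of_inc relative_to_inc finite_intersection_of_inc)
  have topY: "topspace Y = V"
    unfolding Y_def topspace_subbase ..
  have openF: "openin Y (V \<inter> max_locus R F)" if "finite F" "F \<subseteq> R" for F
    using that
  proof (induction F rule: finite_induct)
    case empty
    have "V \<inter> max_locus R {} = topspace Y" unfolding topY unfolding V_def max_locus_def by blast
    then show ?case by simp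
  next
    case (insert g F)
    have "V \<inter> max_locus R (insert g F) = (V \<inter> max_locus R {g}) \<inter> (V \<inter> max_locus R F)"
      unfolding max_locus_def by blast
    then show ?case using insert openY[of g] by auto
  qed
  have "continuous_map Y (max_inverse R) id"
    unfolding continuous_map_def
  proof (intro conjI allI impI)
    show "id \<in> topspace Y \<rightarrow> topspace (max_inverse R)"
      unfolding topY topspace_max_inverse[OF subring] V_def max_locus_def by auto
    fix S assume S: "openin (max_inverse R) S"
    show "openin Y {x \<in> topspace Y. id x \<in> S}"
    proof (subst openin_subopen, intro ballI)
      fix M assume "M \<in> {x \<in> topspace Y. id x \<in> S}"
      then have M: "M \<in> V" "M \<in> S" unfolding topY by auto
      obtain F where F: "finite F" "F \<subseteq> R" "M \<in> max_locus R F" "max_locus R F \<subseteq> S"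
        using max_inverse_base[OF subring S M(2)] by blast
      show "\<exists>T. openin Y T \<and> M \<in> T \<and> T \<subseteq> {x \<in> topspace Y. id x \<in> S}"
        using openF[OF F(1,2)] M(1) F(3,4) unfolding topY by (intro exI[of _ "V \<inter> max_locus R F"]) auto
    qed
  qed
  moreover have "compactin Y V" using \<open>compact_space Y\<close> topY unfolding compact_space_def by simp
  ultimately have "compactin (max_inverse R) (id ` V)" by (intro image_compactin)
  then show ?thesis unfolding V_def by simp
qed

text \<open>The positive part of \<open>f\<close> is again a value function, say of
  \<open>F\<close>. Its values are nonnegative, so \<open>F\<close> lies in \<open>R\<close>, and
  positivity at M says that \<open>F\<close> lies in M.\<close>

lemma pos_vfuns:
  assumes "f \<in> vfuns"
  shows "\<exists>F\<in>fsets. F \<subseteq> R \<and> {M. f M > 0} = max_locus R F"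
proof -
  have "0 \<in> vfuns" by (rule zmod.subspace_0[OF subspace_vfuns])
  then have "f - (\<lambda>x. min (f x) (0 x)) \<in> vfuns"
    by (intro zmod.subspace_diff[OF subspace_vfuns] assms min_vfuns)
  then obtain F where F: "F \<in> fsets" "nu F = f - (\<lambda>x. min (f x) (0 x))" unfolding vfuns_def by auto
  have nu: "nu F M = max (f M) 0" for M using F(2) by (auto simp: fun_eq_iff)
  have FR: "F \<subseteq> R"
  proof
    fix x assume x: "x \<in> F"
    show "x \<in> R" unfolding in_R_iff vge_def
    proof
      fix M assume M: "M \<in> Max_R"
      show "x = 0 \<or> 0 \<le> val M x" using nu_le[OF F(1) M x] nu[of M] by auto
    qed
  qed
  have "f M > 0 \<longleftrightarrow> M \<in> max_locus R F" for M
  proof (cases "M \<in> Max_R")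
    case True
    have "f M > 0 \<longleftrightarrow> 1 \<le> nu F M" unfolding nu by auto
    also have "\<dots> \<longleftrightarrow> (\<forall>x\<in>F. 1 \<le> val M x)" by (rule nu_ge_iff[OF F(1) True])
    also have "\<dots> \<longleftrightarrow> (\<forall>x\<in>F. x \<in> M)"
    proof (intro ball_cong refl)
      fix x assume "x \<in> F"
      then have "x \<in> R" "x \<noteq> 0" using FR F(1) unfolding fsets_def by auto
      then show "1 \<le> val M x \<longleftrightarrow> x \<in> M" using in_max_iff[OF True] unfolding vge_def by auto
    qed
    finally show ?thesis using True unfolding max_locus_def by auto
  next
    case False
    then have "max (f M) 0 = 0" using nu[of M] unfolding nu_def by simp
    then show ?thesis using False unfolding max_locus_def by auto
  qed
  then show ?thesis using F(1) FR by blast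
qed

sublocale positivity_space "max_inverse R" vfuns
proof
  show "zmod.subspace vfuns" by (rule subspace_vfuns)
  show "(\<lambda>x. min (f x) (g x)) \<in> vfuns" if "f \<in> vfuns" "g \<in> vfuns" for f g using that by (rule min_vfuns)
  show "f x = 0" if "f \<in> vfuns" "x \<notin> topspace (max_inverse R)" for f x
    using that unfolding topspace_max_inverse[OF subring] vfuns_def nu_def by auto
  show "openin (max_inverse R) {x. f x > 0}" if f: "f \<in> vfuns" for f
  proof -
    obtain F where "F \<in> fsets" "F \<subseteq> R" "{M. f M > 0} = max_locus R F" using pos_vfuns[OF f] by blast
    then show ?thesis using openin_max_locus[OF subring, of F] unfolding fsets_def by simp
  qed
  show "compactin (max_inverse R) {x. f x > 0}" if f: "f \<in> vfuns" for f
  proof -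
    obtain F where F: "F \<in> fsets" "F \<subseteq> R" "{M. f M > 0} = max_locus R F" using pos_vfuns[OF f] by blast
    obtain x where x: "x \<in> F" "x \<noteq> 0" using F(1) unfolding fsets_def by auto
    have "compactin (max_inverse R) (max_locus R {x})" using x F(2) by (intro compactin_max_locus_single) auto
    moreover have "max_locus R F \<subseteq> max_locus R {x}" using x(1) unfolding max_locus_def by blast
    ultimately show ?thesis unfolding F(3) using closedin_max_locus[OF subring F(2)] closed_compactin by blast
  qed
  show "\<exists>f\<in>vfuns. f M > 0 \<and> {y. f y > 0} \<subseteq> S" if S: "openin (max_inverse R) S" "M \<in> S" for S M
  proof -
    obtain F where F: "finite F" "F \<subseteq> R" "M \<in> max_locus R F" "max_locus R F \<subseteq> S"
      using max_inverse_base[OF subring S] by blast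
    have M: "M \<in> Max_R" "F \<subseteq> M" using F(3) unfolding max_locus_def by auto
    have MR: "M \<subseteq> R" by (rule max_ideal_closed(1)[OF M(1)])
    obtain t where t: "t \<in> M" "t \<noteq> 0" using uniformizer_exists[OF M(1)] by blast
    \<comment> \<open>The nonzero element \<open>t\<close> of \<open>M\<close> keeps the set
      nonempty even if \<open>F\<close> has no nonzero element; it only shrinks the locus.\<close>
    define F1 where "F1 = insert t (F - {0})"
    have F1: "F1 \<in> fsets" "F1 \<subseteq> M" unfolding F1_def fsets_def using F(1) t M(2) by auto
    have pos: "nu F1 N > 0 \<longleftrightarrow> F1 \<subseteq> N" if N: "N \<in> Max_R" for N
    proof -
      have "nu F1 N > 0 \<longleftrightarrow> 1 \<le> nu F1 N" by linarith
      also have "\<dots> \<longleftrightarrow> (\<forall>x\<in>F1. 1 \<le> val N x)" by (rule nu_ge_iff[OF F1(1) N])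
      also have "\<dots> \<longleftrightarrow> (\<forall>x\<in>F1. x \<in> N)"
      proof (intro ball_cong refl)
        fix x assume "x \<in> F1"
        then have "x \<in> R" "x \<noteq> 0" using MR F1 unfolding fsets_def by auto
        then show "1 \<le> val N x \<longleftrightarrow> x \<in> N" using in_max_iff[OF N] unfolding vge_def by auto
      qed
      finally show ?thesis by auto
    qed
    have "{N. nu F1 N > 0} \<subseteq> S"
    proof
      fix N assume "N \<in> {N. nu F1 N > 0}"
      then have N: "N \<in> Max_R" "nu F1 N > 0" unfolding nu_def by (auto split: if_splits)
      then have "F1 \<subseteq> N" using pos by blast
      then have "F \<subseteq> N" using max_ideal_closed(2)[OF N(1)] unfolding F1_def by auto
      then show "N \<in> S" using F(4) N(1) unfolding max_locus_def by blast
    qed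
    moreover have "nu F1 M > 0" using pos[OF M(1)] F1(2) by blast
    ultimately show ?thesis using F1(1) unfolding vfuns_def by blast
  qed
  show "Hausdorff_space (max_inverse R)" by (rule Hausdorff_max_inverse[OF subring])
qed

lemma closedin_subset_Max: "closedin (max_inverse R) C \<Longrightarrow> C \<subseteq> Max_R"
  using closedin_subset topspace_max_inverse[OF subring] by blast

end

subsection \<open>Overrings and critical ideals\<close>

lemma gen_ideal_generator:
  assumes T: "subring T" and F: "finite F" "f \<in> F"
  shows "f \<in> gen_ideal T F"
proof -
  have "(\<Sum>g\<in>F. (if g = f then 1 else 0) * g) = (\<Sum>g\<in>F. if g = f then f else 0)"
    by (intro sum.cong) auto
  also have "\<dots> = f" using F by simp
  finally show ?thesis unfolding gen_ideal_def using subringD(1,2)[OF T]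
    by (intro CollectI exI[of _ "\<lambda>g. if g = f then 1 else 0"]) auto
qed

context almost_dedekind_domain
begin

lemma in_overring_iff:
  assumes "C \<subseteq> Max_R"
  shows "x \<in> overring R C \<longleftrightarrow> (\<forall>Q\<in>C. vge (val Q) 0 x)"
  using assms val(2) unfolding overring_def by blast

lemma subring_overring:
  assumes C: "C \<subseteq> Max_R"
  shows "subring (overring R C)" "R \<subseteq> overring R C"
proof -
  have CM: "\<And>Q. Q \<in> C \<Longrightarrow> Q \<in> Max_R" using C by blast
  show sub: "R \<subseteq> overring R C" using vge_R CM in_overring_iff[OF C] by blast
  have neg: "vge v 0 (- x)" if "valuation v" "vge v 0 x" "vge v 0 (-1)" for v and x :: 'k
    using vge_mult[OF that(1,3,2)] by simp
  show "subring (overring R C)"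
    unfolding subring_def
  proof (intro conjI ballI)
    show "0 \<in> overring R C" "1 \<in> overring R C" using sub ring by auto
    fix x y assume x: "x \<in> overring R C" and y: "y \<in> overring R C"
    show "x + y \<in> overring R C" using x y vge_add[OF val(1)[OF CM]] unfolding in_overring_iff[OF C] by blast
    show "x * y \<in> overring R C" using x y vge_mult[OF val(1)[OF CM], of _ 0 x 0 y] unfolding in_overring_iff[OF C] by simp
    have "vge (val Q) 0 (-1)" if "Q \<in> C" for Q using vge_R[OF CM[OF that]] ring(2,5) by blast
    then show "- x \<in> overring R C" using x neg[OF val(1)[OF CM]] unfolding in_overring_iff[OF C] by blast
  qed
qed

text \<open>The coefficients of a partition of unity have values at least \<open>- nu F\<close>,
  hence nonnegative on \<open>C\<close>; so \<open>F\<close> generates the unit ideal of the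
  overring.\<close>

lemma partition_in_overring:
  assumes C: "C \<subseteq> Max_R" and F: "F \<in> fsets" "\<And>Q. Q \<in> C \<Longrightarrow> nu F Q \<le> 0"
  shows "\<exists>z. (\<forall>f\<in>F. z f \<in> overring R C) \<and> 1 = (\<Sum>f\<in>F. f * z f)"
proof -
  obtain y where y: "\<forall>f\<in>F. \<forall>g\<in>F. y f * g \<in> R" "1 = (\<Sum>f\<in>F. f * y f)"
    using partition_of_unity[OF F(1)] by blast
  have "y f \<in> overring R C" if f: "f \<in> F" for f
    unfolding in_overring_iff[OF C]
  proof
    fix Q assume Q: "Q \<in> C"
    then have "vge (val Q) (- nu F Q) (y f)" using C by (intro partition_of_unity_vge[OF F(1) y(1) _ f]) blast
    then show "vge (val Q) 0 (y f)" using vge_mono[of "val Q" "- nu F Q" "y f" 0] F(2)[OF Q] by simp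
  qed
  then show ?thesis using y(2) by blast
qed

text \<open>The elements \<open>y 1\<close> and \<open>y x\<close> of a partition of unity for
  \<open>{1, x}\<close> are denominators of x. They cannot both have positive value at a Q in
  \<open>C\<close>, where 1 and x have nonnegative value; so denominators of x generate the unit
  ideal of the overring.\<close>

lemma overring_denominators:
  assumes C: "C \<subseteq> Max_R" and x: "x \<in> overring R C"
  shows "\<exists>F z. finite F \<and> (\<forall>f\<in>F. f \<in> R \<and> f * x \<in> R \<and> z f \<in> overring R C) \<and> 1 = (\<Sum>f\<in>F. f * z f)"
proof (cases "x = 0")
  case True
  then show ?thesis using subringD(2)[OF subring_overring(1)[OF C]] ring(1,2)
    by (intro exI[of _ "{1}"] exI[of _ "\<lambda>_. 1"]) simp
next
  case x0: False
  have X: "{1, x} \<in> fsets" using x0 unfolding fsets_def by simp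
  obtain y where y: "\<forall>f\<in>{1, x}. \<forall>g\<in>{1, x}. y f * g \<in> R" "1 = (\<Sum>f\<in>{1, x}. f * y f)"
    using partition_of_unity[OF X] by blast
  define F where "F = y ` {1, x} - {0}"
  have FR: "f \<in> R" "f * x \<in> R" if "f \<in> F" for f using y(1) that unfolding F_def by auto
  have "F \<noteq> {}"
  proof
    assume "F = {}"
    then have "(\<Sum>f\<in>{1, x}. f * y f) = 0" unfolding F_def by (intro sum.neutral) auto
    then show False using y(2) by simp
  qed
  then have F: "F \<in> fsets" unfolding fsets_def F_def by auto
  have "nu F Q \<le> 0" if Q: "Q \<in> C" for Q
  proof (rule ccontr)
    assume A: "\<not> nu F Q \<le> 0"
    have QM: "Q \<in> Max_R" using Q C by blast
    note v = val(1)[OF QM]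
    have y1: "vge (val Q) 1 (y f)" if "f \<in> {1, x}" for f
    proof (cases "y f = 0")
      case False
      then have "y f \<in> F" using that unfolding F_def by blast
      then show ?thesis using nu_le[OF F QM, of "y f"] A unfolding vge_def by auto
    qed simp
    have xf: "vge (val Q) 0 f" if "f \<in> {1, x}" for f
      using that x Q vge_R[OF QM ring(2)] unfolding in_overring_iff[OF C] by auto
    have "vge (val Q) 1 (\<Sum>f\<in>{1, x}. f * y f)"
    proof (rule vge_sum[OF v])
      show "vge (val Q) 1 (f * y f)" if "f \<in> {1, x}" for f
        using vge_mult[OF v xf[OF that] y1[OF that]] by simp
    qed
    then show False using y(2) valD(4)[OF QM] unfolding vge_def by simp
  qed
  then obtain z where "\<forall>f\<in>F. z f \<in> overring R C" "1 = (\<Sum>f\<in>F. f * z f)"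
    using partition_in_overring[OF C F] by blast
  then show ?thesis using FR F unfolding fsets_def by blast
qed

text \<open>For the harder inclusion, x of positive value at \<open>Q\<close> is multiplied by a
  partition of 1 into denominators: each \<open>f * x\<close> lies in \<open>R\<close> and hence in
  \<open>Q\<close>, and x is a combination of them over the overring.\<close>

lemma extended_ideal_eq:
  assumes C: "C \<subseteq> Max_R" and Q: "Q \<in> C"
  shows "ideal_mult Q (overring R C) = {x \<in> overring R C. vge (val Q) 1 x}"
proof
  let ?T = "overring R C"
  have QM: "Q \<in> Max_R" using Q C by blast
  note T = subring_overring[OF C] and v = val(1)[OF QM]
  have QR: "Q \<subseteq> R" by (rule max_ideal_closed(1)[OF QM])
  show "ideal_mult Q ?T \<subseteq> {x \<in> ?T. vge (val Q) 1 x}"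
  proof
    fix x assume "x \<in> ideal_mult Q ?T"
    then obtain n :: nat and a b where ab: "\<And>i. i < n \<Longrightarrow> a i \<in> Q" "\<And>i. i < n \<Longrightarrow> b i \<in> ?T"
      "x = (\<Sum>i<n. a i * b i)" by (rule ideal_multE) blast
    have "a i * b i \<in> ?T" if "i < n" for i using subringD(4)[OF T(1)] ab(1,2)[OF that] QR T(2) by blast
    then have "x \<in> ?T" unfolding ab(3) by (intro subring_sum[OF T(1)]) simp
    moreover have "vge (val Q) 1 (a i * b i)" if i: "i < n" for i
    proof -
      have "vge (val Q) 1 (a i)" using in_max_iff[OF QM, of "a i"] ab(1)[OF i] QR by blast
      moreover have "vge (val Q) 0 (b i)" using ab(2)[OF i] Q unfolding in_overring_iff[OF C] by blast
      ultimately show ?thesis using vge_mult[OF v] by fastforce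
    qed
    then have "vge (val Q) 1 x" unfolding ab(3) by (intro vge_sum[OF v]) simp
    ultimately show "x \<in> {x \<in> ?T. vge (val Q) 1 x}" by blast
  qed
  show "{x \<in> ?T. vge (val Q) 1 x} \<subseteq> ideal_mult Q ?T"
  proof
    fix x assume "x \<in> {x \<in> ?T. vge (val Q) 1 x}"
    then have x: "x \<in> ?T" "vge (val Q) 1 x" by auto
    obtain F z where F: "finite F" "\<forall>f\<in>F. f \<in> R \<and> f * x \<in> R \<and> z f \<in> ?T" "1 = (\<Sum>f\<in>F. f * z f)"
      using overring_denominators[OF C x(1)] by blast
    have "f * x \<in> Q" if f: "f \<in> F" for f
    proof -
      have "vge (val Q) (0 + 1) (f * x)" using F(2) f x(2) by (intro vge_mult[OF v] vge_R[OF QM]) auto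
      then show ?thesis using in_max_iff[OF QM] F(2) f by simp
    qed
    then have "(\<Sum>f\<in>F. (f * x) * z f) \<in> ideal_mult Q ?T" using F(1,2) by (intro ideal_multI) auto
    moreover have "x = (\<Sum>f\<in>F. f * z f) * x" using F(3) by simp
    then have "x = (\<Sum>f\<in>F. (f * x) * z f)" by (simp add: sum_distrib_left sum_distrib_right mult_ac)
    ultimately show "x \<in> ideal_mult Q ?T" by simp
  qed
qed

text \<open>An element of J outside the extended ideal is a unit at \<open>Q\<close>. Its numerator
  lies in J and in \<open>R\<close> but not in \<open>Q\<close>, and together with \<open>Q\<close>
  it generates 1.\<close>

lemma extended_ideal_max:
  assumes C: "C \<subseteq> Max_R" and Q: "Q \<in> C"
  shows "ideal_mult Q (overring R C) \<in> max_ideals (overring R C)"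
proof -
  let ?T = "overring R C" and ?QT = "ideal_mult Q (overring R C)"
  have QM: "Q \<in> Max_R" using Q C by blast
  note T = subring_overring[OF C] and v = val(1)[OF QM] and eq = extended_ideal_eq[OF C Q]
  note ringT = subringD[OF T(1)]
  have id: "is_ideal ?T ?QT"
    unfolding is_ideal_def
  proof (intro conjI ballI)
    show "?QT \<subseteq> ?T" unfolding eq by blast
    show "0 \<in> ?QT" unfolding eq using ringT(1) by simp
    show "x + y \<in> ?QT" if "x \<in> ?QT" "y \<in> ?QT" for x y
      using that ringT(3) vge_add[OF v] unfolding eq by blast
    show "r * x \<in> ?QT" if "r \<in> ?T" "x \<in> ?QT" for r x
    proof -
      have "vge (val Q) 0 r" using that(1) Q unfolding in_overring_iff[OF C] by blast
      then have "vge (val Q) (0 + 1) (r * x)" using that(2) unfolding eq by (intro vge_mult[OF v]) auto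
      then show ?thesis using that ringT(4) unfolding eq by simp
    qed
  qed
  have n1: "1 \<notin> ?QT" unfolding eq using valD(4)[OF QM] unfolding vge_def by simp
  show ?thesis
    unfolding max_ideals_def
  proof (intro CollectI conjI allI impI)
    show "is_ideal ?T ?QT" by (rule id)
    show "?QT \<noteq> ?T" using n1 ringT(2) by blast
    fix J assume J: "is_ideal ?T J \<and> ?QT \<subseteq> J"
    note idJ = is_idealD[of ?T J]
    show "J = ?QT \<or> J = ?T"
    proof (cases "J \<subseteq> ?QT")
      case True then show ?thesis using J by blast
    next
      case False
      then obtain y where y: "y \<in> J" "y \<notin> ?QT" by blast
      have yT: "y \<in> ?T" using idJ(1) J y(1) by blast
      have "\<not> vge (val Q) 1 y" using y(2) yT unfolding eq by blast
      moreover have v0: "vge (val Q) 0 y" using yT Q unfolding in_overring_iff[OF C] by blast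
      ultimately have y0: "y \<noteq> 0" "val Q y = 0" unfolding vge_def by auto
      obtain a b where ab: "a \<in> R" "b \<in> R" "b \<notin> Q" "b \<noteq> 0" "y = a / b" using in_localizationE[OF QM v0] by blast
      have aeq: "a = b * y" using ab(4,5) by simp
      have "vge (val Q) 0 b" "\<not> vge (val Q) 1 b" using vge_R[OF QM ab(2)] in_max_iff[OF QM ab(2)] ab(3) by auto
      then have "val Q b = 0" unfolding vge_def by auto
      then have "val Q a = 0" using valD(1)[OF QM, of b y] ab(4) y0 aeq by simp
      moreover have "a \<noteq> 0" using aeq ab(4) y0(1) by simp
      ultimately have aQ: "a \<notin> Q" using in_max_iff[OF QM ab(1)] unfolding vge_def by simp
      have aJ: "a \<in> J" unfolding aeq using idJ(4) J y(1) ab(2) T(2) by blast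
      obtain q s where qs: "q \<in> Q" "s \<in> R" "1 = q + s * a" using max_ideal_complement[OF subring QM ab(1) aQ] by blast
      have "q * 1 \<in> ?QT" using qs(1) ringT(2) by (rule ideal_multI1)
      then have "q \<in> J" using J by auto
      moreover have "s * a \<in> J" using idJ(4) J aJ qs(2) T(2) by blast
      ultimately have "q + s * a \<in> J" using idJ(3) J by blast
      then have "1 \<in> J" using qs(3) by simp
      then show ?thesis using ideal_eq_ring J by blast
    qed
  qed
qed

text \<open>A maximal ideal N of the overring contracts to a nonzero prime, hence to a maximal ideal
  of \<open>R\<close>. Were this outside the closed set \<open>C\<close>, a finite set contained in
  it but in no member of \<open>C\<close> would generate the unit ideal of the overring while lying
  in N.\<close>

lemma max_ideals_overring:
  assumes C: "closedin (max_inverse R) C" "C \<noteq> {}"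
  shows "max_ideals (overring R C) = (\<lambda>Q. ideal_mult Q (overring R C)) ` C"
proof
  let ?T = "overring R C"
  have CM: "C \<subseteq> Max_R" by (rule closedin_subset_Max[OF C(1)])
  note T = subring_overring[OF CM]
  show "(\<lambda>Q. ideal_mult Q ?T) ` C \<subseteq> max_ideals ?T" using extended_ideal_max[OF CM] by blast
  show "max_ideals ?T \<subseteq> (\<lambda>Q. ideal_mult Q ?T) ` C"
  proof
    fix N assume N: "N \<in> max_ideals ?T"
    note idN = max_ideal_closed[OF N]
    have P: "N \<inter> R \<in> prime_ideals R" by (rule contraction_prime[OF subring T N])
    \<comment> \<open>A zero contraction forces \<open>N = {0}\<close>, which is strictly below the
      extension of any member of \<open>C\<close>.\<close>
    have "\<exists>p\<in>N \<inter> R. p \<noteq> 0"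
    proof (rule ccontr)
      assume A: "\<not> ?thesis"
      have "x = 0" if x: "x \<in> N" for x
      proof -
        obtain a b where ab: "a \<in> R" "b \<in> R" "b \<noteq> 0" "x = a / b" using quotient_field by blast
        then have aeq: "a = b * x" by simp
        have "a \<in> N" unfolding aeq using idN(4) x ab(2) T(2) by blast
        then have "a = 0" using A ab(1) by blast
        then show ?thesis using ab(4) by simp
      qed
      then have N0: "N = {0}" using idN(2) by blast
      obtain Q where Q: "Q \<in> C" using C(2) by blast
      then have QM: "Q \<in> Max_R" using CM by blast
      obtain t where t: "t \<in> Q" "t \<noteq> 0" using uniformizer_exists[OF QM] by blast
      have "t * 1 \<in> ideal_mult Q ?T" using t(1) subringD(2)[OF T(1)] by (rule ideal_multI1)
      then have "ideal_mult Q ?T \<noteq> N" using t(2) N0 by auto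
      moreover note qm = max_idealsD[OF extended_ideal_max[OF CM Q]]
      have "N \<subseteq> ideal_mult Q ?T" using N0 is_idealD(2)[OF qm(1)] by simp
      ultimately show False using max_idealsD(4)[OF N qm(1)] qm(2) by blast
    qed
    then obtain p where p: "p \<in> N \<inter> R" "p \<noteq> 0" by blast
    have PM: "N \<inter> R \<in> Max_R" by (rule nonzero_prime_max[OF P p])
    have PC: "N \<inter> R \<in> C"
    proof (rule ccontr)
      assume "N \<inter> R \<notin> C"
      moreover have "openin (max_inverse R) (Max_R - C)"
        using C(1) unfolding closedin_def topspace_max_inverse[OF subring] by blast
      ultimately obtain f where f: "f \<in> vfuns" "f (N \<inter> R) > 0" "{y. f y > 0} \<subseteq> Max_R - C"
        using base_pos[of "Max_R - C" "N \<inter> R"] PM by blast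
      obtain F where F: "F \<in> fsets" "F \<subseteq> R" "{M. f M > 0} = max_locus R F" using pos_vfuns[OF f(1)] by blast
      have "nu F Q \<le> 0" if Q: "Q \<in> C" for Q
      proof (rule ccontr)
        assume A: "\<not> nu F Q \<le> 0"
        have QM: "Q \<in> Max_R" using Q CM by blast
        have "x \<in> Q" if x: "x \<in> F" for x
        proof -
          have "vge (val Q) 1 x" using nu_le[OF F(1) QM x] A unfolding vge_def by simp
          then show ?thesis using in_max_iff[OF QM] F(2) x by blast
        qed
        then have "Q \<in> max_locus R F" using QM unfolding max_locus_def by blast
        then show False using F(3) f(3) Q by blast
      qed
      then obtain z where z: "\<forall>f\<in>F. z f \<in> ?T" "1 = (\<Sum>f\<in>F. f * z f)" using partition_in_overring[OF CM F(1)] by blast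
      have "N \<inter> R \<in> max_locus R F" using f(2) F(3) by blast
      then have FN: "F \<subseteq> N" unfolding max_locus_def by blast
      have "f * z f \<in> N" if "f \<in> F" for f
        using idN(4)[of "z f" f] z(1) FN that by (metis mult.commute subsetD)
      then have "(\<Sum>f\<in>F. f * z f) \<in> N" by (rule ideal_sum[OF max_idealsD(1)[OF N]])
      then show False using z(2) max_idealsD(3)[OF N] by simp
    qed
    have "ideal_mult (N \<inter> R) ?T \<subseteq> N"
    proof
      fix x assume "x \<in> ideal_mult (N \<inter> R) ?T"
      then obtain n :: nat and a b where ab: "\<And>i. i < n \<Longrightarrow> a i \<in> N \<inter> R" "\<And>i. i < n \<Longrightarrow> b i \<in> ?T"
        "x = (\<Sum>i<n. a i * b i)" by (rule ideal_multE) blast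
      have "a i * b i \<in> N" if "i < n" for i
        using idN(4)[OF ab(2)[OF that], of "a i"] ab(1)[OF that] by (simp add: mult.commute)
      then show "x \<in> N" unfolding ab(3) by (intro ideal_sum[OF max_idealsD(1)[OF N]]) simp
    qed
    then have "N = ideal_mult (N \<inter> R) ?T"
      using max_idealsD(4)[OF extended_ideal_max[OF CM PC] max_idealsD(1)[OF N]] max_idealsD(2)[OF N] by blast
    then show "N \<in> (\<lambda>Q. ideal_mult Q ?T) ` C" using PC by blast
  qed
qed

text \<open>The recursion asks for criticality of the extension of every maximal ideal of
  \<open>R\<close>, so an ideal outside \<open>C\<close> must be kept from having the same extension
  as one inside.\<close>

lemma extended_ideal_inj:
  assumes C: "C \<subseteq> Max_R" and Q: "Q \<in> C" and P: "P \<in> Max_R"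
    and eq: "ideal_mult P (overring R C) = ideal_mult Q (overring R C)"
  shows "P = Q"
proof -
  have QM: "Q \<in> Max_R" using Q C by blast
  note T = subring_overring[OF C]
  have "P \<subseteq> Q"
  proof
    fix x assume x: "x \<in> P"
    have xR: "x \<in> R" using max_ideal_closed(1)[OF P] x by blast
    have "x * 1 \<in> ideal_mult P (overring R C)" using x subringD(2)[OF T(1)] by (rule ideal_multI1)
    then have "vge (val Q) 1 x" unfolding eq extended_ideal_eq[OF C Q] by simp
    then show "x \<in> Q" using in_max_iff[OF QM xR] by blast
  qed
  then show ?thesis using max_idealsD(4)[OF P max_idealsD(1)[OF QM]] max_idealsD(2)[OF QM] by blast
qed

text \<open>With a uniformizer t and b outside \<open>Q\<close>, \<open>b * x = a * t * t\<close>.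
  Writing 1 as \<open>q + s * b\<close> splits x into \<open>q * x\<close> and
  \<open>(s * a * t) * t\<close>, whose four factors all lie in the extended ideal.\<close>

lemma extended_ideal_square:
  assumes C: "C \<subseteq> Max_R" and Q: "Q \<in> C"
  shows "ideal_mult (ideal_mult Q (overring R C)) (ideal_mult Q (overring R C)) =
    {x \<in> overring R C. vge (val Q) 2 x}"
proof
  let ?T = "overring R C" and ?QT = "ideal_mult Q (overring R C)"
  have QM: "Q \<in> Max_R" using Q C by blast
  note T = subring_overring[OF C] and v = val(1)[OF QM] and eq = extended_ideal_eq[OF C Q]
  note ringT = subringD[OF T(1)]
  have QR: "Q \<subseteq> R" by (rule max_ideal_closed(1)[OF QM])
  have QQT: "Q \<subseteq> ?QT" using ideal_multI1[OF _ ringT(2), of _ Q] by auto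
  show "ideal_mult ?QT ?QT \<subseteq> {x \<in> ?T. vge (val Q) 2 x}"
  proof
    fix x assume "x \<in> ideal_mult ?QT ?QT"
    then obtain n :: nat and a b where ab: "\<And>i. i < n \<Longrightarrow> a i \<in> ?QT" "\<And>i. i < n \<Longrightarrow> b i \<in> ?QT"
      "x = (\<Sum>i<n. a i * b i)" by (rule ideal_multE) blast
    have abT: "a i \<in> ?T" "vge (val Q) 1 (a i)" "b i \<in> ?T" "vge (val Q) 1 (b i)" if "i < n" for i
      using ab(1,2)[OF that] unfolding eq by auto
    have "x \<in> ?T" unfolding ab(3) using abT ringT(4) by (intro subring_sum[OF T(1)]) simp
    moreover have "vge (val Q) 2 (a i * b i)" if i: "i < n" for i
      using vge_mult[OF v abT(2)[OF i] abT(4)[OF i]] by simp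
    then have "vge (val Q) 2 x" unfolding ab(3) by (intro vge_sum[OF v]) simp
    ultimately show "x \<in> {x \<in> ?T. vge (val Q) 2 x}" by blast
  qed
  show "{x \<in> ?T. vge (val Q) 2 x} \<subseteq> ideal_mult ?QT ?QT"
  proof
    fix x assume "x \<in> {x \<in> ?T. vge (val Q) 2 x}"
    then have x: "x \<in> ?T" "vge (val Q) 2 x" by auto
    have xQT: "x \<in> ?QT" unfolding eq using x vge_mono[OF x(2), of 1] by simp
    obtain t where t: "t \<in> Q" "t \<noteq> 0" "val Q t = 1" using uniformizer_exists[OF QM] by blast
    have "vge (val Q) 0 (x / (t * t))"
      using x(2) valD(6)[OF QM, of x "t * t"] valD(1)[OF QM t(2,2)] t(2,3)
      unfolding vge_def by (cases "x = 0") auto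
    then obtain a b where ab: "a \<in> R" "b \<in> R" "b \<notin> Q" "b \<noteq> 0" "x / (t * t) = a / b"
      using in_localizationE[OF QM] by blast
    then have bx: "b * x = a * t * t" using t(2) by (simp add: field_simps)
    obtain q s where qs: "q \<in> Q" "s \<in> R" "1 = q + s * b" using max_ideal_complement[OF subring QM ab(2,3)] by blast
    have "x = (q + s * b) * x" using qs(3) by simp
    also have "\<dots> = q * x + s * (b * x)" by (simp add: algebra_simps)
    also have "\<dots> = q * x + (s * a * t) * t" unfolding bx by (simp add: algebra_simps)
    finally have xeq: "x = q * x + (s * a * t) * t" .
    have "s * a * t \<in> Q" using max_ideal_closed(4)[OF QM, of "s * a" t] ring(4) qs(2) ab(1) t(1) by blast
    then have "q * x + (s * a * t) * t \<in> ideal_mult ?QT ?QT"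
      using QQT qs(1) xQT t(1) by (intro ideal_multI2) auto
    then show "x \<in> ideal_mult ?QT ?QT" using xeq by simp
  qed
qed

lemma gen_ideal_subset_iff:
  assumes T: "subring T" and F: "finite F" and v: "valuation v" "\<And>x. x \<in> T \<Longrightarrow> vge v 0 x"
    and FT: "F \<subseteq> T"
  shows "gen_ideal T F \<subseteq> {x \<in> T. vge v n x} \<longleftrightarrow> (\<forall>f\<in>F. vge v n f)"
proof
  assume "gen_ideal T F \<subseteq> {x \<in> T. vge v n x}"
  then show "\<forall>f\<in>F. vge v n f" using gen_ideal_generator[OF T F] by blast
next
  assume A: "\<forall>f\<in>F. vge v n f"
  show "gen_ideal T F \<subseteq> {x \<in> T. vge v n x}"
  proof
    fix x assume "x \<in> gen_ideal T F"
    then obtain c where c: "\<forall>f\<in>F. c f \<in> T" "x = (\<Sum>f\<in>F. c f * f)" unfolding gen_ideal_def by blast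
    have "x \<in> T" unfolding c(2) using c(1) FT subringD(4)[OF T] by (intro subring_sum[OF T]) blast
    moreover have "vge v n (c f * f)" if f: "f \<in> F" for f
      using vge_mult[OF v(1) v(2)[of "c f"], of n f] c(1) A f by simp
    then have "vge v n x" unfolding c(2) by (rule vge_sum[OF v(1)])
    ultimately show "x \<in> {x \<in> T. vge v n x}" by blast
  qed
qed

text \<open>The value conditions define ideals of the overring, so containment of a finitely
  generated ideal is tested on its generators.\<close>

lemma critical_overring_iff:
  assumes C: "closedin (max_inverse R) C" "C \<noteq> {}" and P: "P \<in> C"
  shows "ideal_mult P (overring R C) \<in> critical_ideals (overring R C) \<longleftrightarrow>
    (\<forall>F. finite F \<and> F \<subseteq> overring R C \<and> (\<forall>f\<in>F. vge (val P) 1 f) \<longrightarrow> (\<exists>Q\<in>C. \<forall>f\<in>F. vge (val Q) 2 f))"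
proof -
  let ?T = "overring R C"
  have CM: "C \<subseteq> Max_R" by (rule closedin_subset_Max[OF C(1)])
  note T = subring_overring[OF CM]
  have v: "valuation (val Q)" "\<And>x. x \<in> ?T \<Longrightarrow> vge (val Q) 0 x" if "Q \<in> C" for Q
    using val(1) CM that in_overring_iff[OF CM] by auto
  have "ideal_mult P ?T \<in> critical_ideals ?T \<longleftrightarrow>
      (\<forall>J. fin_gen_ideal ?T J \<and> J \<subseteq> ideal_mult P ?T \<longrightarrow>
        (\<exists>Q\<in>C. J \<subseteq> ideal_mult (ideal_mult Q ?T) (ideal_mult Q ?T)))"
    unfolding critical_ideals_def using extended_ideal_max[OF CM P] max_ideals_overring[OF C] by auto
  also have "\<dots> \<longleftrightarrow> (\<forall>F. finite F \<and> F \<subseteq> ?T \<and> gen_ideal ?T F \<subseteq> ideal_mult P ?T \<longrightarrow>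
        (\<exists>Q\<in>C. gen_ideal ?T F \<subseteq> ideal_mult (ideal_mult Q ?T) (ideal_mult Q ?T)))"
    unfolding fin_gen_ideal_def by auto
  also have "\<dots> \<longleftrightarrow> (\<forall>F. finite F \<and> F \<subseteq> ?T \<and> (\<forall>f\<in>F. vge (val P) 1 f) \<longrightarrow> (\<exists>Q\<in>C. \<forall>f\<in>F. vge (val Q) 2 f))"
  proof -
    have 1: "gen_ideal ?T F \<subseteq> ideal_mult P ?T \<longleftrightarrow> (\<forall>f\<in>F. vge (val P) 1 f)" if "finite F" "F \<subseteq> ?T" for F
      unfolding extended_ideal_eq[OF CM P] using gen_ideal_subset_iff[OF T(1) that(1) v[OF P] that(2)] by simp
    have 2: "gen_ideal ?T F \<subseteq> ideal_mult (ideal_mult Q ?T) (ideal_mult Q ?T) \<longleftrightarrow> (\<forall>f\<in>F. vge (val Q) 2 f)"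
      if "finite F" "F \<subseteq> ?T" "Q \<in> C" for F Q
      unfolding extended_ideal_square[OF CM that(3)]
      using gen_ideal_subset_iff[OF T(1) that(1) v[OF that(3)] that(2)] by simp
    show ?thesis using 1 2 by (simp cong: conj_cong bex_cong)
  qed
  finally show ?thesis .
qed

text \<open>Finite sets of nonzero elements of the overring have value functions that are
  nonnegative on \<open>C\<close>, and conversely. This matches the two notions of criticality and
  turns a successor step of the recursion into the topological operator \<open>Cr\<close>.\<close>

theorem critical_overring_eq_Cr:
  assumes C: "closedin (max_inverse R) C"
  shows "{P \<in> Max_R. ideal_mult P (overring R C) \<in> critical_ideals (overring R C)} = Cr C"
proof (cases "C = {}")
  case True
  \<comment> \<open>Over the field every extension is the unit ideal, so nothing is
    critical.\<close>
  have "ideal_mult P UNIV \<notin> critical_ideals UNIV" if P: "P \<in> Max_R" for P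
  proof
    assume A: "ideal_mult P UNIV \<in> critical_ideals UNIV"
    obtain t where t: "t \<in> P" "t \<noteq> 0" using uniformizer_exists[OF P] by blast
    have "t * (1 / t) \<in> ideal_mult P UNIV" using t(1) by (intro ideal_multI1) auto
    then have "1 \<in> ideal_mult P UNIV" using t(2) by simp
    then show False using A max_idealsD(3) unfolding critical_ideals_def by blast
  qed
  then show ?thesis unfolding True overring_def Cr_def by simp
next
  case ne: False
  let ?T = "overring R C"
  have CM: "C \<subseteq> Max_R" by (rule closedin_subset_Max[OF C])
  have "P \<in> C" if P: "P \<in> Max_R" "ideal_mult P ?T \<in> critical_ideals ?T" for P
  proof -
    have "ideal_mult P ?T \<in> max_ideals ?T" using P(2) unfolding critical_ideals_def by blast
    then obtain Q where "Q \<in> C" "ideal_mult P ?T = ideal_mult Q ?T"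
      unfolding max_ideals_overring[OF C ne] by blast
    then show ?thesis using extended_ideal_inj[OF CM _ P(1)] by blast
  qed
  moreover have "P \<in> Cr C \<longleftrightarrow> ideal_mult P ?T \<in> critical_ideals ?T" if P: "P \<in> C" for P
    unfolding critical_overring_iff[OF C ne P]
  proof
    assume A: "P \<in> Cr C"
    show "\<forall>F. finite F \<and> F \<subseteq> ?T \<and> (\<forall>f\<in>F. vge (val P) 1 f) \<longrightarrow> (\<exists>Q\<in>C. \<forall>f\<in>F. vge (val Q) 2 f)"
    proof (intro allI impI, elim conjE)
      fix F assume F: "finite F" "F \<subseteq> ?T" "\<forall>f\<in>F. vge (val P) 1 f"
      show "\<exists>Q\<in>C. \<forall>f\<in>F. vge (val Q) 2 f"
      \<comment> \<open>The zero ideal has no value function, but 0 meets every value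
        condition.\<close>
      proof (cases "F \<subseteq> {0}")
        case True
        then show ?thesis using P by (intro bexI[of _ P]) auto
      next
        case False
        then have F': "F - {0} \<in> fsets" using F(1) unfolding fsets_def by auto
        have "0 \<le> nu (F - {0}) Q" if Q: "Q \<in> C" for Q
        proof -
          have QM: "Q \<in> Max_R" using Q CM by blast
          show ?thesis unfolding nu_ge_iff[OF F' QM]
            using F(2) Q in_overring_iff[OF CM] unfolding vge_def by blast
        qed
        moreover have "1 \<le> nu (F - {0}) P"
        proof -
          have PM: "P \<in> Max_R" using P CM by blast
          show ?thesis unfolding nu_ge_iff[OF F' PM] using F(3) unfolding vge_def by blast
        qed
        moreover have "nu (F - {0}) \<in> vfuns" using F' unfolding vfuns_def by blast
        moreover have "\<forall>g\<in>vfuns. (\<forall>y\<in>C. g y \<ge> 0) \<and> g P \<ge> 1 \<longrightarrow> (\<exists>y\<in>C. g y \<ge> 2)"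
          using A unfolding Cr_def by simp
        ultimately have "\<exists>Q\<in>C. 2 \<le> nu (F - {0}) Q" by simp
        then obtain Q where Q: "Q \<in> C" "2 \<le> nu (F - {0}) Q" by blast
        have QM: "Q \<in> Max_R" using Q CM by blast
        have "\<forall>f\<in>F. vge (val Q) 2 f" using Q(2) unfolding nu_ge_iff[OF F' QM] vge_def by blast
        then show ?thesis using Q(1) by blast
      qed
    qed
  next
    assume A: "\<forall>F. finite F \<and> F \<subseteq> ?T \<and> (\<forall>f\<in>F. vge (val P) 1 f) \<longrightarrow> (\<exists>Q\<in>C. \<forall>f\<in>F. vge (val Q) 2 f)"
    have PM: "P \<in> Max_R" using P CM by blast
    show "P \<in> Cr C"
      unfolding Cr_def
    proof (intro CollectI conjI ballI impI, rule P, elim conjE)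
      fix f assume f: "f \<in> vfuns" "\<forall>y\<in>C. 0 \<le> f y" "1 \<le> f P"
      obtain F where F: "F \<in> fsets" "f = nu F" using f(1) unfolding vfuns_def by blast
      have "F \<subseteq> ?T"
      proof
        fix x assume x: "x \<in> F"
        show "x \<in> ?T" unfolding in_overring_iff[OF CM]
        proof
          fix Q assume Q: "Q \<in> C"
          then have "0 \<le> nu F Q" using f(2) F(2) by blast
          moreover have "nu F Q \<le> val Q x" using Q CM by (intro nu_le[OF F(1) _ x]) blast
          ultimately show "vge (val Q) 0 x" unfolding vge_def by simp
        qed
      qed
      moreover have "\<forall>x\<in>F. vge (val P) 1 x" using f(3) unfolding F(2) nu_ge_iff[OF F(1) PM] vge_def by blast
      moreover have "finite F" using F(1) unfolding fsets_def by blast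
      ultimately obtain Q where Q: "Q \<in> C" "\<forall>x\<in>F. vge (val Q) 2 x" using A by blast
      have QM: "Q \<in> Max_R" using Q CM by blast
      have "2 \<le> f Q"
        unfolding F(2) nu_ge_iff[OF F(1) QM]
      proof
        fix x assume x: "x \<in> F"
        then have "x \<noteq> 0" using F(1) unfolding fsets_def by auto
        then show "2 \<le> val Q x" using bspec[OF Q(2) x] unfolding vge_def by simp
      qed
      then show "\<exists>y\<in>C. 2 \<le> f y" using Q(1) by blast
    qed
  qed
  moreover have "Cr C \<subseteq> C" unfolding Cr_def by blast
  ultimately show ?thesis using CM by blast
qed

end

subsection \<open>The derived sequence and the decomposition of the group of invertible ideals\<close>

lemma group_add_group:
  fixes M :: "'v::comm_ring_1 set"
  assumes "zmod.subspace M"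
  shows "group (add_group M)"
proof (rule groupI)
  fix x assume "x \<in> carrier (add_group M)"
  then show "\<exists>y\<in>carrier (add_group M). y \<otimes>\<^bsub>add_group M\<^esub> x = \<one>\<^bsub>add_group M\<^esub>"
    using zmod.subspace_neg[OF assms] unfolding add_group_def by (intro bexI[of _ "- x"]) auto
qed (use zmod.subspace_0[OF assms] zmod.subspace_add[OF assms] in \<open>auto simp: add_group_def add.assoc\<close>)

section \<open>Successors in a well-order and the recursion for the critical sequence\<close>

lemma is_predD:
  assumes "is_pred r b a"
  shows "(b, a) \<in> r" "b \<noteq> a" "\<And>c. (b, c) \<in> r \<Longrightarrow> c \<noteq> b \<Longrightarrow> (c, a) \<in> r \<Longrightarrow> c = a"
  using assms unfolding is_pred_def by auto

lemma is_pred_less_iff: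
  assumes r: "Well_order r" and p: "is_pred r b a" and c: "(c, a) \<in> r" "c \<noteq> a"
  shows "(c, b) \<in> r"
proof (rule ccontr)
  assume A: "(c, b) \<notin> r"
  have F: "b \<in> Field r" "c \<in> Field r" using is_predD(1)[OF p] c(1) unfolding Field_def by auto
  then have "(b, c) \<in> r" "c \<noteq> b" using Well_orderD(1)[OF r F] Well_orderD(1)[OF r F(1) F(1)] A by auto
  then show False using is_predD(3)[OF p] c by blast
qed

lemma is_pred_unique:
  assumes "Well_order r" "is_pred r b a" "is_pred r b' a"
  shows "b = b'"
  using is_pred_less_iff[OF assms(1,2) is_predD(1,2)[OF assms(3)]]
    is_pred_less_iff[OF assms(1,3) is_predD(1,2)[OF assms(2)]] Well_orderD(2)[OF assms(1)] by blast

lemma is_pred_succ_le: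
  assumes r: "Well_order r" and p: "is_pred r b a" and c: "(b, c) \<in> r" "b \<noteq> c"
  shows "(a, c) \<in> r"
proof (rule ccontr)
  assume A: "(a, c) \<notin> r"
  have F: "a \<in> Field r" "c \<in> Field r" using is_predD(1)[OF p] c(1) unfolding Field_def by auto
  then have "(c, a) \<in> r" "c \<noteq> a" using Well_orderD(1)[OF r F] Well_orderD(1)[OF r F(1) F(1)] A by auto
  then show False using is_predD(3)[OF p c(1)] c(2) by blast
qed

lemma wsucc_eq:
  assumes r: "Well_order r" and p: "is_pred r b a"
  shows "wsucc r b = a"
  unfolding wsucc_def
proof (rule some_equality)
  show "is_pred r b a" by (rule p)
  fix a' assume p': "is_pred r b a'"
  show "a' = a"
    using is_pred_succ_le[OF r p is_predD(1,2)[OF p']] is_pred_succ_le[OF r p' is_predD(1,2)[OF p]]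
      Well_orderD(2)[OF r] by blast
qed

text \<open>The successor is the least element above b, which exists because b is not the last
  element.\<close>

lemma is_pred_wsucc:
  assumes r: "Well_order r" and b: "(b, c) \<in> r" "b \<noteq> c"
  shows "is_pred r b (wsucc r b)"
proof -
  let ?S = "{d. (b, d) \<in> r \<and> d \<noteq> b}"
  have "c \<in> ?S" using b by blast
  then obtain a where a: "a \<in> ?S" "\<And>d. (d, a) \<in> r - Id \<Longrightarrow> d \<notin> ?S"
    by (rule wfE_min[OF Well_orderD(4)[OF r]]) blast
  have "is_pred r b a" unfolding is_pred_def using a by auto
  then show ?thesis using wsucc_eq[OF r] by simp
qed

lemma crit_seq_step:
  assumes r: "Well_order r"
  shows "crit_seq R r a = crit_step R r (cut (crit_seq R r) (r - Id) a) a"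
  unfolding crit_seq_def by (rule wfrec[OF Well_orderD(4)[OF r]])

lemma crit_seq_succ:
  assumes r: "Well_order r" and p: "is_pred r b a"
  shows "crit_seq R r a = {P \<in> max_ideals R. ideal_mult P (overring R (crit_seq R r b)) \<in>
    critical_ideals (overring R (crit_seq R r b))}"
proof -
  have "(THE b. is_pred r b a) = b" using p is_pred_unique[OF r _ p] by (rule the_equality)
  moreover have "cut (crit_seq R r) (r - Id) a b = crit_seq R r b"
    using is_predD(1,2)[OF p] by (simp add: cut_apply)
  moreover have "\<exists>b. is_pred r b a" using p by blast
  ultimately show ?thesis by (subst crit_seq_step[OF r]) (simp add: crit_step_def Let_def)
qed

text \<open>The least index is included: there the family of earlier stages is empty, and
  intersecting with \<open>max_ideals R\<close> gives all maximal ideals.\<close>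

lemma crit_seq_limit:
  assumes r: "Well_order r" and p: "\<And>b. \<not> is_pred r b a"
  shows "crit_seq R r a = max_ideals R \<inter> \<Inter> (crit_seq R r ` {b. (b, a) \<in> r \<and> b \<noteq> a})"
proof -
  have "cut (crit_seq R r) (r - Id) a ` {b. (b, a) \<in> r \<and> b \<noteq> a} = crit_seq R r ` {b. (b, a) \<in> r \<and> b \<noteq> a}"
    by (intro image_cong refl) (simp add: cut_apply)
  then show ?thesis using p by (subst crit_seq_step[OF r]) (simp add: crit_step_def)
qed

context almost_dedekind_domain
begin

text \<open>Both properties are proved together, since a successor stage is identified with
  \<open>Cr\<close> of the previous one by means of the closedness of the latter.\<close>

lemma crit_seq_closed_decreasing:
  assumes r: "Well_order r" and a: "a \<in> Field r"
  shows "closedin (max_inverse R) (crit_seq R r a) \<and> (\<forall>b. (b, a) \<in> r \<longrightarrow> crit_seq R r a \<subseteq> crit_seq R r b)"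
  using a
proof (induction a rule: wf_induct_rule[OF Well_orderD(4)[OF r]])
  case (1 a)
  have IH: "closedin (max_inverse R) (crit_seq R r b)" "\<And>c. (c, b) \<in> r \<Longrightarrow> crit_seq R r b \<subseteq> crit_seq R r c"
    if "(b, a) \<in> r" "b \<noteq> a" for b
  proof -
    have "(b, a) \<in> r - Id" "b \<in> Field r" using that unfolding Field_def by auto
    from 1(1)[OF this] show "closedin (max_inverse R) (crit_seq R r b)"
      "\<And>c. (c, b) \<in> r \<Longrightarrow> crit_seq R r b \<subseteq> crit_seq R r c" by auto
  qed
  show ?case
  proof (cases "\<exists>b. is_pred r b a")
    case True
    then obtain b where b: "is_pred r b a" by blast
    note b' = is_predD(1,2)[OF b]
    have eq: "crit_seq R r a = Cr (crit_seq R r b)"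
      unfolding crit_seq_succ[OF r b] by (rule critical_overring_eq_Cr[OF IH(1)[OF b']])
    have "crit_seq R r a \<subseteq> crit_seq R r c" if c: "(c, a) \<in> r" for c
    proof (cases "c = a")
      case False
      have "(c, b) \<in> r" by (rule is_pred_less_iff[OF r b c False])
      then have "crit_seq R r b \<subseteq> crit_seq R r c" by (rule IH(2)[OF b'])
      then show ?thesis using closed_Cr(2)[OF IH(1)[OF b']] unfolding eq by blast
    qed simp
    moreover have "closedin (max_inverse R) (crit_seq R r a)" unfolding eq by (rule closed_Cr(1)[OF IH(1)[OF b']])
    ultimately show ?thesis by blast
  next
    case False
    let ?B = "{b. (b, a) \<in> r \<and> b \<noteq> a}"
    have eq: "crit_seq R r a = Max_R \<inter> \<Inter> (crit_seq R r ` ?B)"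
      using False by (intro crit_seq_limit[OF r]) blast
    have Max: "closedin (max_inverse R) Max_R"
      using closedin_topspace[of "max_inverse R"] unfolding topspace_max_inverse[OF subring] .
    have "closedin (max_inverse R) (crit_seq R r a)"
    proof (cases "?B = {}")
      case True
      then show ?thesis unfolding eq True using Max by simp
    next
      case ne: False
      have "closedin (max_inverse R) (\<Inter> (crit_seq R r ` ?B))"
        using ne IH(1) by (intro closedin_Inter) auto
      then show ?thesis unfolding eq using Max by (intro closedin_Int)
    qed
    moreover have "crit_seq R r a \<subseteq> crit_seq R r c" if c: "(c, a) \<in> r" for c
    proof (cases "c = a")
      case False
      then show ?thesis unfolding eq using c by blast
    qed simp
    ultimately show ?thesis by blast
  qed
qed

lemma crit_seq_wsucc:
  assumes r: "Well_order r" and i: "(i, j) \<in> r" "i \<noteq> j"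
  shows "crit_seq R r (wsucc r i) = Cr (crit_seq R r i)"
proof -
  have "i \<in> Field r" using i unfolding Field_def by blast
  then have "closedin (max_inverse R) (crit_seq R r i)" using crit_seq_closed_decreasing[OF r] by blast
  then show ?thesis unfolding crit_seq_succ[OF r is_pred_wsucc[OF r i]] by (rule critical_overring_eq_Cr)
qed

lemma vanishing_antimono: "C \<subseteq> D \<Longrightarrow> vanishing D \<subseteq> vanishing C"
  unfolding vanishing_def by blast

text \<open>This is the continuity of the filtration. At the least index a function vanishing on all
  maximal ideals is 0; at a limit, compactness moves \<open>f\<close> to an earlier stage.\<close>

lemma vanishing_crit_seq_cases:
  assumes r: "Well_order r" and a: "a \<in> Field r" and f: "f \<in> vanishing (crit_seq R r a)"
  shows "f = 0 \<or> (\<exists>j. (j, a) \<in> r \<and> j \<noteq> a \<and> f \<in> vanishing (crit_seq R r (wsucc r j)))"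
proof (cases "\<exists>b. is_pred r b a")
  case True
  then obtain b where b: "is_pred r b a" by blast
  then show ?thesis using is_predD(1,2)[OF b] wsucc_eq[OF r b] f by blast
next
  case False
  let ?B = "{b. (b, a) \<in> r \<and> b \<noteq> a}"
  have eq: "crit_seq R r a = Max_R \<inter> \<Inter> (crit_seq R r ` ?B)"
    using False by (intro crit_seq_limit[OF r]) blast
  note cd = crit_seq_closed_decreasing[OF r]
  have BF: "b \<in> Field r" if "b \<in> ?B" for b using that unfolding Field_def by auto
  show ?thesis
  proof (cases "?B = {}")
    case True
    have "f x = 0" for x
      using f zero_outside[of f x] unfolding eq True vanishing_def topspace_max_inverse[OF subring] by auto
    then have "f = 0" by (simp add: fun_eq_iff)
    then show ?thesis by blast
  next
    case ne: False
    then obtain b0 where b0: "b0 \<in> ?B" by blast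
    have "crit_seq R r b0 \<subseteq> Max_R"
      using cd[OF BF[OF b0]] closedin_subset_Max by blast
    then have eq': "crit_seq R r a = \<Inter> (crit_seq R r ` ?B)" unfolding eq using b0 by blast
    have "\<exists>C\<in>crit_seq R r ` ?B. f \<in> vanishing C"
    proof (rule vanishing_chain)
      show "crit_seq R r ` ?B \<noteq> {}" using ne by blast
      show "C \<subseteq> D \<or> D \<subseteq> C" if CD: "C \<in> crit_seq R r ` ?B" "D \<in> crit_seq R r ` ?B" for C D
      proof -
        obtain b c where bc: "b \<in> ?B" "c \<in> ?B" "C = crit_seq R r b" "D = crit_seq R r c" using CD by blast
        then show ?thesis using Well_orderD(1)[OF r BF[OF bc(1)] BF[OF bc(2)]] cd[OF BF[OF bc(1)]] cd[OF BF[OF bc(2)]] by blast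
      qed
      show "closedin (max_inverse R) C" if "C \<in> crit_seq R r ` ?B" for C
        using that cd BF by blast
      show "f \<in> vanishing (\<Inter> (crit_seq R r ` ?B))" using f unfolding eq' .
    qed
    then obtain b where b: "(b, a) \<in> r" "b \<noteq> a" "f \<in> vanishing (crit_seq R r b)" by blast
    \<comment> \<open>The filtration is stated through its upper ends, so stage \<open>b\<close> is
      replaced by its successor, whose critical set is smaller.\<close>
    have p: "is_pred r b (wsucc r b)" by (rule is_pred_wsucc[OF r b(1,2)])
    have "wsucc r b \<in> Field r" using is_predD(1)[OF p] unfolding Field_def by blast
    then have "crit_seq R r (wsucc r b) \<subseteq> crit_seq R r b" using cd is_predD(1)[OF p] by blast
    then have "f \<in> vanishing (crit_seq R r (wsucc r b))" using b(3) vanishing_antimono by blast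
    then show ?thesis using b(1,2) by blast
  qed
qed

text \<open>The filtration starts at 0, the functions vanishing on all maximal ideals, and ends at
  all of \<open>vfuns\<close> because the critical set at \<open>\<alpha>\<close> is empty. Every
  index below \<open>\<alpha>\<close> has a successor, so \<open>wsucc\<close> is meaningful on
  \<open>I\<close>.\<close>

theorem vfuns_basis:
  assumes r: "Well_order r" and \<alpha>: "\<alpha> \<in> Field r" "crit_seq R r \<alpha> = {}"
  defines "I \<equiv> {i. (i, \<alpha>) \<in> r \<and> i \<noteq> \<alpha>}"
    and "Y \<equiv> \<lambda>i. subtopology (max_inverse R) (crit_seq R r i - crit_seq R r (wsucc r i))"
  shows "\<exists>S. rel_basis {0} vfuns (\<Union>i\<in>I. S i) \<and> disjoint_family_on S I \<and>
    (\<forall>i\<in>I. free_Abelian_group (S i) \<cong> Cc_group (Y i))"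
proof -
  have IF: "I \<subseteq> Field r" unfolding I_def Field_def by auto
  have Ir: "(i, \<alpha>) \<in> r" "i \<noteq> \<alpha>" if "i \<in> I" for i using that unfolding I_def by auto
  note cd = crit_seq_closed_decreasing[OF r]
  have "\<exists>S. rel_basis (vanishing (crit_seq R r i)) (vanishing (crit_seq R r (wsucc r i))) S \<and>
      free_Abelian_group S \<cong> Cc_group (Y i)"
    if i: "i \<in> I" for i
    unfolding Y_def crit_seq_wsucc[OF r Ir[OF i]] using cd i IF by (intro vanishing_rel_basis) blast
  then obtain S where S: "\<And>i. i \<in> I \<Longrightarrow> rel_basis (vanishing (crit_seq R r i)) (vanishing (crit_seq R r (wsucc r i))) (S i)"
    "\<And>i. i \<in> I \<Longrightarrow> free_Abelian_group (S i) \<cong> Cc_group (Y i)" by metis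
  have cases: "f \<in> {0} \<or> (\<exists>j\<in>I. (j, a) \<in> r \<and> j \<noteq> a \<and> f \<in> vanishing (crit_seq R r (wsucc r j)))"
    if a: "(a, \<alpha>) \<in> r" and f: "f \<in> vanishing (crit_seq R r a)" for a f
  proof -
    have "a \<in> Field r" using a unfolding Field_def by blast
    from vanishing_crit_seq_cases[OF r this f] show ?thesis
    proof (elim disjE exE conjE)
      fix j assume j: "(j, a) \<in> r" "j \<noteq> a" "f \<in> vanishing (crit_seq R r (wsucc r j))"
      have "(j, \<alpha>) \<in> r" by (rule Well_orderD(3)[OF r j(1) a])
      moreover have "j \<noteq> \<alpha>" using Well_orderD(2)[OF r j(1)] j(2) a by blast
      ultimately show ?thesis unfolding I_def using j by blast
    qed simp
  qed
  have V0: "vanishing {} = vfuns" unfolding vanishing_def by simp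
  have \<alpha>\<alpha>: "(\<alpha>, \<alpha>) \<in> r" using Well_orderD(1)[OF r \<alpha>(1) \<alpha>(1)] by blast
  have "disjoint_family_on S I \<and> rel_basis {0} vfuns (\<Union>i\<in>I. S i)"
  proof (rule rel_basis_filtration[OF r IF, where L = "\<lambda>i. vanishing (crit_seq R r i)"
        and U = "\<lambda>i. vanishing (crit_seq R r (wsucc r i))"])
    show "vanishing (crit_seq R r (wsucc r i)) \<subseteq> vanishing (crit_seq R r j)"
      if "i \<in> I" "j \<in> I" "(i, j) \<in> r" "i \<noteq> j" for i j
    proof (rule vanishing_antimono)
      have "(wsucc r i, j) \<in> r" by (rule is_pred_succ_le[OF r is_pred_wsucc[OF r that(3,4)] that(3,4)])
      then show "crit_seq R r j \<subseteq> crit_seq R r (wsucc r i)" using cd that(2) IF by blast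
    qed
    show "x \<in> {0} \<or> (\<exists>j\<in>I. x \<in> vanishing (crit_seq R r (wsucc r j)))" if "x \<in> vfuns" for x
      using cases[OF \<alpha>\<alpha>, of x] that unfolding \<alpha>(2) V0 by blast
  qed (use subspace_vanishing zmod.subspace_0[OF subspace_vanishing] cases Ir S(1) in \<open>auto simp: vanishing_def\<close>)
  then show ?thesis using S(2) by blast
qed

end

theorem theorem5p9:
  fixes R :: "'k::field set" and r :: "'o rel" and \<alpha> :: 'o
  assumes "almost_dedekind R"
    and "Well_order r"
    and "is_SP_rank R r \<alpha>"
    and "crit_seq R r \<alpha> = {}"
  shows "Inv_group R \<cong> sum_group {i. (i, \<alpha>) \<in> r \<and> i \<noteq> \<alpha>}
           (\<lambda>i. Cc_group (subtopology (max_inverse R)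
                   (crit_seq R r i - crit_seq R r (wsucc r i))))
    \<and> (\<exists>S :: 'k set set. Inv_group R \<cong> free_Abelian_group S)"
proof -
  interpret almost_dedekind_domain R using assms(1) by unfold_locales
  let ?I = "{i. (i, \<alpha>) \<in> r \<and> i \<noteq> \<alpha>}"
  let ?Cc = "\<lambda>i. Cc_group (subtopology (max_inverse R) (crit_seq R r i - crit_seq R r (wsucc r i)))"
  have \<alpha>: "\<alpha> \<in> Field r" using assms(3) unfolding is_SP_rank_def by blast
  obtain S where S: "rel_basis {0} vfuns (\<Union>i\<in>?I. S i)" "disjoint_family_on S ?I"
    "\<And>i. i \<in> ?I \<Longrightarrow> free_Abelian_group (S i) \<cong> ?Cc i"
    using vfuns_basis[OF assms(2) \<alpha> assms(4)] by (elim exE conjE) blast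
  have Inv: "Inv_group R \<cong> add_group vfuns"
    by (rule group.iso_sym[OF group_add_group[OF subspace_vfuns] add_group_vfuns_iso_Inv])
  \<comment> \<open>The type of \<open>T\<close> is left open: it will be the basis itself, for the
    direct sum, and then a set of ideals.\<close>
  have free: "add_group vfuns \<cong> free_Abelian_group T" if "bij_betw e T (\<Union>i\<in>?I. S i)" for e and T :: "'t set"
    by (rule group.iso_sym[OF group_free_Abelian_group free_Abelian_group_iso_add_group[OF subspace_vfuns S(1) that]])
  have "(\<lambda>f. sum' f ?I) \<in> iso (sum_group ?I (\<lambda>i. free_Abelian_group (S i))) (free_Abelian_group (\<Union>(S ` ?I)))"
    using S(2) by (intro iso_free_Abelian_group_sum) (auto simp: pairwise_def disjoint_family_on_def disjnt_def)
  then have "sum_group ?I (\<lambda>i. free_Abelian_group (S i)) \<cong> free_Abelian_group (\<Union>i\<in>?I. S i)"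
    unfolding is_iso_def by blast
  then have sum: "free_Abelian_group (\<Union>i\<in>?I. S i) \<cong> sum_group ?I (\<lambda>i. free_Abelian_group (S i))"
    by (rule group.iso_sym[rotated]) simp
  have "sum_group ?I (\<lambda>i. free_Abelian_group (S i)) \<cong> sum_group ?I ?Cc"
    using S(3) by (rule iso_sum_groupI) (simp_all add: Cc_group_eq_add_group group_add_group subspace_Cc_funs)
  then have "Inv_group R \<cong> sum_group ?I ?Cc"
    using iso_trans[OF Inv iso_trans[OF free[of id] iso_trans[OF sum]]] by simp
  moreover
  have "(\<Union>i\<in>?I. S i) \<subseteq> vfuns" by (rule rel_basisD(1)[OF S(1)])
  \<comment> \<open>The basis consists of functions, whereas the free generators are to form a set
    of type \<open>'k set set\<close>; the injective map \<open>ideal_of\<close> replaces each basis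
    function by its ideal.\<close>
  then have "bij_betw ideal_of (\<Union>i\<in>?I. S i) (ideal_of ` (\<Union>i\<in>?I. S i))"
    using inj_on_ideal_of inj_on_subset unfolding bij_betw_def by blast
  then have "Inv_group R \<cong> free_Abelian_group (ideal_of ` (\<Union>i\<in>?I. S i))"
    by (rule iso_trans[OF Inv free[OF bij_betw_inv_into]])
  then have "\<exists>S :: 'k set set. Inv_group R \<cong> free_Abelian_group S" by blast
  ultimately show ?thesis by blast
qed

end
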